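(* Let $\Sigma\subset\mathbb{R}^d$ be compact. Let $\hat c_1,\hat c_2\in\mathcal{C}_{\mathrm{DRO}}(X\times\mathcal{P}(\Sigma))$ be two DRO predictors with associated ambiguity sets $\mathcal{A}_1(\hat P)$ and $\mathcal{A}_2(\hat P)$ respectively. Then for every $x\in X$ and $\hat P\in\mathcal{P}(\Sigma)$ $$\sup_{\ell\in\mathcal{L}_1}|\hat c_1(x,\hat P)-\hat c_2(x,\hat P)|=\max\left\{\sup_{P\in\mathcal{A}_1(\hat P)}\inf_{Q\in\mathcal{A}_2(\hat P)}W(P,Q),\ \sup_{Q\in\mathcal{A}_2(\hat P)}\inf_{P\in\mathcal{A}_1(\hat P)}W(P,Q)\right\}.$$ In particular, if $r>0$, $\hat c_1$ is a reasonably feasible DRO predictor at rate $r$ and $\hat c_2=\hat c_{\mathrm{KL},r}$, then, for every loss function $\ell$ (upper semicontinuous in $\xi$), every $x\in X$ and $\hat P\in\mathcal{P}(\Sigma)$, $$0\le\hat c_1(x,\hat P)-\hat c_{\mathrm{KL},r}(x,\hat P)\le\left(\sup_{\xi'\ne\xi\in\Sigma}\frac{|\ell(x,\xi')-\ell(x,\xi)|}{\|\xi'-\xi\|}\right)\cdot\sup_{P\in\mathcal{A}_1(\hat P)}\ \inf_{Q\in\mathcal{P}(\Sigma):\,D_{\mathrm{KL}}(\hat P,Q)\le r}W(P,Q),$$ where the right-hand side is read as $+\infty$ if the first supremum is infinite.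
   Context: $X\subseteq\mathbb{R}^m$ is a nonempty set of decisions. $\mathcal{P}(\Sigma)$ is the set of Borel probability measures on $\Sigma$ with the weak topology. For a loss $\ell:X\times\Sigma\to\mathbb{R}$ (bounded below) put $c(x,P):=\int\ell(x,\xi)\,\mathrm{d}P(\xi)$. For $P\in\mathcal{P}(\Sigma)$, $\xi_1,\xi_2,\dots$ are i.i.d. samples from $P$, $P_N:=\frac1N\sum_{i=1}^N\delta_{\xi_i}$, and $\mathrm{Prob}$ is the probability under this sampling; $\log0=-\infty$. DRO predictors: $\mathcal{C}_{\mathrm{DRO}}(X\times\mathcal{P}(\Sigma))$ consists of predictors of the form $\hat c(x,\hat P)=\sup\{c(x,P):P\in\mathcal{A}(\hat P)\}$, where for each $\hat P$ the ambiguity set $\mathcal{A}(\hat P)\subseteq\mathcal{P}(\Sigma)$ is nonempty, (weakly) closed and convex, depends only on $\hat P$ and not on the loss function, and where $\hat P\mapsto\hat c(x,\hat P)$ is upper semicontinuous for each $x\in X$. Thus a fixed ambiguity map $\mathcal{A}$ yields a predictor for each loss function (upper semicontinuity being required for the losses under consideration, in particular for all decision-free losses); in the displayed supremum over $\ell$ the ambiguity sets are fixed and the predictors vary with $\ell$. A loss is decision-free if $\ell(x,\xi)\equiv\ell_0(\xi)$ with $\ell_0:\Sigma\to\mathbb{R}$ continuous. A DRO predictor is reasonably feasible at rate $r$ if for every decision-free loss $\sup_{P\in\mathcal{P}(\Sigma)}\limsup_{N\to\infty}\frac1N\log\mathrm{Prob}[\exists x\in X:c(x,P)>\hat c(x,P_N)]\le-r$.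 $\mathcal{L}_1$ is the set of losses $\ell$ with $|\ell(x,\xi')-\ell(x,\xi)|\le\|\xi'-\xi\|$ for all $\xi,\xi'\in\Sigma$, $x\in X$. $W(P',P)=\inf\{\int\|\xi'-\xi\|\,\mathrm{d}\gamma(\xi',\xi):\gamma\in\Gamma(P',P)\}$ is the Wasserstein distance ($\Gamma(P',P)$: couplings). $D_{\mathrm{KL}}(P',P)=\int\log\frac{\mathrm{d}P'}{\mathrm{d}P}\,\mathrm{d}P'$ if $P'\ll P$ and $+\infty$ otherwise. $\hat c_{\mathrm{KL},r}(x,\hat P)=\sup\{c(x,P):P\in\mathcal{P}(\Sigma),\ D_{\mathrm{KL}}(\hat P,P)\le r\}$. *)

theory Defs
  imports "HOL-Probability.Probability"
begin

abbreviation borel_on :: "'a::topological_space set \<Rightarrow> 'a measure" where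
  "borel_on S \<equiv> restrict_space borel S"

definition probs :: "'a::topological_space set \<Rightarrow> 'a measure set" where
  "probs S = space (prob_algebra (borel_on S))"

lemma in_probs_iff: "P \<in> probs S \<longleftrightarrow> sets P = sets (borel_on S) \<and> prob_space P"
  by (simp add: probs_def space_prob_algebra)

definition weak_topology :: "'a::topological_space set \<Rightarrow> 'a measure topology" where
  "weak_topology S = topology_generated_by
     {{P \<in> probs S. integral\<^sup>L P f \<in> U} | (f :: 'a \<Rightarrow> real) U.
        continuous_on S f \<and> bounded (f ` S) \<and> open U}"

lemma topspace_weak_topology [simp]: "topspace (weak_topology S) = probs S"
proof -
  have "\<exists>(f :: 'a \<Rightarrow> real) U. probs S = {P \<in> probs S. integral\<^sup>L P f \<in> U} \<and>
          continuous_on S f \<and> bounded (f ` S) \<and> open U"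
    by (rule exI[of _ "\<lambda>_. 0"], rule exI[of _ UNIV]) (auto simp: image_constant_conv)
  then show ?thesis
    unfolding weak_topology_def by auto
qed

definition usc_map :: "'a topology \<Rightarrow> ('a \<Rightarrow> real) \<Rightarrow> bool" where
  "usc_map T f \<longleftrightarrow> (\<forall>a. openin T {p \<in> topspace T. f p < a})"

definition mixture :: "real \<Rightarrow> 'a measure \<Rightarrow> 'a measure \<Rightarrow> 'a measure" where
  "mixture t P Q = measure_of (space P) (sets P)
     (\<lambda>B. ennreal t * emeasure P B + ennreal (1 - t) * emeasure Q B)"

definition convex_measures :: "'a measure set \<Rightarrow> bool" where
  "convex_measures \<A> \<longleftrightarrow> (\<forall>P\<in>\<A>. \<forall>Q\<in>\<A>. \<forall>t\<in>{0..1}. mixture t P Q \<in> \<A>)"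

text \<open>Sample indices start at 0: \<open>\<omega> 0, \<dots>, \<omega> (N - 1)\<close> are the first \<open>N\<close> samples.
  The case \<open>N = 0\<close> is irrelevant below, where only limits in \<open>N\<close> occur.\<close>

definition empirical :: "'a::topological_space set \<Rightarrow> nat \<Rightarrow> (nat \<Rightarrow> 'a) \<Rightarrow> 'a measure" where
  "empirical S N \<omega> = measure_of S (sets (borel_on S))
     (\<lambda>B. (\<Sum>i<N. emeasure (return (borel_on S) (\<omega> i)) B) / of_nat N)"

text \<open>Both definitions by \<^const>\<open>measure_of\<close> are non-degenerate (\<^const>\<open>measure_of\<close> silently yields
  the null measure for a set function that is not a measure).\<close>

lemma sets_mixture [simp]: "sets (mixture t P Q) = sets P"
  and space_mixture [simp]: "space (mixture t P Q) = space P"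
  unfolding mixture_def by auto

lemma emeasure_mixture:
  assumes "sets P = sets Q" "B \<in> sets P"
  shows "emeasure (mixture t P Q) B = ennreal t * emeasure P B + ennreal (1 - t) * emeasure Q B"
proof (rule emeasure_measure_of[OF mixture_def])
  show "countably_additive (sets (mixture t P Q))
          (\<lambda>B. ennreal t * emeasure P B + ennreal (1 - t) * emeasure Q B)"
    using assms(1)
    by (auto intro!: countably_additiveI simp: suminf_add[symmetric] ennreal_suminf_cmult
        suminf_emeasure)
qed (use assms sets.space_closed[of P] in \<open>auto simp: positive_def\<close>)

lemma mixture_in_probs:
  assumes "P \<in> probs S" "Q \<in> probs S" "t \<in> {0..1}"
  shows "mixture t P Q \<in> probs S"
proof -
  have s: "sets P = sets Q" and "prob_space P" "prob_space Q"
    using assms by (auto simp: in_probs_iff)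
  then have "emeasure (mixture t P Q) (space P) = ennreal t * 1 + ennreal (1 - t) * 1"
    using prob_space.emeasure_space_1[of P] prob_space.emeasure_space_1[of Q]
      sets_eq_imp_space_eq[OF s] emeasure_mixture[OF s, of "space P" t] by simp
  also have "\<dots> = 1"
    using assms(3) by (simp flip: ennreal_plus)
  finally have "prob_space (mixture t P Q)"
    by (intro prob_spaceI) simp
  then show ?thesis
    using assms(1) by (simp add: in_probs_iff)
qed

lemma sets_empirical [simp]: "sets (empirical S N \<omega>) = sets (borel_on S)"
  and space_empirical [simp]: "space (empirical S N \<omega>) = S"
  using sets.space_closed[of "borel_on S"] sets.sigma_sets_eq[of "borel_on S"]
  unfolding empirical_def by (auto simp: space_restrict_space)

lemma emeasure_empirical:
  assumes "B \<in> sets (borel_on S)"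
  shows "emeasure (empirical S N \<omega>) B = (\<Sum>i<N. indicator B (\<omega> i)) / of_nat N"
proof -
  have "emeasure (empirical S N \<omega>) B =
          (\<Sum>i<N. emeasure (return (borel_on S) (\<omega> i)) B) / of_nat N"
  proof (rule emeasure_measure_of[OF empirical_def])
    show "countably_additive (sets (empirical S N \<omega>))
            (\<lambda>B. (\<Sum>i<N. emeasure (return (borel_on S) (\<omega> i)) B) / of_nat N)"
      by (auto intro!: countably_additiveI simp: ennreal_suminf_divide suminf_sum suminf_emeasure
          simp del: emeasure_return)
  qed (use assms sets.space_closed[of "borel_on S"] in
        \<open>auto simp: positive_def space_restrict_space\<close>)
  then show ?thesis
    using assms by simp
qed

lemma empirical_in_probs:
  assumes "N > 0" "\<And>i. i < N \<Longrightarrow> \<omega> i \<in> S"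
  shows "empirical S N \<omega> \<in> probs S"
proof -
  have "S \<in> sets (borel_on S)"
    using sets.top[of "borel_on S"] by (simp add: space_restrict_space)
  then have "emeasure (empirical S N \<omega>) S = of_nat N / of_nat N"
    using assms(2) by (simp add: emeasure_empirical)
  also have "\<dots> = 1"
    using assms(1) by (simp add: ennreal_divide_self ennreal_of_nat_eq_real_of_nat flip: ennreal_0)
  finally show ?thesis
    by (auto simp: in_probs_iff intro: prob_spaceI)
qed

definition couplings ::
    "'a::topological_space set \<Rightarrow> 'a measure \<Rightarrow> 'a measure \<Rightarrow> ('a \<times> 'a) measure set" where
  "couplings S P' P = {\<gamma>. sets \<gamma> = sets (borel_on S \<Otimes>\<^sub>M borel_on S) \<and> prob_space \<gamma> \<and>
     distr \<gamma> (borel_on S) fst = P' \<and> distr \<gamma> (borel_on S) snd = P}"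

definition wasserstein ::
    "'a::real_normed_vector set \<Rightarrow> 'a measure \<Rightarrow> 'a measure \<Rightarrow> ennreal" where
  "wasserstein S P' P =
     (INF \<gamma>\<in>couplings S P' P. \<integral>\<^sup>+ (\<xi>', \<xi>). ennreal (norm (\<xi>' - \<xi>)) \<partial>\<gamma>)"

text \<open>\<open>D_KL P' P\<close> is the divergence of \<open>P'\<close> from \<open>P\<close>; the library's \<^const>\<open>KL_divergence\<close> and
  \<^const>\<open>entropy_density\<close> take the two measures in the opposite order. As
  \<open>\<integral> log (dP'/dP) dP'\<close> always has an integrable negative part, failure of integrability means
  that its value is \<open>+\<infinity>\<close>, whereas the (real-valued) library integral is then 0 by convention.\<close>

definition D_KL :: "'a measure \<Rightarrow> 'a measure \<Rightarrow> ereal" where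
  "D_KL P' P =
     (if absolutely_continuous P P' \<and> integrable P' (entropy_density (exp 1) P P')
      then ereal (KL_divergence (exp 1) P P') else \<infinity>)"

definition loss :: "'x set \<Rightarrow> 'a set \<Rightarrow> ('x \<Rightarrow> 'a \<Rightarrow> real) \<Rightarrow> bool" where
  "loss X S \<l> \<longleftrightarrow> (\<exists>b. \<forall>x\<in>X. \<forall>\<xi>\<in>S. b \<le> \<l> x \<xi>)"

definition usc_loss :: "'x set \<Rightarrow> 'a::topological_space set \<Rightarrow> ('x \<Rightarrow> 'a \<Rightarrow> real) \<Rightarrow> bool" where
  "usc_loss X S \<l> \<longleftrightarrow> loss X S \<l> \<and> (\<forall>x\<in>X. usc_map (top_of_set S) (\<l> x))"

definition continuous_loss ::
    "'x set \<Rightarrow> 'a::topological_space set \<Rightarrow> ('x \<Rightarrow> 'a \<Rightarrow> real) \<Rightarrow> bool" where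
  "continuous_loss X S \<l> \<longleftrightarrow> loss X S \<l> \<and> (\<forall>x\<in>X. continuous_on S (\<l> x))"

definition decision_free ::
    "'x set \<Rightarrow> 'a::topological_space set \<Rightarrow> ('x \<Rightarrow> 'a \<Rightarrow> real) \<Rightarrow> bool" where
  "decision_free X S \<l> \<longleftrightarrow> loss X S \<l> \<and>
     (\<exists>\<l>\<^sub>0. continuous_on S \<l>\<^sub>0 \<and> (\<forall>x\<in>X. \<forall>\<xi>\<in>S. \<l> x \<xi> = \<l>\<^sub>0 \<xi>))"

definition lipschitz1_losses ::
    "'x set \<Rightarrow> 'a::real_normed_vector set \<Rightarrow> ('x \<Rightarrow> 'a \<Rightarrow> real) set" where
  "lipschitz1_losses X S =
     {\<l>. loss X S \<l> \<and> (\<forall>x\<in>X. \<forall>\<xi>\<in>S. \<forall>\<xi>'\<in>S. \<bar>\<l> x \<xi>' - \<l> x \<xi>\<bar> \<le> norm (\<xi>' - \<xi>))}"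

text \<open>The best Lipschitz constant of \<open>f\<close> on \<open>S\<close>, in \<open>[0, \<infinity>]\<close>; it is 0 if \<open>S\<close> has at most one
  point.\<close>

definition lip_const :: "'a::real_normed_vector set \<Rightarrow> ('a \<Rightarrow> real) \<Rightarrow> ennreal" where
  "lip_const S f =
     (SUP (\<xi>', \<xi>) \<in> {(\<xi>', \<xi>). \<xi>' \<in> S \<and> \<xi> \<in> S \<and> \<xi>' \<noteq> \<xi>}. ennreal (\<bar>f \<xi>' - f \<xi>\<bar> / norm (\<xi>' - \<xi>)))"

definition cost :: "('x \<Rightarrow> 'a \<Rightarrow> real) \<Rightarrow> 'x \<Rightarrow> 'a measure \<Rightarrow> real" where
  "cost \<l> x P = (\<integral>\<xi>. \<l> x \<xi> \<partial>P)"

text \<open>Real-valued supremum: it is only used for losses whose sections \<open>\<l> x\<close> are bounded and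
  measurable on the compact set \<open>S\<close>, and for nonempty ambiguity sets.\<close>

definition dro_predictor ::
    "('a measure \<Rightarrow> 'a measure set) \<Rightarrow> ('x \<Rightarrow> 'a \<Rightarrow> real) \<Rightarrow> 'x \<Rightarrow> 'a measure \<Rightarrow> real" where
  "dro_predictor \<A> \<l> x Phat = (SUP P\<in>\<A> Phat. cost \<l> x P)"

text \<open>A DRO predictor is given by its ambiguity map \<open>\<A>\<close>, which does not depend on the loss. Upper
  semicontinuity of the predictor is demanded for the losses continuous in \<open>\<xi>\<close>; on compact \<open>S\<close>
  these include all decision-free and all 1-Lipschitz losses.\<close>

definition is_dro ::
    "'x set \<Rightarrow> 'a::topological_space set \<Rightarrow> ('a measure \<Rightarrow> 'a measure set) \<Rightarrow> bool" where
  "is_dro X S \<A> \<longleftrightarrow>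
     (\<forall>Phat\<in>probs S. \<A> Phat \<subseteq> probs S \<and> \<A> Phat \<noteq> {} \<and>
        closedin (weak_topology S) (\<A> Phat) \<and> convex_measures (\<A> Phat)) \<and>
     (\<forall>\<l>. continuous_loss X S \<l> \<longrightarrow> (\<forall>x\<in>X. usc_map (weak_topology S) (dro_predictor \<A> \<l> x)))"

definition log0 :: "real \<Rightarrow> ereal" where
  "log0 p = (if p = 0 then -\<infinity> else ereal (ln p))"

text \<open>I.i.d. sampling is modelled on the infinite product space of \<open>P\<close>. For a decision-free loss and
  an upper semicontinuous predictor the event is measurable for every \<open>N > 0\<close>.\<close>

definition disappointment_prob ::
    "'x set \<Rightarrow> 'a::topological_space set \<Rightarrow> ('a measure \<Rightarrow> 'a measure set) \<Rightarrow>
       ('x \<Rightarrow> 'a \<Rightarrow> real) \<Rightarrow> 'a measure \<Rightarrow> nat \<Rightarrow> real" where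
  "disappointment_prob X S \<A> \<l> P N =
     (let \<Omega> = PiM (UNIV :: nat set) (\<lambda>_. P) in
      measure \<Omega> {\<omega> \<in> space \<Omega>. \<exists>x\<in>X. cost \<l> x P > dro_predictor \<A> \<l> x (empirical S N \<omega>)})"

definition reasonably_feasible ::
    "'x set \<Rightarrow> 'a::topological_space set \<Rightarrow> ('a measure \<Rightarrow> 'a measure set) \<Rightarrow> real \<Rightarrow> bool" where
  "reasonably_feasible X S \<A> r \<longleftrightarrow>
     (\<forall>\<l>. decision_free X S \<l> \<longrightarrow>
        (SUP P\<in>probs S. limsup (\<lambda>N. ereal (1 / real N) * log0 (disappointment_prob X S \<A> \<l> P N)))
          \<le> ereal (- r))"

definition KL_ambiguity ::
    "'a::topological_space set \<Rightarrow> real \<Rightarrow> 'a measure \<Rightarrow> 'a measure set" where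
  "KL_ambiguity S r Phat = {P \<in> probs S. D_KL Phat P \<le> ereal r}"

end

theory Submission
  imports Defs
begin

text \<open>Everything rests on the duality \<open>inf\<^sub>Q W(P,Q) = sup\<^sub>F (\<integral>F dP - sup\<^sub>Q \<integral>F dQ)\<close>, where \<open>Q\<close> ranges over a
  convex set and \<open>F\<close> over the 1-Lipschitz functions. After discretising \<open>S\<close> by a finite net it becomes
  a statement on transport plans between finitely many points, where the multiplier of the marginal
  constraint is the potential \<open>F\<close>. As only infima over \<open>Q\<close> are involved, neither closedness of the
  convex set nor weak compactness is used. Duality in both directions gives the Hausdorff distance.

  For the second claim it suffices that a reasonably feasible ambiguity set contains the
  Kullback-Leibler ball; by duality and weak closedness this amounts to comparing worst-case costs
  of Lipschitz functions. If some \<open>P\<close> in the ball had a larger cost than the predictor at \<open>Q\<close>, then, by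
  upper semicontinuity, samples from a slight mixture \<open>R\<close> of \<open>P\<close> with \<open>Q\<close> would disappoint whenever their
  empirical measure is weakly close to \<open>Q\<close>. By the change of measure from \<open>R\<close> to \<open>Q\<close> (the lower bound in
  Sanov's theorem) the probability of that decays at a rate strictly below \<open>r\<close>.\<close>

text \<open>The potential \<open>F\<close> produced by the duality does not depend on the decision,
  so it is itself a decision-free loss. This is why feasibility for decision-free losses alone
  controls whole ambiguity sets, and why decision-free losses already exhaust the supremum over all
  1-Lipschitz losses. Convexity of an ambiguity set is what lets single functions detect a measure
  outside it. The obstacle in the probabilistic half is that the log-likelihood of \<open>Q\<close>
  against \<open>P\<close> is merely integrable. It may be unbounded, so Hoeffding's inequality says
  nothing about its sample mean. The lower bound for disappointment probabilities therefore uses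
  only its expectation, through 1 + y \<le> exp y; concentration is invoked for bounded continuous
  test functions only. Likewise the divergence of \<open>Q\<close> from the mixture \<open>R\<close>
  is never computed. A pointwise inequality between arithmetic and geometric means shows that (1 -
  t) times the log-density of \<open>Q\<close> relative to \<open>P\<close> bounds the one relative
  to \<open>R\<close>, and this bound is all that the change of measure asks for.\<close>

subsection \<open>Transport duality on finite sets\<close>

text \<open>Instead of separating \<open>Z\<close> from the half-line \<open>v = 0, w < \<delta>\<close> by a hyperplane (which would need \<open>Z\<close>
  to be closed), take a near-minimiser of \<open>w + \<kappa>/2 |v|\<^sup>2\<close> for a large penalty \<open>\<kappa>\<close>; the first-order
  condition there exhibits \<open>\<kappa> v\<close> as an approximate multiplier.\<close>

lemma lagrange_multiplier:
  fixes Z :: "(('a \<Rightarrow> real) \<times> real) set"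
  assumes "finite K" "Z \<noteq> {}" "\<delta>' < \<delta>" "D \<ge> 0"
    and conv: "\<And>v w v' w' t. (v, w) \<in> Z \<Longrightarrow> (v', w') \<in> Z \<Longrightarrow> t \<in> {0..1} \<Longrightarrow>
           (\<lambda>j. (1 - t) * v j + t * v' j, (1 - t) * w + t * w') \<in> Z"
    and bdd: "\<And>v w j. (v, w) \<in> Z \<Longrightarrow> j \<in> K \<Longrightarrow> \<bar>v j\<bar> \<le> 1"
    and calm: "\<And>v w. (v, w) \<in> Z \<Longrightarrow> w \<ge> \<delta> - D * (\<Sum>j\<in>K. \<bar>v j\<bar>)"
  shows "\<exists>b. \<forall>(v, w)\<in>Z. w + (\<Sum>j\<in>K. b j * v j) \<ge> \<delta>'"
proof -
  define n where "n = real (card K)"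
  define \<epsilon> where "\<epsilon> = (\<delta> - \<delta>') / 4"
  \<comment> \<open>\<open>\<kappa>\<close> keeps the penalised value above
    \<open>\<delta> - \<epsilon> / 2\<close>: against the penalty, each coordinate of
    \<open>v\<close> gains at most D^2 / (2 \<kappa>). \<open>t\<close> makes the second-order term
    of a step of length \<open>t\<close> at most \<open>\<epsilon>\<close>, each squared difference
    of coordinates being at most 4. The 1 in \<open>n + 1\<close> keeps \<open>t\<close> positive
    when \<open>K\<close> is empty.\<close>
  define \<kappa> where "\<kappa> = 1 + D\<^sup>2 * n / \<epsilon>"
  define t where "t = min 1 (\<epsilon> / (2 * \<kappa> * (n + 1)))"
  define \<Psi> where "\<Psi> = (\<lambda>(v :: 'a \<Rightarrow> real, w). w + \<kappa> / 2 * (\<Sum>j\<in>K. (v j)\<^sup>2))"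
  have n: "n \<ge> 0" and \<epsilon>: "\<epsilon> > 0"
    using assms by (auto simp: n_def \<epsilon>_def)
  have \<kappa>: "\<kappa> \<ge> 1" "D\<^sup>2 * n \<le> \<epsilon> * \<kappa>"
    using n \<epsilon> by (auto simp: \<kappa>_def field_simps)
  have t: "0 < t" "t \<le> 1" "2 * t * \<kappa> * n \<le> \<epsilon>"
  proof -
    have "0 < \<epsilon> / (2 * \<kappa> * (n + 1))" using n \<epsilon> \<kappa> by (auto intro!: divide_pos_pos mult_pos_pos)
    then show "0 < t" "t \<le> 1" by (auto simp: t_def)
    have "t \<le> \<epsilon> / (2 * \<kappa> * (n + 1))" by (simp add: t_def)
    moreover have "2 * \<kappa> * (n + 1) > 0" using n \<kappa> by auto
    ultimately have "t * (2 * \<kappa> * (n + 1)) \<le> \<epsilon>" by (simp only: pos_le_divide_eq)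
    moreover have "2 * t * \<kappa> * n \<le> t * (2 * \<kappa> * (n + 1))" using \<open>0 < t\<close> \<kappa> by (simp add: algebra_simps)
    ultimately show "2 * t * \<kappa> * n \<le> \<epsilon>" by linarith
  qed
  have lower: "\<Psi> z \<ge> \<delta> - \<epsilon> / 2" if "z \<in> Z" for z
  proof -
    obtain v w where z: "z = (v, w)" by fastforce
    have "D * \<bar>x\<bar> - \<kappa> / 2 * x\<^sup>2 \<le> D\<^sup>2 / (2 * \<kappa>)" for x :: real
    proof -
      have "0 \<le> (D - \<kappa> * \<bar>x\<bar>)\<^sup>2 / (2 * \<kappa>)" using \<kappa> by simp
      also have "\<dots> = D\<^sup>2 / (2 * \<kappa>) - D * \<bar>x\<bar> + \<kappa> / 2 * x\<^sup>2"
        using \<kappa> by (simp add: power2_diff power_mult_distrib add_divide_distrib diff_divide_distrib)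
                   (simp add: power2_eq_square)
      finally show ?thesis by simp
    qed
    then have "(\<Sum>j\<in>K. D * \<bar>v j\<bar> - \<kappa> / 2 * (v j)\<^sup>2) \<le> (\<Sum>j\<in>K. D\<^sup>2 / (2 * \<kappa>))"
      by (intro sum_mono)
    also have "\<dots> \<le> \<epsilon> / 2"
      using \<kappa> by (simp add: n_def[symmetric] field_simps)
    finally show ?thesis
      using calm[of v w] that by (simp add: z \<Psi>_def sum_subtractf sum_distrib_left)
  qed
  then have bb: "bdd_below (\<Psi> ` Z)" by (auto intro!: bdd_belowI)
  \<comment> \<open>The tolerance is \<open>t * \<epsilon>\<close> and not
    \<open>\<epsilon>\<close>, because the first-order inequality is divided by \<open>t\<close>
    below.\<close>
  have "(INF z\<in>Z. \<Psi> z) < (INF z\<in>Z. \<Psi> z) + t * \<epsilon>" using t \<epsilon> by simp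
  then obtain z where z: "z \<in> Z" "\<Psi> z < (INF z\<in>Z. \<Psi> z) + t * \<epsilon>"
    using cInf_lessD[of "\<Psi> ` Z"] assms(2) by (metis (no_types, lifting) image_iff image_is_empty)
  obtain v w where vw: "z = (v, w)" by fastforce
  have "w' + (\<Sum>j\<in>K. \<kappa> * v j * v' j) \<ge> \<delta>'" if vw': "(v', w') \<in> Z" for v' w'
  proof -
    define s where "s = (\<Sum>j\<in>K. v j * (v' j - v j))"
    define u where "u = (\<Sum>j\<in>K. (v' j - v j)\<^sup>2)"
    let ?z = "(\<lambda>j. (1 - t) * v j + t * v' j, (1 - t) * w + t * w')"
    have "?z \<in> Z" using conv z vw vw' t by auto
    then have "\<Psi> z - t * \<epsilon> \<le> \<Psi> ?z" using z(2) cINF_lower[OF bb] by fastforce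
    also have "\<Psi> ?z = \<Psi> z + t * (w' - w + \<kappa> * s + t * \<kappa> / 2 * u)"
    proof -
      have "((1 - t) * v j + t * v' j)\<^sup>2 = (v j)\<^sup>2 + 2 * t * (v j * (v' j - v j)) + t\<^sup>2 * (v' j - v j)\<^sup>2" for j
        by (simp add: power2_eq_square algebra_simps)
      then have "(\<Sum>j\<in>K. ((1 - t) * v j + t * v' j)\<^sup>2) = (\<Sum>j\<in>K. (v j)\<^sup>2) + 2 * t * s + t\<^sup>2 * u"
        by (simp add: sum.distrib s_def u_def sum_distrib_left)
      then show ?thesis by (simp add: vw \<Psi>_def algebra_simps power2_eq_square)
    qed
    finally have "0 \<le> t * (\<epsilon> + (w' - w + \<kappa> * s + t * \<kappa> / 2 * u))" by (simp add: algebra_simps)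
    then have 1: "0 \<le> \<epsilon> + (w' - w + \<kappa> * s + t * \<kappa> / 2 * u)"
      using t by (simp add: zero_le_mult_iff)
    have "u \<le> (\<Sum>j\<in>K. 4)"
      unfolding u_def
    proof (rule sum_mono)
      fix j assume "j \<in> K"
      then have "\<bar>v' j - v j\<bar> \<le> 2" using bdd[OF vw'] bdd z vw by fastforce
      then have "(v' j - v j)\<^sup>2 \<le> 2\<^sup>2" by (rule power2_le_iff_abs_le[THEN iffD2, rotated]) simp
      then show "(v' j - v j)\<^sup>2 \<le> 4" by simp
    qed
    then have "t * \<kappa> / 2 * u \<le> t * \<kappa> / 2 * (4 * n)"
      using t \<kappa> by (intro mult_left_mono) (auto simp: n_def)
    also have "\<dots> \<le> \<epsilon>" using t by (simp add: algebra_simps)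
    finally have 2: "t * \<kappa> / 2 * u \<le> \<epsilon>" .
    have 3: "(\<Sum>j\<in>K. \<kappa> * v j * v' j) = \<kappa> * s + \<kappa> * (\<Sum>j\<in>K. (v j)\<^sup>2)"
      by (simp add: s_def sum_distrib_left sum.distrib[symmetric] algebra_simps power2_eq_square)
    \<comment> \<open>Testing against \<open>v'\<close> instead of \<open>v' - v\<close> yields the
      surplus \<kappa> |v|^2. Half of it completes \<open>w\<close> to \<open>\<Psi> z\<close>, the
      other half is dropped.\<close>
    have "0 \<le> \<kappa> * (\<Sum>j\<in>K. (v j)\<^sup>2)" using \<kappa> by (intro mult_nonneg_nonneg sum_nonneg) auto
    then have "w' + (\<Sum>j\<in>K. \<kappa> * v j * v' j) \<ge> \<Psi> z - 2 * \<epsilon>"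
      using 1 2 3 by (simp add: \<Psi>_def vw)
    then show ?thesis using lower[OF z(1)] \<epsilon> unfolding \<epsilon>_def by simp argo
  qed
  then show ?thesis by (intro exI[of _ "\<lambda>j. \<kappa> * v j"]) auto
qed

definition plan :: "'a set \<Rightarrow> ('a \<Rightarrow> real) \<Rightarrow> ('a \<Rightarrow> real) \<Rightarrow> ('a \<Rightarrow> 'a \<Rightarrow> real) \<Rightarrow> bool" where
  "plan K p q \<pi> \<longleftrightarrow> (\<forall>i\<in>K. \<forall>j\<in>K. 0 \<le> \<pi> i j) \<and>
     (\<forall>i\<in>K. (\<Sum>j\<in>K. \<pi> i j) = p i) \<and> (\<forall>j\<in>K. (\<Sum>i\<in>K. \<pi> i j) = q j)"

definition plan_cost :: "'a set \<Rightarrow> ('a \<Rightarrow> 'a \<Rightarrow> real) \<Rightarrow> ('a \<Rightarrow> 'a \<Rightarrow> real) \<Rightarrow> real" where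
  "plan_cost K d \<pi> = (\<Sum>i\<in>K. \<Sum>j\<in>K. d i j * \<pi> i j)"

text \<open>Repairs a plan whose column sums are wrong. Each column keeps the fraction
  \<open>\<rho> j\<close> of its mass that still fits; the mass \<open>l i\<close> released in row
  \<open>i\<close> is shipped to the columns in proportion to their deficits \<open>e j\<close>. The
  mass moved is \<open>E\<close>, at most the total defect, and each unit of it costs at most
  \<open>D\<close>. This is the calmness that \<open>lagrange_multiplier\<close> asks for.\<close>

lemma plan_change_column_sums:
  assumes K: "finite K" and pl: "plan K p c \<pi>"
    and q: "\<And>j. j \<in> K \<Longrightarrow> 0 \<le> q j" and mass: "sum q K = sum c K"
    and d: "\<And>i j. i \<in> K \<Longrightarrow> j \<in> K \<Longrightarrow> 0 \<le> d i j \<and> d i j \<le> D"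
  shows "\<exists>\<pi>'. plan K p q \<pi>' \<and> plan_cost K d \<pi>' \<le> plan_cost K d \<pi> + D * (\<Sum>j\<in>K. \<bar>c j - q j\<bar>)"
proof (cases "K = {}")
  case True
  then show ?thesis by (auto simp: plan_def plan_cost_def)
next
  case False
  have \<pi>: "\<And>i j. i \<in> K \<Longrightarrow> j \<in> K \<Longrightarrow> 0 \<le> \<pi> i j" "\<And>i. i \<in> K \<Longrightarrow> (\<Sum>j\<in>K. \<pi> i j) = p i"
     "\<And>j. j \<in> K \<Longrightarrow> (\<Sum>i\<in>K. \<pi> i j) = c j"
    using pl by (auto simp: plan_def)
  have c: "0 \<le> c j" if "j \<in> K" for j
    using \<pi>(3)[OF that, symmetric] that by (auto intro!: sum_nonneg \<pi>)
  define \<rho> where "\<rho> j = min 1 (q j / c j)" for j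
  define l where "l i = (\<Sum>j\<in>K. \<pi> i j * (1 - \<rho> j))" for i
  define e where "e j = q j - min (c j) (q j)" for j
  define E where "E = sum e K"
  have \<rho>: "0 \<le> \<rho> j" "\<rho> j \<le> 1" "c j * \<rho> j = min (c j) (q j)" if "j \<in> K" for j
    using c[OF that] q[OF that] by (auto simp: \<rho>_def min_def field_simps)
  have l: "0 \<le> l i" if "i \<in> K" for i
    unfolding l_def using \<rho> \<pi> that by (auto intro!: sum_nonneg)
  have e: "0 \<le> e j" "e j \<le> \<bar>c j - q j\<bar>" for j
    by (auto simp: e_def min_def)
  have lE: "sum l K = E"
  proof -
    have "sum l K = (\<Sum>j\<in>K. \<Sum>i\<in>K. \<pi> i j * (1 - \<rho> j))"
      unfolding l_def by (rule sum.swap)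
    also have "\<dots> = (\<Sum>j\<in>K. c j - min (c j) (q j))"
      by (intro sum.cong refl) (simp only: sum_distrib_right[symmetric] \<pi> \<rho>(3)[symmetric], simp add: algebra_simps)
    also have "\<dots> = E" using mass by (simp add: E_def e_def sum_subtractf)
    finally show ?thesis .
  qed
  have E0: "0 \<le> E" by (simp add: E_def e sum_nonneg)
  have l0: "l i = 0" if "E = 0" "i \<in> K" for i
    using lE l that K by (metis sum_nonneg_eq_0_iff)
  have e0: "e i = 0" if "E = 0" "i \<in> K" for i
    using e that K unfolding E_def by (metis sum_nonneg_eq_0_iff)
  \<comment> \<open>For \<open>E = 0\<close> the second summand is 0 by the convention for division
    by 0, in agreement with \<open>l0\<close> and \<open>e0\<close>.\<close>
  define \<pi>' where "\<pi>' i j = \<pi> i j * \<rho> j + l i * e j / E" for i j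
  have "plan K p q \<pi>'"
    unfolding plan_def
  proof (intro conjI ballI)
    fix i j assume "i \<in> K" "j \<in> K"
    then show "0 \<le> \<pi>' i j" using \<pi> \<rho> l e E0 by (auto simp: \<pi>'_def)
  next
    fix i assume i: "i \<in> K"
    have "(\<Sum>j\<in>K. \<pi>' i j) = (\<Sum>j\<in>K. \<pi> i j * \<rho> j) + l i * E / E"
      by (simp add: \<pi>'_def sum.distrib E_def sum_distrib_left sum_divide_distrib)
    also have "l i * E / E = l i" using l0 i by auto
    finally show "(\<Sum>j\<in>K. \<pi>' i j) = p i"
      using \<pi>(2)[OF i] by (simp add: l_def sum.distrib[symmetric] algebra_simps)
  next
    fix j assume j: "j \<in> K"
    have "(\<Sum>i\<in>K. \<pi>' i j) = (\<Sum>i\<in>K. \<pi> i j) * \<rho> j + sum l K * e j / E"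
      by (simp add: \<pi>'_def sum.distrib sum_distrib_right sum_divide_distrib)
    also have "\<dots> = c j * \<rho> j + e j" using e0 j by (auto simp: lE \<pi>)
    finally show "(\<Sum>i\<in>K. \<pi>' i j) = q j" using \<rho>(3)[OF j] by (simp add: e_def)
  qed
  moreover have "plan_cost K d \<pi>' \<le> plan_cost K d \<pi> + D * (\<Sum>j\<in>K. \<bar>c j - q j\<bar>)"
  proof -
    have "d i j * \<pi>' i j \<le> d i j * \<pi> i j + D * (l i * e j / E)" if ij: "i \<in> K" "j \<in> K" for i j
    proof -
      have "d i j * (\<pi> i j * \<rho> j) \<le> d i j * \<pi> i j"
        using d[OF ij] \<pi>(1)[OF ij] \<rho>[OF ij(2)] by (intro mult_left_mono mult_left_le) auto
      moreover have "d i j * (l i * e j / E) \<le> D * (l i * e j / E)"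
        using d[OF ij] l[OF ij(1)] e E0 by (intro mult_right_mono) auto
      ultimately show ?thesis by (simp add: \<pi>'_def algebra_simps)
    qed
    then have "plan_cost K d \<pi>' \<le> (\<Sum>i\<in>K. \<Sum>j\<in>K. d i j * \<pi> i j + D * (l i * e j / E))"
      unfolding plan_cost_def by (intro sum_mono)
    also have "\<dots> = plan_cost K d \<pi> + D * (\<Sum>i\<in>K. \<Sum>j\<in>K. l i * e j / E)"
      by (simp add: plan_cost_def sum.distrib sum_distrib_left)
    also have "(\<Sum>i\<in>K. \<Sum>j\<in>K. l i * e j / E) = sum l K * sum e K / E"
      by (simp add: sum_product sum_divide_distrib)
    also have "\<dots> = E" by (simp add: lE E_def[symmetric])
    also have "D * E \<le> D * (\<Sum>j\<in>K. \<bar>c j - q j\<bar>)"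
      using False d unfolding E_def by (intro mult_left_mono sum_mono e) fastforce
    finally show ?thesis by simp
  qed
  ultimately show ?thesis by blast
qed

text \<open>Relax the second marginal: the column sums of a plan may differ from the target
  \<open>q\<close>, and the set \<open>Z\<close> of pairs (defect, cost) is convex because
  \<open>C\<close> is. By \<open>plan_change_column_sums\<close> the defect lowers the cost by at
  most \<open>D\<close> per unit, so a multiplier \<open>b\<close> exists. Optimising the plan for
  fixed \<open>b\<close> sends each row to its cheapest column, which produces the minimum in the
  statement.\<close>

lemma discrete_transport_duality:
  fixes p :: "'a \<Rightarrow> real"
  assumes K: "finite K" and C: "C \<noteq> {}" and p: "\<And>i. i \<in> K \<Longrightarrow> 0 \<le> p i" "sum p K = 1"
    and q: "\<And>q i. q \<in> C \<Longrightarrow> i \<in> K \<Longrightarrow> 0 \<le> q i" "\<And>q. q \<in> C \<Longrightarrow> sum q K = 1"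
    and conv: "\<And>q q' t. q \<in> C \<Longrightarrow> q' \<in> C \<Longrightarrow> t \<in> {0..1} \<Longrightarrow> (\<lambda>i. (1 - t) * q i + t * q' i) \<in> C"
    and d: "\<And>i j. i \<in> K \<Longrightarrow> j \<in> K \<Longrightarrow> 0 \<le> d i j \<and> d i j \<le> D"
    and lower: "\<And>q \<pi>. q \<in> C \<Longrightarrow> plan K p q \<pi> \<Longrightarrow> \<delta> \<le> plan_cost K d \<pi>"
    and "\<delta>' < \<delta>"
  shows "\<exists>b. \<forall>q\<in>C. (\<Sum>i\<in>K. p i * (MIN j\<in>K. b j + d i j)) - (\<Sum>j\<in>K. b j * q j) \<ge> \<delta>'"
proof -
  define col where "col \<pi> j = (\<Sum>i\<in>K. \<pi> i j)" for \<pi> :: "'a \<Rightarrow> 'a \<Rightarrow> real" and j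
  define Z where "Z = {(\<lambda>j. col \<pi> j - q j, plan_cost K d \<pi>) | \<pi> q. q \<in> C \<and> plan K p (col \<pi>) \<pi>}"
  have K0: "K \<noteq> {}" using p by auto
  have D: "D \<ge> 0" using K0 d by fastforce
  have col: "0 \<le> col \<pi> j" "sum (col \<pi>) K = 1" if "plan K p (col \<pi>) \<pi>" "j \<in> K" for \<pi> j
  proof -
    show "0 \<le> col \<pi> j" using that by (auto simp: col_def plan_def intro!: sum_nonneg)
    have "sum (col \<pi>) K = (\<Sum>i\<in>K. \<Sum>j\<in>K. \<pi> i j)" unfolding col_def by (rule sum.swap)
    then show "sum (col \<pi>) K = 1" using that p by (simp add: plan_def)
  qed
  have le1: "r j \<le> 1" if "sum r K = 1" "\<And>i. i \<in> K \<Longrightarrow> 0 \<le> r i" "j \<in> K" for r :: "'a \<Rightarrow> real" and j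
    using member_le_sum[of j K r] that K by auto
  have "\<exists>b. \<forall>(v, w)\<in>Z. w + (\<Sum>j\<in>K. b j * v j) \<ge> \<delta>'"
  proof (rule lagrange_multiplier[OF K _ \<open>\<delta>' < \<delta>\<close> D])
    obtain q0 where q0: "q0 \<in> C" using C by auto
    have "col (\<lambda>i j. p i * q0 j) j = q0 j" for j
      using p by (simp add: col_def sum_distrib_right[symmetric])
    moreover have "plan K p q0 (\<lambda>i j. p i * q0 j)"
      using p q q0 by (auto simp: plan_def sum_distrib_right[symmetric] sum_distrib_left[symmetric])
    ultimately have "plan K p (col (\<lambda>i j. p i * q0 j)) (\<lambda>i j. p i * q0 j)"
      by (simp add: plan_def)
    then show "Z \<noteq> {}" using q0 unfolding Z_def by blast
  next
    fix v w v' w' and t :: real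
    assume "(v, w) \<in> Z" "(v', w') \<in> Z" and t: "t \<in> {0..1}"
    then obtain \<pi> q \<pi>' q' where *: "v = (\<lambda>j. col \<pi> j - q j)" "w = plan_cost K d \<pi>" "q \<in> C"
       "v' = (\<lambda>j. col \<pi>' j - q' j)" "w' = plan_cost K d \<pi>'" "q' \<in> C"
       "plan K p (col \<pi>) \<pi>" "plan K p (col \<pi>') \<pi>'"
      by (auto simp: Z_def)
    let ?\<pi> = "\<lambda>i j. (1 - t) * \<pi> i j + t * \<pi>' i j" and ?q = "\<lambda>i. (1 - t) * q i + t * q' i"
    have c: "col ?\<pi> = (\<lambda>j. (1 - t) * col \<pi> j + t * col \<pi>' j)"
      by (simp add: col_def fun_eq_iff sum.distrib sum_distrib_left)
    have "plan K p (col ?\<pi>) ?\<pi>"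
      unfolding plan_def
    proof (intro conjI ballI)
      fix i j assume "i \<in> K" "j \<in> K"
      then show "0 \<le> ?\<pi> i j" using *(7,8) t by (auto simp: plan_def)
    next
      fix i assume "i \<in> K"
      then have "(\<Sum>j\<in>K. \<pi> i j) = p i" "(\<Sum>j\<in>K. \<pi>' i j) = p i"
        using *(7,8) by (auto simp: plan_def)
      then have "(\<Sum>j\<in>K. ?\<pi> i j) = (1 - t) * p i + t * p i"
        by (simp add: sum.distrib sum_distrib_left[symmetric])
      then show "(\<Sum>j\<in>K. ?\<pi> i j) = p i" by (simp add: algebra_simps)
    next
      fix j
      show "(\<Sum>i\<in>K. ?\<pi> i j) = col ?\<pi> j" by (simp add: col_def)
    qed
    moreover have "?q \<in> C" using conv * t by auto
    moreover have "plan_cost K d ?\<pi> = (1 - t) * w + t * w'"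
      by (simp add: plan_cost_def * sum.distrib[symmetric] sum_distrib_left algebra_simps)
    moreover have "(\<lambda>j. (1 - t) * v j + t * v' j) = (\<lambda>j. col ?\<pi> j - ?q j)"
      unfolding c *(1,4) by (rule ext) (simp add: algebra_simps)
    ultimately show "(\<lambda>j. (1 - t) * v j + t * v' j, (1 - t) * w + t * w') \<in> Z"
      unfolding Z_def by (auto intro!: exI[of _ ?\<pi>] exI[of _ ?q])
  next
    fix v w j assume "(v, w) \<in> Z" and j: "j \<in> K"
    then obtain \<pi> q' where *: "v = (\<lambda>j. col \<pi> j - q' j)" "q' \<in> C" "plan K p (col \<pi>) \<pi>"
      by (auto simp: Z_def)
    have "0 \<le> col \<pi> j" "col \<pi> j \<le> 1" "0 \<le> q' j" "q' j \<le> 1"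
      using col[OF *(3)] q *(2) j by (auto intro!: le1)
    then show "\<bar>v j\<bar> \<le> 1" by (simp add: *)
  next
    fix v w assume "(v, w) \<in> Z"
    then obtain \<pi> q' where *: "v = (\<lambda>j. col \<pi> j - q' j)" "w = plan_cost K d \<pi>" "q' \<in> C" "plan K p (col \<pi>) \<pi>"
      by (auto simp: Z_def)
    obtain \<pi>' where "plan K p q' \<pi>'" 
      "plan_cost K d \<pi>' \<le> plan_cost K d \<pi> + D * (\<Sum>j\<in>K. \<bar>col \<pi> j - q' j\<bar>)"
      using plan_change_column_sums[OF K *(4), of q' d D] q *(3) d col[OF *(4)] K0 by fastforce
    then show "\<delta> - D * (\<Sum>j\<in>K. \<bar>v j\<bar>) \<le> w"
      using lower[OF *(3)] by (fastforce simp: *)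
  qed
  then obtain b where b: "\<And>v w. (v, w) \<in> Z \<Longrightarrow> w + (\<Sum>j\<in>K. b j * v j) \<ge> \<delta>'" by blast
  have "(\<Sum>i\<in>K. p i * (MIN j\<in>K. b j + d i j)) - (\<Sum>j\<in>K. b j * q' j) \<ge> \<delta>'" if "q' \<in> C" for q'
  proof -
    have "\<exists>j\<in>K. (MIN j\<in>K. b j + d i j) = b j + d i j" for i
    proof -
      have "(MIN j\<in>K. b j + d i j) \<in> (\<lambda>j. b j + d i j) ` K"
        using K K0 by (intro Min_in) auto
      then show ?thesis by blast
    qed
    then obtain T where T: "\<And>i. T i \<in> K" "\<And>i. (MIN j\<in>K. b j + d i j) = b (T i) + d i (T i)"
      by metis
    \<comment> \<open>Testing the multiplier on the plan that moves all mass at \<open>i\<close> to the minimiser \<open>T i\<close>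
      replaces \<open>b\<close> by its inf-convolution with \<open>d\<close>.\<close>
    define \<pi> where "\<pi> i j = (if j = T i then p i else 0)" for i j
    have "plan K p (col \<pi>) \<pi>"
      using K T p by (auto simp: plan_def col_def \<pi>_def)
    then have "\<delta>' \<le> plan_cost K d \<pi> + (\<Sum>j\<in>K. b j * (col \<pi> j - q' j))"
      using b that unfolding Z_def by blast
    also have "(\<Sum>j\<in>K. b j * (col \<pi> j - q' j)) = (\<Sum>j\<in>K. \<Sum>i\<in>K. b j * \<pi> i j) - (\<Sum>j\<in>K. b j * q' j)"
      by (simp add: col_def right_diff_distrib sum_subtractf sum_distrib_left)
    also have "(\<Sum>j\<in>K. \<Sum>i\<in>K. b j * \<pi> i j) = (\<Sum>i\<in>K. \<Sum>j\<in>K. b j * \<pi> i j)" by (rule sum.swap)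
    also have "\<dots> = (\<Sum>i\<in>K. b (T i) * p i)"
      using K T by (intro sum.cong refl) (simp add: \<pi>_def if_distrib cong: if_cong)
    also have "plan_cost K d \<pi> = (\<Sum>i\<in>K. d i (T i) * p i)"
      unfolding plan_cost_def
      using K T by (intro sum.cong refl) (simp add: \<pi>_def if_distrib cong: if_cong)
    finally show ?thesis by (simp add: T sum.distrib algebra_simps)
  qed
  then show ?thesis by blast
qed

subsection \<open>Wasserstein distance and separation\<close>

lemma space_borel_on [simp]: "space (borel_on S) = S"
  by (simp add: space_restrict_space)

lemma space_probs: "P \<in> probs S \<Longrightarrow> space P = S"
  using sets_eq_imp_space_eq[of P "borel_on S"] by (simp add: in_probs_iff)

lemma integrable_probs:
  fixes f :: "'a::topological_space \<Rightarrow> real"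
  assumes "P \<in> probs S" "f \<in> borel_measurable (borel_on S)" "bounded (f ` S)"
  shows "integrable P f"
proof -
  interpret prob_space P using assms(1) by (simp add: in_probs_iff)
  obtain B where "\<And>x. x \<in> S \<Longrightarrow> norm (f x) \<le> B"
    using assms(3) by (auto simp: bounded_iff)
  moreover have "f \<in> borel_measurable P"
    using assms(1,2) by (simp add: in_probs_iff cong: measurable_cong_sets)
  ultimately show ?thesis
    using space_probs[OF assms(1)] by (intro integrable_const_bound[of _ B]) auto
qed

lemma measurable_norm_diff [measurable]:
  fixes S :: "'a::{real_normed_vector, second_countable_topology} set"
  shows "(\<lambda>(x, y). norm (x - y)) \<in> borel_measurable (borel_on S \<Otimes>\<^sub>M borel_on S)"
proof -
  have id: "(\<lambda>x. x) \<in> borel_on S \<rightarrow>\<^sub>M borel"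
    by (auto intro: measurable_restrict_space1)
  have [measurable]: "fst \<in> borel_on S \<Otimes>\<^sub>M borel_on S \<rightarrow>\<^sub>M borel" "snd \<in> borel_on S \<Otimes>\<^sub>M borel_on S \<rightarrow>\<^sub>M borel"
    by (rule measurable_compose[OF measurable_fst id], rule measurable_compose[OF measurable_snd id])
  show ?thesis unfolding case_prod_beta by measurable
qed

text \<open>With \<open>e = 0\<close> this is the easy half of Kantorovich duality. The slack
  \<open>e\<close> admits merely continuous test functions, which on a compact set are Lipschitz up
  to an arbitrarily small error.\<close>

lemma coupling_integral_bound:
  fixes S :: "'a::{real_normed_vector, second_countable_topology} set"
  assumes \<gamma>: "\<gamma> \<in> couplings S P Q" and f: "f \<in> borel_measurable (borel_on S)" "bounded (f ` S)"
    and lip: "\<And>x y. x \<in> S \<Longrightarrow> y \<in> S \<Longrightarrow> \<bar>f x - f y\<bar> \<le> e + L * norm (x - y)"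
    and "e \<ge> 0" "L \<ge> 0"
  shows "ennreal \<bar>integral\<^sup>L P f - integral\<^sup>L Q f\<bar> \<le>
           ennreal e + ennreal L * (\<integral>\<^sup>+ (\<xi>', \<xi>). ennreal (norm (\<xi>' - \<xi>)) \<partial>\<gamma>)"
proof -
  have s[measurable_cong]: "sets \<gamma> = sets (borel_on S \<Otimes>\<^sub>M borel_on S)" and "prob_space \<gamma>"
     and PQ: "distr \<gamma> (borel_on S) fst = P" "distr \<gamma> (borel_on S) snd = Q"
    using \<gamma> by (auto simp: couplings_def)
  interpret prob_space \<gamma> by fact
  note f(1)[measurable]
  have sp: "space \<gamma> = S \<times> S"
    using sets_eq_imp_space_eq[OF s] by (simp add: space_pair_measure)
  obtain B where B: "\<And>x. x \<in> S \<Longrightarrow> norm (f x) \<le> B"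
    using f(2) by (auto simp: bounded_iff)
  have i: "integrable \<gamma> (\<lambda>z. f (fst z))" "integrable \<gamma> (\<lambda>z. f (snd z))"
    by (auto intro!: integrable_const_bound[of _ B] B simp: sp)
  have "integral\<^sup>L P f = (\<integral>z. f (fst z) \<partial>\<gamma>)" "integral\<^sup>L Q f = (\<integral>z. f (snd z) \<partial>\<gamma>)"
    unfolding PQ[symmetric] by (auto intro!: integral_distr)
  then have "\<bar>integral\<^sup>L P f - integral\<^sup>L Q f\<bar> = norm (\<integral>z. f (fst z) - f (snd z) \<partial>\<gamma>)"
    using i by simp
  also have "ennreal \<dots> \<le> (\<integral>\<^sup>+ z. norm (f (fst z) - f (snd z)) \<partial>\<gamma>)"
    using i by (intro integral_norm_bound_ennreal) auto
  also have "\<dots> \<le> (\<integral>\<^sup>+ z. ennreal e + ennreal L * (case z of (x, y) \<Rightarrow> ennreal (norm (x - y))) \<partial>\<gamma>)"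
    using assms(5,6) by (intro nn_integral_mono)
      (auto simp: sp ennreal_mult[symmetric] ennreal_plus[symmetric] simp del: ennreal_plus intro!: ennreal_leI lip)
  also have "\<dots> = ennreal e + ennreal L * (\<integral>\<^sup>+ (\<xi>', \<xi>). ennreal (norm (\<xi>' - \<xi>)) \<partial>\<gamma>)"
    by (subst nn_integral_add) (auto simp: nn_integral_cmult emeasure_space_1)
  finally show ?thesis .
qed

lemma wasserstein_ge_integral_diff:
  fixes S :: "'a::{real_normed_vector, second_countable_topology} set"
  assumes f: "f \<in> borel_measurable (borel_on S)" "bounded (f ` S)"
    and lip: "\<And>x y. x \<in> S \<Longrightarrow> y \<in> S \<Longrightarrow> \<bar>f x - f y\<bar> \<le> e + L * norm (x - y)"
    and "e \<ge> 0" "L > 0"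
  shows "ennreal ((\<bar>integral\<^sup>L P f - integral\<^sup>L Q f\<bar> - e) / L) \<le> wasserstein S P Q"
  unfolding wasserstein_def
proof (rule INF_greatest)
  fix \<gamma> assume \<gamma>: "\<gamma> \<in> couplings S P Q"
  let ?c = "\<integral>\<^sup>+ (\<xi>', \<xi>). ennreal (norm (\<xi>' - \<xi>)) \<partial>\<gamma>"
  show "ennreal ((\<bar>integral\<^sup>L P f - integral\<^sup>L Q f\<bar> - e) / L) \<le> ?c"
  proof (cases ?c)
    case (real c)
    have "ennreal \<bar>integral\<^sup>L P f - integral\<^sup>L Q f\<bar> \<le> ennreal e + ennreal L * ennreal c"
      using coupling_integral_bound[OF \<gamma> f lip] assms(4,5) real by simp
    also have "\<dots> = ennreal (e + L * c)"
      using assms(4,5) real by (simp add: ennreal_mult)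
    finally have "\<bar>integral\<^sup>L P f - integral\<^sup>L Q f\<bar> \<le> e + L * c"
      using assms(4,5) real by (subst (asm) ennreal_le_iff) auto
    then have "(\<bar>integral\<^sup>L P f - integral\<^sup>L Q f\<bar> - e) / L \<le> c"
      using assms(5) by (simp add: field_simps)
    then show ?thesis unfolding real by (intro ennreal_leI)
  qed simp
qed

lemma wasserstein_ge_lipschitz:
  fixes S :: "'a::{real_normed_vector, second_countable_topology} set"
  assumes f: "f \<in> borel_measurable (borel_on S)" "bounded (f ` S)"
    and lip: "\<And>x y. x \<in> S \<Longrightarrow> y \<in> S \<Longrightarrow> \<bar>f x - f y\<bar> \<le> L * norm (x - y)" and "L > 0"
  shows "ennreal \<bar>integral\<^sup>L P f - integral\<^sup>L Q f\<bar> \<le> ennreal L * wasserstein S P Q"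
proof -
  have "ennreal L * ennreal (\<bar>integral\<^sup>L P f - integral\<^sup>L Q f\<bar> / L) \<le> ennreal L * wasserstein S P Q"
    using wasserstein_ge_integral_diff[OF f, of 0 L P Q] lip \<open>L > 0\<close> by (intro mult_left_mono) auto
  then show ?thesis using \<open>L > 0\<close> by (simp add: ennreal_mult'[symmetric])
qed

lemma wasserstein_commute:
  fixes S :: "'a::{real_normed_vector, second_countable_topology} set"
  shows "wasserstein S P Q = wasserstein S Q P"
proof -
  have "wasserstein S Q P \<le> wasserstein S P Q" for P Q
    unfolding wasserstein_def[of S P Q]
  proof (rule INF_greatest)
    fix \<gamma> assume \<gamma>: "\<gamma> \<in> couplings S P Q"
    have s[measurable_cong]: "sets \<gamma> = sets (borel_on S \<Otimes>\<^sub>M borel_on S)" and ps: "prob_space \<gamma>"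
       and PQ: "distr \<gamma> (borel_on S) fst = P" "distr \<gamma> (borel_on S) snd = Q"
      using \<gamma> by (auto simp: couplings_def)
    let ?\<gamma> = "distr \<gamma> (borel_on S \<Otimes>\<^sub>M borel_on S) (\<lambda>(x, y). (y, x))"
    have "?\<gamma> \<in> couplings S Q P"
      unfolding couplings_def using PQ
      by (auto simp: distr_distr comp_def case_prod_beta intro!: prob_space.prob_space_distr[OF ps])
    then have "wasserstein S Q P \<le> (\<integral>\<^sup>+ (\<xi>', \<xi>). ennreal (norm (\<xi>' - \<xi>)) \<partial>?\<gamma>)"
      unfolding wasserstein_def by (rule INF_lower)
    also have "\<dots> = (\<integral>\<^sup>+ (\<xi>', \<xi>). ennreal (norm (\<xi>' - \<xi>)) \<partial>\<gamma>)"
      by (subst nn_integral_distr) (simp_all add: split_beta' norm_minus_commute)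
    finally show "wasserstein S Q P \<le> (\<integral>\<^sup>+ (\<xi>', \<xi>). ennreal (norm (\<xi>' - \<xi>)) \<partial>\<gamma>)" .
  qed
  then show ?thesis by (intro antisym)
qed

section \<open>Discretisation by finite nets and the separating potential\<close>

lemma finite_net_map:
  fixes S :: "'a::real_normed_vector set"
  assumes "compact S" "\<epsilon> > 0"
  obtains K \<tau> where "finite K" "K \<subseteq> S" "\<tau> \<in> borel_on S \<rightarrow>\<^sub>M count_space UNIV"
    "\<And>x. x \<in> S \<Longrightarrow> \<tau> x \<in> K \<and> norm (x - \<tau> x) \<le> \<epsilon>"
proof -
  obtain K where K: "finite K" "K \<subseteq> S" "S \<subseteq> (\<Union>x\<in>K. ball x \<epsilon>)"
    using compactE_image[OF assms(1), of S "\<lambda>x. ball x \<epsilon>"] assms(2) by force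
  obtain xs where xs: "set xs = K" using K finite_list by blast
  define P where "P n x \<longleftrightarrow> n < length xs \<and> dist (xs ! n) x < \<epsilon>" for n x
  \<comment> \<open>Choosing the first net point in a fixed enumeration whose ball contains
    \<open>x\<close>, instead of a nearest one, breaks ties and gives measurability through
    \<open>measurable_Least\<close>.\<close>
  define \<tau> where "\<tau> x = xs ! (LEAST n. P n x)" for x
  have [measurable]: "(\<lambda>x. P n x) \<in> borel_on S \<rightarrow>\<^sub>M count_space UNIV" for n
  proof -
    have "open {x. dist (xs ! n) x < \<epsilon>}" by (intro open_Collect_less continuous_intros)
    then have "Measurable.pred borel (\<lambda>x. dist (xs ! n) x < \<epsilon>)" by (simp add: pred_def borel_open)
    then have "Measurable.pred borel (P n)" unfolding P_def by measurable
    then show ?thesis by (rule measurable_restrict_space1)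
  qed
  have "\<tau> \<in> borel_on S \<rightarrow>\<^sub>M count_space UNIV"
    unfolding \<tau>_def by (rule measurable_compose[OF measurable_Least]) simp_all
  moreover have "\<tau> x \<in> K \<and> norm (x - \<tau> x) \<le> \<epsilon>" if "x \<in> S" for x
  proof -
    have "\<exists>n. P n x" using K(3) that unfolding P_def xs[symmetric]
      by (fastforce simp: in_set_conv_nth)
    then have "P (LEAST n. P n x) x" by (rule LeastI_ex)
    then show ?thesis unfolding P_def \<tau>_def xs[symmetric] by (auto simp: dist_norm norm_minus_commute)
  qed
  ultimately show ?thesis using K that by blast
qed

lemma integral_finite_range:
  fixes f :: "'a \<Rightarrow> real"
  assumes "finite_measure M" and [measurable]: "\<tau> \<in> M \<rightarrow>\<^sub>M count_space UNIV"
    and "finite K" "\<And>x. x \<in> space M \<Longrightarrow> \<tau> x \<in> K"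
  shows "(\<integral>x. f (\<tau> x) \<partial>M) = (\<Sum>i\<in>K. measure M (\<tau> -` {i} \<inter> space M) * f i)"
proof -
  interpret finite_measure M by fact
  have "(\<integral>x. f (\<tau> x) \<partial>M) = (\<integral>x. (\<Sum>i\<in>K. indicator (\<tau> -` {i} \<inter> space M) x * f i) \<partial>M)"
  proof (rule Bochner_Integration.integral_cong[OF refl])
    fix x assume x: "x \<in> space M"
    then have "(\<Sum>i\<in>K. indicator (\<tau> -` {i} \<inter> space M) x * f i) = (\<Sum>i\<in>K. if i = \<tau> x then f i else 0)"
      by (intro sum.cong) (auto simp: indicator_def)
    then show "f (\<tau> x) = (\<Sum>i\<in>K. indicator (\<tau> -` {i} \<inter> space M) x * f i)"
      using assms(3,4) x by simp
  qed
  also have "\<dots> = (\<Sum>i\<in>K. \<integral>x. indicator (\<tau> -` {i} \<inter> space M) x * f i \<partial>M)"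
  proof (rule Bochner_Integration.integral_sum)
    fix i
    have "\<tau> -` {i} \<inter> space M \<in> sets M" by measurable
    then show "integrable M (\<lambda>x. indicator (\<tau> -` {i} \<inter> space M) x * f i)"
      by (intro integrable_mult_left integrable_real_indicator) (simp_all add: less_top[symmetric])
  qed
  also have "\<dots> = (\<Sum>i\<in>K. measure M (\<tau> -` {i} \<inter> space M) * f i)"
    by simp
  finally show ?thesis .
qed

lemma emeasure_finite_partition:
  assumes [measurable]: "\<tau> \<in> M \<rightarrow>\<^sub>M count_space UNIV"
    and "finite K" "\<And>x. x \<in> space M \<Longrightarrow> \<tau> x \<in> K" and A [measurable]: "A \<in> sets M"
  shows "(\<Sum>i\<in>K. emeasure M (A \<inter> (\<tau> -` {i} \<inter> space M))) = emeasure M A"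
proof -
  have "(\<Sum>i\<in>K. emeasure M (A \<inter> (\<tau> -` {i} \<inter> space M))) = emeasure M (\<Union>i\<in>K. A \<inter> (\<tau> -` {i} \<inter> space M))"
    using assms(2) by (intro sum_emeasure) (auto simp: disjoint_family_on_def)
  also have "(\<Union>i\<in>K. A \<inter> (\<tau> -` {i} \<inter> space M)) = A"
    using assms(3) sets.sets_into_space[OF A] by auto
  finally show ?thesis .
qed

lemma pair_finite_range_expansion:
  fixes u :: "'a \<Rightarrow> 'b \<Rightarrow> ennreal"
  assumes K: "finite K" "\<And>x. x \<in> space M \<Longrightarrow> \<tau> x \<in> K" and L: "finite L" "\<And>x. x \<in> space N \<Longrightarrow> \<sigma> x \<in> L"
    and z: "z \<in> space (M \<Otimes>\<^sub>M N)"
  shows "u (\<tau> (fst z)) (\<sigma> (snd z)) * indicator (A \<times> B) z =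
    (\<Sum>i\<in>K. \<Sum>j\<in>L. u i j * indicator ((A \<inter> (\<tau> -` {i} \<inter> space M)) \<times> (B \<inter> (\<sigma> -` {j} \<inter> space N))) z)"
proof -
  let ?X = "\<lambda>i. A \<inter> (\<tau> -` {i} \<inter> space M)" and ?Y = "\<lambda>j. B \<inter> (\<sigma> -` {j} \<inter> space N)"
  obtain x y where xy: "z = (x, y)" "x \<in> space M" "y \<in> space N"
    using z by (auto simp: space_pair_measure)
  have "(\<Sum>i\<in>K. \<Sum>j\<in>L. u i j * indicator (?X i \<times> ?Y j) z) =
      (\<Sum>i\<in>K. if i = \<tau> x then (\<Sum>j\<in>L. if j = \<sigma> y then u i j * indicator (A \<times> B) z else 0) else 0)"
    using xy by (intro sum.cong refl) (auto simp: indicator_def intro!: sum.cong sum.neutral[symmetric])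
  also have "\<dots> = u (\<tau> x) (\<sigma> y) * indicator (A \<times> B) z"
    using K L xy by simp
  finally show ?thesis by (simp add: xy)
qed

text \<open>No measurability is known of \<open>u\<close>; the integrand is measurable because it is
  a finite combination of indicators of rectangles. The factor
  \<open>indicator (A \<times> B)\<close> lets the same formula give both the mass of a rectangle
  and, for full \<open>A\<close> and \<open>B\<close>, the transport cost.\<close>

lemma nn_integral_pair_finite_range:
  fixes u :: "'a \<Rightarrow> 'b \<Rightarrow> ennreal"
  assumes "sigma_finite_measure N"
    and [measurable]: "\<tau> \<in> M \<rightarrow>\<^sub>M count_space UNIV" "\<sigma> \<in> N \<rightarrow>\<^sub>M count_space UNIV"
    and K: "finite K" "\<And>x. x \<in> space M \<Longrightarrow> \<tau> x \<in> K" and L: "finite L" "\<And>x. x \<in> space N \<Longrightarrow> \<sigma> x \<in> L"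
    and A [measurable]: "A \<in> sets M" and B [measurable]: "B \<in> sets N"
  shows "(\<lambda>z. u (\<tau> (fst z)) (\<sigma> (snd z)) * indicator (A \<times> B) z) \<in> borel_measurable (M \<Otimes>\<^sub>M N)" (is ?meas)
    and "(\<integral>\<^sup>+ z. u (\<tau> (fst z)) (\<sigma> (snd z)) * indicator (A \<times> B) z \<partial>(M \<Otimes>\<^sub>M N)) =
    (\<Sum>i\<in>K. \<Sum>j\<in>L. u i j * (emeasure M (A \<inter> (\<tau> -` {i} \<inter> space M)) * emeasure N (B \<inter> (\<sigma> -` {j} \<inter> space N))))" (is ?int)
proof -
  interpret N: sigma_finite_measure N by fact
  let ?X = "\<lambda>i. A \<inter> (\<tau> -` {i} \<inter> space M)" and ?Y = "\<lambda>j. B \<inter> (\<sigma> -` {j} \<inter> space N)"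
  have X [measurable]: "?X i \<in> sets M" "?Y j \<in> sets N" for i j by measurable
  note * = pair_finite_range_expansion[where \<tau> = \<tau> and \<sigma> = \<sigma>, OF K L]
  have "(\<lambda>z. (\<Sum>i\<in>K. \<Sum>j\<in>L. u i j * indicator (?X i \<times> ?Y j) z)) \<in> borel_measurable (M \<Otimes>\<^sub>M N)" by measurable
  then show ?meas by (subst measurable_cong[OF *])
  have "(\<integral>\<^sup>+ z. u (\<tau> (fst z)) (\<sigma> (snd z)) * indicator (A \<times> B) z \<partial>(M \<Otimes>\<^sub>M N)) =
     (\<integral>\<^sup>+ z. (\<Sum>i\<in>K. \<Sum>j\<in>L. u i j * indicator (?X i \<times> ?Y j) z) \<partial>(M \<Otimes>\<^sub>M N))"
    by (intro nn_integral_cong *)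
  also have "\<dots> = (\<Sum>i\<in>K. \<integral>\<^sup>+ z. (\<Sum>j\<in>L. u i j * indicator (?X i \<times> ?Y j) z) \<partial>(M \<Otimes>\<^sub>M N))"
    by (rule nn_integral_sum) measurable
  also have "\<dots> = (\<Sum>i\<in>K. \<Sum>j\<in>L. \<integral>\<^sup>+ z. u i j * indicator (?X i \<times> ?Y j) z \<partial>(M \<Otimes>\<^sub>M N))"
    by (intro sum.cong refl nn_integral_sum) measurable
  also have "\<dots> = (\<Sum>i\<in>K. \<Sum>j\<in>L. u i j * (emeasure M (?X i) * emeasure N (?Y j)))"
    by (intro sum.cong refl)
       (subst nn_integral_cmult_indicator, simp, simp only: N.emeasure_pair_measure_Times X)
  finally show ?int .
qed

text \<open>A plan between the cell masses is lifted to a coupling of \<open>P\<close> and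
  \<open>Q\<close> themselves. Its marginals are exact; only the cost is approximate, since going
  from x to y through the net points \<open>\<tau> x\<close> and \<open>\<tau> y\<close> adds at
  most \<open>\<epsilon>\<close> at either end. Building the coupling directly avoids gluing
  couplings for a triangle inequality.\<close>

lemma wasserstein_le_plan_cost:
  fixes S :: "'a::{real_normed_vector, second_countable_topology} set"
  assumes P: "P \<in> probs S" and Q: "Q \<in> probs S"
    and \<tau>: "\<tau> \<in> borel_on S \<rightarrow>\<^sub>M count_space UNIV" "\<And>x. x \<in> S \<Longrightarrow> \<tau> x \<in> K \<and> norm (x - \<tau> x) \<le> \<epsilon>"
    and K: "finite K" and "\<epsilon> \<ge> 0"
    and pl: "plan K (\<lambda>i. measure P (\<tau> -` {i} \<inter> S)) (\<lambda>i. measure Q (\<tau> -` {i} \<inter> S)) \<pi>"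
  shows "wasserstein S P Q \<le> ennreal (plan_cost K (\<lambda>i j. norm (i - j)) \<pi> + 2 * \<epsilon>)"
proof -
  interpret P: prob_space P using P by (simp add: in_probs_iff)
  interpret Q: prob_space Q using Q by (simp add: in_probs_iff)
  have sets[simp, measurable_cong]: "sets P = sets (borel_on S)" "sets Q = sets (borel_on S)"
    and space[simp]: "space P = S" "space Q = S"
    using P Q space_probs by (auto simp: in_probs_iff)
  note \<tau>(1)[measurable]
  have \<tau>PQ: "\<tau> \<in> P \<rightarrow>\<^sub>M count_space UNIV" "\<tau> \<in> Q \<rightarrow>\<^sub>M count_space UNIV" by measurable
  have S[measurable]: "S \<in> sets (borel_on S)" using sets.top[of "borel_on S"] by simp
  have X: "\<tau> -` {i} \<inter> S \<in> sets (borel_on S)" for i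
    using measurable_sets[OF \<tau>(1), of "{i}"] by simp
  define p where "p i = measure P (\<tau> -` {i} \<inter> S)" for i
  define q where "q i = measure Q (\<tau> -` {i} \<inter> S)" for i
  have p0: "p i \<ge> 0" "q i \<ge> 0" for i by (auto simp: p_def q_def)
  have \<pi>: "\<And>i j. i \<in> K \<Longrightarrow> j \<in> K \<Longrightarrow> 0 \<le> \<pi> i j" "\<And>i. i \<in> K \<Longrightarrow> (\<Sum>j\<in>K. \<pi> i j) = p i"
     "\<And>j. j \<in> K \<Longrightarrow> (\<Sum>i\<in>K. \<pi> i j) = q j"
    using pl by (auto simp: plan_def p_def q_def)
  have \<pi>0: "\<pi> i j = 0" if "p i = 0 \<or> q j = 0" "i \<in> K" "j \<in> K" for i j
    using that \<pi>(2)[OF that(2)] \<pi>(3)[OF that(3)] \<pi>(1) K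
      sum_nonneg_eq_0_iff[of K "\<lambda>j. \<pi> i j"] sum_nonneg_eq_0_iff[of K "\<lambda>i. \<pi> i j"] by auto
  define c where "c i j = \<pi> i j / (p i * q j)" for i j
  have c0: "c i j \<ge> 0" if "i \<in> K" "j \<in> K" for i j
    using \<pi>(1)[OF that] p0 by (simp add: c_def)
  have cpq: "c i j * (p i * q j) = \<pi> i j" if "i \<in> K" "j \<in> K" for i j
    using \<pi>0[OF _ that] by (cases "p i = 0 \<or> q j = 0") (auto simp: c_def)
  have PX: "emeasure P (\<tau> -` {i} \<inter> S) = ennreal (p i)" "emeasure Q (\<tau> -` {i} \<inter> S) = ennreal (q i)" for i
    by (auto simp: p_def q_def P.emeasure_eq_measure Q.emeasure_eq_measure)
  \<comment> \<open>Spread the mass \<open>\<pi> i j\<close> over the rectangle of the cells of \<open>i\<close> and \<open>j\<close> proportionally to \<open>P \<Otimes> Q\<close>;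
    the junk value \<open>c i j = 0\<close> on null cells is harmless because \<open>\<pi> i j = 0\<close> there.\<close>
  define \<gamma> where "\<gamma> = density (P \<Otimes>\<^sub>M Q) (\<lambda>z. ennreal (c (\<tau> (fst z)) (\<tau> (snd z))))"
  have hm [measurable]: "(\<lambda>z. u (\<tau> (fst z)) (\<tau> (snd z))) \<in> borel_measurable (P \<Otimes>\<^sub>M Q)" for u :: "'a \<Rightarrow> 'a \<Rightarrow> ennreal"
  proof -
    have "(\<lambda>z. u (\<tau> (fst z)) (\<tau> (snd z)) * indicator (S \<times> S) z) \<in> borel_measurable (P \<Otimes>\<^sub>M Q)"
      using nn_integral_pair_finite_range(1)[OF Q.sigma_finite_measure_axioms \<tau>PQ K _ K, of S S u] \<tau>(2) by simp
    then show ?thesis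
      by (subst measurable_cong[of _ _ "\<lambda>z. u (\<tau> (fst z)) (\<tau> (snd z)) * indicator (S \<times> S) z"])
         (auto simp: space_pair_measure)
  qed
  have sets\<gamma> [measurable_cong]: "sets \<gamma> = sets (borel_on S \<Otimes>\<^sub>M borel_on S)"
    unfolding \<gamma>_def by (simp cong: sets_pair_measure_cong)
  have space\<gamma>: "space \<gamma> = S \<times> S"
    by (simp add: \<gamma>_def space_pair_measure)
  have em: "emeasure \<gamma> (A \<times> B) = (\<Sum>i\<in>K. \<Sum>j\<in>K. ennreal (c i j) *
      (emeasure P (A \<inter> (\<tau> -` {i} \<inter> S)) * emeasure Q (B \<inter> (\<tau> -` {j} \<inter> S))))"
    if [measurable]: "A \<in> sets (borel_on S)" "B \<in> sets (borel_on S)" for A B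
  proof -
    have "emeasure \<gamma> (A \<times> B) = (\<integral>\<^sup>+ z. ennreal (c (\<tau> (fst z)) (\<tau> (snd z))) * indicator (A \<times> B) z \<partial>(P \<Otimes>\<^sub>M Q))"
      unfolding \<gamma>_def by (rule emeasure_density) measurable
    then show ?thesis
      using nn_integral_pair_finite_range(2)[OF Q.sigma_finite_measure_axioms \<tau>PQ K _ K, of A B "\<lambda>i j. ennreal (c i j)"] \<tau>(2)
      by simp
  qed
  have marg1: "emeasure \<gamma> (A \<times> S) = emeasure P A" if A[measurable]: "A \<in> sets (borel_on S)" for A
  proof -
    have "emeasure \<gamma> (A \<times> S) = (\<Sum>i\<in>K. emeasure P (A \<inter> (\<tau> -` {i} \<inter> S)))"
      unfolding em[OF A S]
    proof (rule sum.cong[OF refl])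
      fix i assume i: "i \<in> K"
      let ?a = "emeasure P (A \<inter> (\<tau> -` {i} \<inter> S))"
      have "(\<Sum>j\<in>K. ennreal (c i j) * (?a * emeasure Q (S \<inter> (\<tau> -` {j} \<inter> S)))) =
         ?a * (\<Sum>j\<in>K. ennreal (c i j * q j))"
        using i c0 p0 by (simp add: sum_distrib_left Int_absorb1 PX ennreal_mult mult.left_commute)
      also have "(\<Sum>j\<in>K. ennreal (c i j * q j)) = ennreal (\<Sum>j\<in>K. c i j * q j)"
        using i c0 p0 by (intro sum_ennreal) auto
      also have "(\<Sum>j\<in>K. c i j * q j) = (\<Sum>j\<in>K. \<pi> i j / p i)"
        using \<pi>0 i by (intro sum.cong refl) (auto simp: c_def)
      also have "\<dots> = p i / p i" using i by (simp add: sum_divide_distrib[symmetric] \<pi>)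
      \<comment> \<open>On a null cell the quotient is 0 and not 1, but then \<open>?a\<close>
        vanishes as well.\<close>
      also have "?a * ennreal (p i / p i) = ?a"
      proof (cases "p i = 0")
        case True
        have "?a \<le> emeasure P (\<tau> -` {i} \<inter> S)" using X by (intro emeasure_mono) auto
        then show ?thesis by (simp add: PX True)
      qed simp
      finally show "(\<Sum>j\<in>K. ennreal (c i j) * (?a * emeasure Q (S \<inter> (\<tau> -` {j} \<inter> S)))) = ?a" .
    qed
    then show ?thesis
      using emeasure_finite_partition[OF \<tau>PQ(1) K, of A] \<tau>(2) by simp
  qed
  have marg2: "emeasure \<gamma> (S \<times> B) = emeasure Q B" if B[measurable]: "B \<in> sets (borel_on S)" for B
  proof -
    have "emeasure \<gamma> (S \<times> B) = (\<Sum>j\<in>K. emeasure Q (B \<inter> (\<tau> -` {j} \<inter> S)))"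
      unfolding em[OF S B]
    proof (subst sum.swap, rule sum.cong[OF refl])
      fix j assume j: "j \<in> K"
      let ?b = "emeasure Q (B \<inter> (\<tau> -` {j} \<inter> S))"
      have "(\<Sum>i\<in>K. ennreal (c i j) * (emeasure P (S \<inter> (\<tau> -` {i} \<inter> S)) * ?b)) =
         ?b * (\<Sum>i\<in>K. ennreal (c i j * p i))"
        using j c0 p0 by (simp add: sum_distrib_right Int_absorb1 PX ennreal_mult mult_ac)
      also have "(\<Sum>i\<in>K. ennreal (c i j * p i)) = ennreal (\<Sum>i\<in>K. c i j * p i)"
        using j c0 p0 by (intro sum_ennreal) auto
      also have "(\<Sum>i\<in>K. c i j * p i) = (\<Sum>i\<in>K. \<pi> i j / q j)"
        using \<pi>0 j by (intro sum.cong refl) (auto simp: c_def)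
      also have "\<dots> = q j / q j" using j by (simp add: sum_divide_distrib[symmetric] \<pi>)
      also have "?b * ennreal (q j / q j) = ?b"
      proof (cases "q j = 0")
        case True
        have "?b \<le> emeasure Q (\<tau> -` {j} \<inter> S)" using X by (intro emeasure_mono) auto
        then show ?thesis by (simp add: PX True)
      qed simp
      finally show "(\<Sum>i\<in>K. ennreal (c i j) * (emeasure P (S \<inter> (\<tau> -` {i} \<inter> S)) * ?b)) = ?b" .
    qed
    then show ?thesis
      using emeasure_finite_partition[OF \<tau>PQ(2) K, of B] \<tau>(2) by simp
  qed
  have "\<gamma> \<in> couplings S P Q"
    unfolding couplings_def mem_Collect_eq
  proof (intro conjI sets\<gamma>)
    show "prob_space \<gamma>"
      using marg1[OF S] P.emeasure_space_1 by (intro prob_spaceI) (simp add: space\<gamma>)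
    show "distr \<gamma> (borel_on S) fst = P"
    proof (rule measure_eqI)
      fix A assume "A \<in> sets (distr \<gamma> (borel_on S) fst)"
      then have A[measurable]: "A \<in> sets (borel_on S)" by simp
      have "fst -` A \<inter> space \<gamma> = A \<times> S" using sets.sets_into_space[OF A] by (auto simp: space\<gamma>)
      then show "emeasure (distr \<gamma> (borel_on S) fst) A = emeasure P A"
        by (subst emeasure_distr) (simp_all add: marg1)
    qed simp
    show "distr \<gamma> (borel_on S) snd = Q"
    proof (rule measure_eqI)
      fix A assume "A \<in> sets (distr \<gamma> (borel_on S) snd)"
      then have A[measurable]: "A \<in> sets (borel_on S)" by simp
      have "snd -` A \<inter> space \<gamma> = S \<times> A" using sets.sets_into_space[OF A] by (auto simp: space\<gamma>)
      then show "emeasure (distr \<gamma> (borel_on S) snd) A = emeasure Q A"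
        by (subst emeasure_distr) (simp_all add: marg2)
    qed simp
  qed
  then have "wasserstein S P Q \<le> (\<integral>\<^sup>+ (x, y). ennreal (norm (x - y)) \<partial>\<gamma>)"
    unfolding wasserstein_def by (rule INF_lower)
  also have "\<dots> = (\<integral>\<^sup>+ z. ennreal (c (\<tau> (fst z)) (\<tau> (snd z))) * (case z of (x, y) \<Rightarrow> ennreal (norm (x - y))) \<partial>(P \<Otimes>\<^sub>M Q))"
    unfolding \<gamma>_def by (rule nn_integral_density) measurable
  also have "\<dots> \<le> (\<integral>\<^sup>+ z. (\<lambda>i j. ennreal (c i j * (norm (i - j) + 2 * \<epsilon>))) (\<tau> (fst z)) (\<tau> (snd z)) * indicator (S \<times> S) z \<partial>(P \<Otimes>\<^sub>M Q))"
  proof (rule nn_integral_mono)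
    fix z assume "z \<in> space (P \<Otimes>\<^sub>M Q)"
    then obtain x y where xy: "z = (x, y)" "x \<in> S" "y \<in> S" by (auto simp: space_pair_measure)
    have "norm (x - y) \<le> norm (x - \<tau> x) + norm (\<tau> x - \<tau> y) + norm (y - \<tau> y)"
      by (metis (no_types, opaque_lifting) add_right_mono diff_add_cancel dist_commute dist_norm dist_triangle dist_triangle_le order_trans)
    also have "\<dots> \<le> norm (\<tau> x - \<tau> y) + 2 * \<epsilon>" using \<tau>(2)[OF xy(2)] \<tau>(2)[OF xy(3)] by simp
    finally have "c (\<tau> x) (\<tau> y) * norm (x - y) \<le> c (\<tau> x) (\<tau> y) * (norm (\<tau> x - \<tau> y) + 2 * \<epsilon>)"
      using c0 \<tau>(2) xy by (intro mult_left_mono) auto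
    then show "ennreal (c (\<tau> (fst z)) (\<tau> (snd z))) * (case z of (x, y) \<Rightarrow> ennreal (norm (x - y))) \<le>
       ennreal (c (\<tau> (fst z)) (\<tau> (snd z)) * (norm (\<tau> (fst z) - \<tau> (snd z)) + 2 * \<epsilon>)) * indicator (S \<times> S) z"
      using xy by (simp add: ennreal_mult''[symmetric] ennreal_leI)
  qed
  also have "\<dots> = (\<Sum>i\<in>K. \<Sum>j\<in>K. ennreal (c i j * (norm (i - j) + 2 * \<epsilon>)) * (ennreal (p i) * ennreal (q j)))"
    using nn_integral_pair_finite_range(2)[OF Q.sigma_finite_measure_axioms \<tau>PQ K _ K, of S S] \<tau>(2)
    by (simp add: Int_absorb1 PX)
  also have "\<dots> = (\<Sum>i\<in>K. \<Sum>j\<in>K. ennreal ((norm (i - j) + 2 * \<epsilon>) * \<pi> i j))"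
  proof (intro sum.cong refl)
    fix i j assume "i \<in> K" "j \<in> K"
    then show "ennreal (c i j * (norm (i - j) + 2 * \<epsilon>)) * (ennreal (p i) * ennreal (q j)) = ennreal ((norm (i - j) + 2 * \<epsilon>) * \<pi> i j)"
      using c0 p0 \<open>\<epsilon> \<ge> 0\<close> cpq[of i j] by (simp add: ennreal_mult[symmetric] mult_ac flip: cpq)
  qed
  also have "\<dots> = (\<Sum>i\<in>K. ennreal (\<Sum>j\<in>K. (norm (i - j) + 2 * \<epsilon>) * \<pi> i j))"
    using \<open>\<epsilon> \<ge> 0\<close> \<pi> by (intro sum.cong refl sum_ennreal) auto
  also have "\<dots> = ennreal (\<Sum>i\<in>K. \<Sum>j\<in>K. (norm (i - j) + 2 * \<epsilon>) * \<pi> i j)"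
    using \<open>\<epsilon> \<ge> 0\<close> \<pi> by (intro sum_ennreal sum_nonneg) auto
  also have "(\<Sum>i\<in>K. \<Sum>j\<in>K. (norm (i - j) + 2 * \<epsilon>) * \<pi> i j) = plan_cost K (\<lambda>i j. norm (i - j)) \<pi> + 2 * \<epsilon> * (\<Sum>i\<in>K. p i)"
    by (simp add: plan_cost_def algebra_simps sum.distrib sum_distrib_left \<pi>(2)[symmetric])
  also have "(\<Sum>i\<in>K. p i) = 1"
    using integral_finite_range[OF P.finite_measure_axioms \<tau>PQ(1) K, of "\<lambda>_. 1"] \<tau>(2)
    by (simp add: p_def P.prob_space[simplified])
  finally show ?thesis by simp
qed

lemma lipschitz_Min:
  fixes b :: "'a::real_normed_vector \<Rightarrow> real"
  assumes "finite K" "K \<noteq> {}"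
  shows "\<bar>(MIN j\<in>K. b j + norm (x - j)) - (MIN j\<in>K. b j + norm (y - j))\<bar> \<le> norm (x - y)"
proof -
  have "(MIN j\<in>K. b j + norm (x - j)) \<le> (MIN j\<in>K. b j + norm (y - j)) + norm (x - y)" for x y
  proof -
    have "(MIN j\<in>K. b j + norm (y - j)) \<in> (\<lambda>j. b j + norm (y - j)) ` K"
      using assms by (intro Min_in) auto
    then obtain j where j: "j \<in> K" "(MIN j\<in>K. b j + norm (y - j)) = b j + norm (y - j)" by blast
    have "(MIN j\<in>K. b j + norm (x - j)) \<le> b j + norm (x - j)"
      using assms j(1) by (intro Min_le) auto
    also have "norm (x - j) \<le> norm (x - y) + norm (y - j)"
      using norm_triangle_ineq[of "x - y" "y - j"] by simp
    finally show ?thesis using j(2) by simp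
  qed
  from this[of x y] this[of y x] show ?thesis by (simp add: norm_minus_commute)
qed

lemma lipschitz_measurable_bounded:
  fixes S :: "'a::euclidean_space set" and f :: "'a \<Rightarrow> real"
  assumes "compact S" and lip: "\<And>x y. x \<in> S \<Longrightarrow> y \<in> S \<Longrightarrow> \<bar>f x - f y\<bar> \<le> L * norm (x - y)"
  shows "continuous_on S f" "f \<in> borel_measurable (borel_on S)" "bounded (f ` S)"
proof -
  have "(max L 0)-lipschitz_on S f"
  proof (rule lipschitz_onI)
    fix x y assume "x \<in> S" "y \<in> S"
    then have "\<bar>f x - f y\<bar> \<le> L * norm (x - y)" by (rule lip)
    also have "\<dots> \<le> max L 0 * norm (x - y)" by (intro mult_right_mono) auto
    finally show "dist (f x) (f y) \<le> max L 0 * dist x y" by (simp add: dist_norm)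
  qed simp
  then show c: "continuous_on S f" by (rule lipschitz_on_continuous_on)
  then show "f \<in> borel_measurable (borel_on S)" by (rule borel_measurable_continuous_on_restrict)
  show "bounded (f ` S)" using compact_continuous_image[OF c \<open>compact S\<close>] by (rule compact_imp_bounded)
qed

lemma measure_mixture:
  assumes "P \<in> probs S" "Q \<in> probs S" "t \<in> {0..1}" "B \<in> sets (borel_on S)"
  shows "measure (mixture t P Q) B = t * measure P B + (1 - t) * measure Q B"
proof -
  interpret P: prob_space P using assms by (simp add: in_probs_iff)
  interpret Q: prob_space Q using assms by (simp add: in_probs_iff)
  have "emeasure (mixture t P Q) B = ennreal t * emeasure P B + ennreal (1 - t) * emeasure Q B"
    using assms by (intro emeasure_mixture) (auto simp: in_probs_iff)
  also have "\<dots> = ennreal (t * measure P B + (1 - t) * measure Q B)"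
    using assms by (simp add: P.emeasure_eq_measure Q.emeasure_eq_measure ennreal_mult)
  finally show ?thesis using assms by (intro measure_eq_emeasure_eq_ennreal) auto
qed

lemma wasserstein_separation:
  fixes S :: "'a::euclidean_space set"
  assumes S: "compact S" and P: "P \<in> probs S" and A: "A \<subseteq> probs S" "A \<noteq> {}" "convex_measures A"
    and lower: "\<And>Q. Q \<in> A \<Longrightarrow> ennreal \<delta> \<le> wasserstein S P Q" and "\<delta>' < \<delta>"
  obtains F where "\<And>x y. \<bar>F x - F y\<bar> \<le> norm (x - y)" 
    "\<And>Q. Q \<in> A \<Longrightarrow> \<delta>' \<le> integral\<^sup>L P F - integral\<^sup>L Q F"
proof -
  \<comment> \<open>The error budget: \<open>2 * \<epsilon>\<close> for rounding in the transport
    cost, one \<open>\<epsilon>\<close> for the strict inequality demanded by the finite duality,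
    and one each for evaluating \<open>F\<close> at net points under \<open>P\<close> and under
    \<open>Q\<close>. The sixth is spare.\<close>
  define \<epsilon> where "\<epsilon> = (\<delta> - \<delta>') / 6"
  have \<epsilon>: "\<epsilon> > 0" "\<delta>' = \<delta> - 6 * \<epsilon>" using \<open>\<delta>' < \<delta>\<close> by (auto simp: \<epsilon>_def field_simps)
  obtain K \<tau> where K: "finite K" "K \<subseteq> S" and \<tau>: "\<tau> \<in> borel_on S \<rightarrow>\<^sub>M count_space UNIV"
    "\<And>x. x \<in> S \<Longrightarrow> \<tau> x \<in> K \<and> norm (x - \<tau> x) \<le> \<epsilon>"
    using finite_net_map[OF S \<epsilon>(1)] by blast
  define pr where "pr Q i = measure Q (\<tau> -` {i} \<inter> S)" for Q i
  have int_\<tau>: "(\<integral>x. f (\<tau> x) \<partial>Q) = (\<Sum>i\<in>K. pr Q i * f i)" if "Q \<in> probs S" for Q and f :: "'a \<Rightarrow> real"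
  proof -
    have "finite_measure Q" "\<tau> \<in> Q \<rightarrow>\<^sub>M count_space UNIV"
      using that \<tau>(1) by (auto simp: in_probs_iff prob_space_def cong: measurable_cong_sets)
    then show ?thesis
      using integral_finite_range[of Q \<tau> K f] K \<tau>(2) space_probs[OF that] by (simp add: pr_def)
  qed
  have sum_pr: "sum (pr Q) K = 1" if "Q \<in> probs S" for Q
    using int_\<tau>[OF that, of "\<lambda>_. 1"] that by (simp add: in_probs_iff prob_space.prob_space)
  have K0: "K \<noteq> {}" using sum_pr[OF P] by auto
  define D where "D = Max ((\<lambda>(i, j). norm (i - j)) ` (K \<times> K))"
  have D: "norm (i - j) \<le> D" if "i \<in> K" "j \<in> K" for i j
    unfolding D_def using that K by (intro Max_ge) (auto intro!: image_eqI[of _ _ "(i, j)"])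
  have X: "\<tau> -` {i} \<inter> S \<in> sets (borel_on S)" for i
    using measurable_sets[OF \<tau>(1), of "{i}"] by simp
  have "\<exists>b. \<forall>q\<in>pr ` A. (\<Sum>i\<in>K. pr P i * (MIN j\<in>K. b j + norm (i - j))) - (\<Sum>j\<in>K. b j * q j) \<ge> \<delta> - 3 * \<epsilon>"
  proof (rule discrete_transport_duality[OF K(1)])
    show "pr ` A \<noteq> {}" using A by simp
    show "sum (pr P) K = 1" by (rule sum_pr[OF P])
    show "sum q K = 1" if "q \<in> pr ` A" for q using that sum_pr A by auto
    show "0 \<le> q i" if "q \<in> pr ` A" for q i using that by (auto simp: pr_def)
    show "0 \<le> pr P i" for i by (auto simp: pr_def)
    show "0 \<le> norm (i - j) \<and> norm (i - j) \<le> D" if "i \<in> K" "j \<in> K" for i j using D that by auto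
    show "\<delta> - 3 * \<epsilon> < \<delta> - 2 * \<epsilon>" using \<epsilon> by simp
    show "(\<lambda>i. (1 - t) * q i + t * q' i) \<in> pr ` A" if "q \<in> pr ` A" "q' \<in> pr ` A" "t \<in> {0..1}" for q q' and t :: real
    proof -
      obtain Q Q' where Q: "Q \<in> A" "Q' \<in> A" "q = pr Q" "q' = pr Q'" using \<open>q \<in> pr ` A\<close> \<open>q' \<in> pr ` A\<close> by auto
      \<comment> \<open>The arguments are swapped because \<open>mixture\<close> puts the weight
        \<open>t\<close> on its first measure, while the finite duality puts it on the second
        vector.\<close>
      have "pr (mixture t Q' Q) = (\<lambda>i. (1 - t) * q i + t * q' i)"
        unfolding pr_def using A(1) Q \<open>t \<in> {0..1}\<close> X by (subst measure_mixture[of _ S]) (auto simp: pr_def)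
      moreover have "mixture t Q' Q \<in> A" using A(3) Q \<open>t \<in> {0..1}\<close> by (auto simp: convex_measures_def)
      ultimately show ?thesis by (metis imageI)
    qed
    show "\<delta> - 2 * \<epsilon> \<le> plan_cost K (\<lambda>i j. norm (i - j)) \<pi>" if "q \<in> pr ` A" "plan K (pr P) q \<pi>" for q \<pi>
    proof -
      obtain Q where Q: "Q \<in> A" "q = pr Q" using \<open>q \<in> pr ` A\<close> by auto
      have "ennreal \<delta> \<le> ennreal (plan_cost K (\<lambda>i j. norm (i - j)) \<pi> + 2 * \<epsilon>)"
        using wasserstein_le_plan_cost[OF P _ \<tau> K(1), of Q \<pi>] lower[OF Q(1)] A(1) Q \<epsilon> \<open>plan K (pr P) q \<pi>\<close>
        by (auto simp: pr_def[abs_def])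
      moreover have "0 \<le> plan_cost K (\<lambda>i j. norm (i - j)) \<pi>"
        using \<open>plan K (pr P) q \<pi>\<close> by (auto simp: plan_cost_def plan_def intro!: sum_nonneg)
      ultimately show ?thesis using \<epsilon> by (subst (asm) ennreal_le_iff) auto
    qed
  qed
  then obtain b where b: "\<And>Q. Q \<in> A \<Longrightarrow>
      (\<Sum>i\<in>K. pr P i * (MIN j\<in>K. b j + norm (i - j))) - (\<Sum>j\<in>K. b j * pr Q j) \<ge> \<delta> - 3 * \<epsilon>" by blast
  \<comment> \<open>The finite potential is extended to the whole space as a minimum of 1-Lipschitz
    functions. On \<open>K\<close> it lies below \<open>b\<close>; as \<open>b\<close> enters the
    duality with a minus sign, replacing it by \<open>F\<close> can only enlarge the gap.\<close>
  define F where "F x = (MIN j\<in>K. b j + norm (x - j))" for x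
  have lip: "\<bar>F x - F y\<bar> \<le> norm (x - y)" for x y
    unfolding F_def using K K0 by (intro lipschitz_Min)
  have F\<tau>: "\<bar>integral\<^sup>L Q F - (\<Sum>i\<in>K. pr Q i * F i)\<bar> \<le> \<epsilon>" if Q: "Q \<in> probs S" for Q
  proof -
    interpret prob_space Q using Q by (simp add: in_probs_iff)
    have \<tau>Q: "\<tau> \<in> Q \<rightarrow>\<^sub>M count_space UNIV" using \<tau>(1) Q by (subst measurable_cong_sets[of Q "borel_on S"]) (auto simp: in_probs_iff)
    have iF: "integrable Q F"
      using lipschitz_measurable_bounded[OF S, of F 1] lip by (intro integrable_probs[OF Q]) auto
    have i\<tau>: "integrable Q (\<lambda>x. F (\<tau> x))"
    proof (rule integrable_const_bound[of _ "Max ((\<lambda>i. \<bar>F i\<bar>) ` K)"])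
      show "AE x in Q. norm (F (\<tau> x)) \<le> Max ((\<lambda>i. \<bar>F i\<bar>) ` K)"
        using K \<tau>(2) space_probs[OF Q] by (intro AE_I2) (auto intro!: Max_ge)
      show "(\<lambda>x. F (\<tau> x)) \<in> borel_measurable Q" by (rule measurable_compose[OF \<tau>Q]) simp
    qed
    have "\<bar>integral\<^sup>L Q F - (\<Sum>i\<in>K. pr Q i * F i)\<bar> = \<bar>\<integral>x. F x - F (\<tau> x) \<partial>Q\<bar>"
      using iF i\<tau> int_\<tau>[OF Q] by simp
    also have "\<dots> \<le> (\<integral>x. \<bar>F x - F (\<tau> x)\<bar> \<partial>Q)" by (rule integral_abs_bound)
    also have "\<dots> \<le> (\<integral>x. \<epsilon> \<partial>Q)"
    proof (rule integral_mono)
      fix x assume "x \<in> space Q"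
      then show "\<bar>F x - F (\<tau> x)\<bar> \<le> \<epsilon>" using lip[of x "\<tau> x"] \<tau>(2)[of x] space_probs[OF Q] by simp
    qed (use iF i\<tau> in auto)
    finally show ?thesis using prob_space by simp
  qed
  show ?thesis
  proof (rule that[OF lip])
    fix Q assume Q: "Q \<in> A"
    have "F j \<le> b j" if "j \<in> K" for j
    proof -
      have "b j + norm (j - j) \<in> (\<lambda>i. b i + norm (j - i)) ` K" using that by (rule imageI)
      then have "F j \<le> b j + norm (j - j)" unfolding F_def using K by (intro Min_le) auto
      then show ?thesis by simp
    qed
    then have "(\<Sum>j\<in>K. pr Q j * F j) \<le> (\<Sum>j\<in>K. pr Q j * b j)"
      by (intro sum_mono mult_left_mono) (auto simp: pr_def)
    then have "(\<Sum>i\<in>K. pr P i * F i) - (\<Sum>j\<in>K. pr Q j * F j) \<ge> \<delta> - 3 * \<epsilon>"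
      using b[OF Q] by (simp add: F_def mult.commute)
    then show "\<delta>' \<le> integral\<^sup>L P F - integral\<^sup>L Q F"
      using F\<tau>[OF P] F\<tau>[OF subsetD[OF A(1) Q]] \<epsilon> by linarith
  qed
qed

section \<open>Weak neighbourhoods and Wasserstein convergence\<close>

lemma weak_topology_basic_neighbourhood:
  fixes S :: "'a::topological_space set"
  assumes "openin (weak_topology S) U" "P \<in> U"
  obtains \<F> \<epsilon> where "finite \<F>" "\<epsilon> > 0" 
    "\<And>f :: 'a \<Rightarrow> real. f \<in> \<F> \<Longrightarrow> continuous_on S f \<and> bounded (f ` S)"
    "\<And>Q. Q \<in> probs S \<Longrightarrow> (\<And>f. f \<in> \<F> \<Longrightarrow> \<bar>integral\<^sup>L Q f - integral\<^sup>L P f\<bar> < \<epsilon>) \<Longrightarrow> Q \<in> U"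
proof -
  let ?B = "{{P \<in> probs S. integral\<^sup>L P f \<in> U} | (f :: 'a \<Rightarrow> real) U.
        continuous_on S f \<and> bounded (f ` S) \<and> open U}"
  have gen: "generate_topology_on ?B U"
    using assms(1) unfolding weak_topology_def by (rule openin_topology_generated_by)
  define N where "N \<F> \<epsilon> V \<longleftrightarrow> finite \<F> \<and> \<epsilon> > 0 \<and> (\<forall>f\<in>\<F>. continuous_on S f \<and> bounded (f ` S)) \<and>
     (\<forall>Q\<in>probs S. (\<forall>f\<in>\<F>. \<bar>integral\<^sup>L Q f - integral\<^sup>L P f\<bar> < \<epsilon>) \<longrightarrow> Q \<in> V)"
    for \<F> :: "('a \<Rightarrow> real) set" and \<epsilon> :: real and V
  from gen have "P \<in> U \<longrightarrow> (\<exists>\<F> \<epsilon>. N \<F> \<epsilon> U)"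
  proof induction
    case (Int a b)
    have "N (F1 \<union> F2) (min e1 e2) (a \<inter> b)" if "N F1 e1 a" "N F2 e2 b" for F1 F2 e1 e2
      using that unfolding N_def by auto
    then show ?case using Int.IH by blast
  next
    case (UN K)
    have "N \<F> \<epsilon> (\<Union>K)" if "N \<F> \<epsilon> k" "k \<in> K" for \<F> \<epsilon> k
      using that unfolding N_def by auto
    then show ?case using UN.IH by blast
  next
    case (Basis s)
    have *: "\<exists>\<F> \<epsilon>. N \<F> \<epsilon> {P \<in> probs S. integral\<^sup>L P f \<in> V}"
      if f: "continuous_on S f" "bounded (f ` S)" "open V" and P: "integral\<^sup>L P f \<in> V" for f :: "'a \<Rightarrow> real" and V
    proof -
      obtain \<epsilon> where "\<epsilon> > 0" "\<And>y. \<bar>y - integral\<^sup>L P f\<bar> < \<epsilon> \<Longrightarrow> y \<in> V"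
        using f(3) P unfolding open_dist by (auto simp: dist_real_def)
      then have "N {f} \<epsilon> {P \<in> probs S. integral\<^sup>L P f \<in> V}" using f unfolding N_def by auto
      then show ?thesis by blast
    qed
    show ?case using Basis by clarify (rule *)
  qed simp
  then obtain \<F> \<epsilon> where "N \<F> \<epsilon> U" using assms(2) by blast
  then show ?thesis using that[of \<F> \<epsilon>] unfolding N_def by auto
qed

text \<open>Below the distance \<open>d\<close> of uniform continuity the term
  \<open>\<epsilon>\<close> suffices. Beyond it, \<open>L\<close> is chosen so large that
  \<open>L * d\<close> exceeds the oscillation of \<open>f\<close>.\<close>

lemma uniformly_continuous_lipschitz_up_to:
  fixes S :: "'a::real_normed_vector set" and f :: "'a \<Rightarrow> real"
  assumes "compact S" "continuous_on S f" "\<epsilon> > 0"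
  obtains L where "L > 0" "\<And>x y. x \<in> S \<Longrightarrow> y \<in> S \<Longrightarrow> \<bar>f x - f y\<bar> \<le> \<epsilon> + L * norm (x - y)"
proof -
  obtain B where B: "\<And>x. x \<in> S \<Longrightarrow> \<bar>f x\<bar> \<le> B"
    using compact_imp_bounded[OF compact_continuous_image[OF assms(2,1)]] by (auto simp: bounded_iff)
  obtain d where d: "d > 0" "\<And>x y. x \<in> S \<Longrightarrow> y \<in> S \<Longrightarrow> dist y x < d \<Longrightarrow> dist (f y) (f x) < \<epsilon>"
    using compact_uniformly_continuous[OF assms(2,1)] \<open>\<epsilon> > 0\<close> unfolding uniformly_continuous_on_def by metis
  define L where "L = (2 * \<bar>B\<bar> + 1) / d"
  have L: "L > 0" using d by (simp add: L_def)
  have "\<bar>f x - f y\<bar> \<le> \<epsilon> + L * norm (x - y)" if xy: "x \<in> S" "y \<in> S" for x y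
  proof (cases "norm (x - y) < d")
    case True
    then have "\<bar>f x - f y\<bar> \<le> \<epsilon>" using d(2)[OF xy(2,1)] by (simp add: dist_norm)
    moreover have "0 \<le> L * norm (x - y)" using L by simp
    ultimately show ?thesis by linarith
  next
    case False
    then have "L * d \<le> L * norm (x - y)" using L by (intro mult_left_mono) auto
    then have "2 * \<bar>B\<bar> + 1 \<le> L * norm (x - y)" using d by (simp add: L_def)
    then show ?thesis using B[OF xy(1)] B[OF xy(2)] \<open>\<epsilon> > 0\<close> by linarith
  qed
  then show ?thesis using that L by blast
qed

text \<open>Wasserstein convergence implies weak convergence: a weak neighbourhood is tested by
  finitely many continuous functions, and each of them is controlled by the distance up to a small
  error.\<close>

lemma closed_under_wasserstein_limits:
  fixes S :: "'a::euclidean_space set"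
  assumes S: "compact S" and A: "closedin (weak_topology S) A" and P: "P \<in> probs S"
    and lim: "\<And>\<eta>. \<eta> > 0 \<Longrightarrow> \<exists>Q\<in>A. wasserstein S P Q < ennreal \<eta>"
  shows "P \<in> A"
proof (rule ccontr)
  assume "P \<notin> A"
  then have U: "openin (weak_topology S) (probs S - A)" "P \<in> probs S - A"
    using A P by (auto simp: closedin_def)
  obtain \<F> \<epsilon> where F: "finite \<F>" "\<epsilon> > 0" 
    "\<And>f :: 'a \<Rightarrow> real. f \<in> \<F> \<Longrightarrow> continuous_on S f \<and> bounded (f ` S)"
    "\<And>Q. Q \<in> probs S \<Longrightarrow> (\<And>f. f \<in> \<F> \<Longrightarrow> \<bar>integral\<^sup>L Q f - integral\<^sup>L P f\<bar> < \<epsilon>) \<Longrightarrow> Q \<in> probs S - A"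
    using weak_topology_basic_neighbourhood[OF U] by blast
  have "\<exists>L>0. \<forall>x\<in>S. \<forall>y\<in>S. \<bar>f x - f y\<bar> \<le> \<epsilon> / 2 + L * norm (x - y)" if "f \<in> \<F>" for f
    using uniformly_continuous_lipschitz_up_to[OF S, of f "\<epsilon> / 2"] F(2) F(3)[OF that] by (metis half_gt_zero)
  then obtain L where L: "\<And>f. f \<in> \<F> \<Longrightarrow> L f > 0" 
    "\<And>f x y. f \<in> \<F> \<Longrightarrow> x \<in> S \<Longrightarrow> y \<in> S \<Longrightarrow> \<bar>f x - f y\<bar> \<le> \<epsilon> / 2 + L f * norm (x - y)"
    by metis
  \<comment> \<open>Chosen so that \<open>\<epsilon> / 2 + L f * \<eta>\<close> is at most
    \<open>\<epsilon>\<close> for every test function; the element 1 covers an empty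
    \<open>\<F>\<close>.\<close>
  define \<eta> where "\<eta> = Min (insert 1 ((\<lambda>f. \<epsilon> / (2 * L f)) ` \<F>))"
  have \<eta>: "\<eta> > 0" "\<And>f. f \<in> \<F> \<Longrightarrow> \<eta> \<le> \<epsilon> / (2 * L f)"
    using F(1,2) L(1) by (auto simp: \<eta>_def)
  obtain Q where Q: "Q \<in> A" "wasserstein S P Q < ennreal \<eta>" using lim[OF \<eta>(1)] by blast
  have Qp: "Q \<in> probs S" using A Q(1) closedin_subset[OF A] by auto
  have "\<bar>integral\<^sup>L Q f - integral\<^sup>L P f\<bar> < \<epsilon>" if f: "f \<in> \<F>" for f
  proof -
    have "ennreal ((\<bar>integral\<^sup>L P f - integral\<^sup>L Q f\<bar> - \<epsilon> / 2) / L f) \<le> wasserstein S P Q"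
      using F(2) F(3)[OF f] L[OF f] 
      by (intro wasserstein_ge_integral_diff borel_measurable_continuous_on_restrict) auto
    also note Q(2)
    finally have "(\<bar>integral\<^sup>L P f - integral\<^sup>L Q f\<bar> - \<epsilon> / 2) / L f < \<eta>"
      by (metis ennreal_leI not_le)
    also note \<eta>(2)[OF f]
    finally show ?thesis using L(1)[OF f] by (simp add: field_simps abs_minus_commute)
  qed
  then show False using F(4)[OF Qp] Q(1) by blast
qed

subsection \<open>Large deviations lower bound\<close>

text \<open>The hypothesis \<open>dom\<close> says that the measure with density exp (- \<phi>)
  relative to \<open>Q\<close> lies below \<open>P\<close>, and this domination passes to products
  one coordinate at a time. It is an inequality because \<open>P\<close> may have mass that the
  tilted \<open>Q\<close> does not see; for lower bounds on probabilities under \<open>P\<close>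
  that is the right direction.\<close>

lemma nn_integral_PiM_change_of_measure:
  fixes \<phi> :: "'a \<Rightarrow> real"
  assumes P: "prob_space P" and Q: "prob_space Q" and sets: "sets Q = sets P"
    and \<phi>: "\<phi> \<in> borel_measurable P"
    and dom: "\<And>B. B \<in> sets P \<Longrightarrow> (\<integral>\<^sup>+ x. ennreal (exp (- \<phi> x)) * indicator B x \<partial>Q) \<le> emeasure P B"
    and "finite I" "u \<in> borel_measurable (PiM I (\<lambda>_. P))"
  shows "(\<integral>\<^sup>+ \<omega>. u \<omega> * ennreal (exp (- (\<Sum>i\<in>I. \<phi> (\<omega> i)))) \<partial>PiM I (\<lambda>_. Q)) \<le> (\<integral>\<^sup>+ \<omega>. u \<omega> \<partial>PiM I (\<lambda>_. P))"
  using assms(6,7)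
proof (induction I arbitrary: u rule: finite_induct)
  case empty
  then show ?case by (simp add: nn_integral_cmult PiM_empty nn_integral_count_space_finite)
next
  case (insert i I)
  interpret P: prob_space P by fact
  interpret Q: prob_space Q by fact
  interpret PP: product_prob_space "\<lambda>_. P" "insert i I" by standard
  interpret QQ: product_prob_space "\<lambda>_. Q" "insert i I" by standard
  note sets[measurable_cong] \<phi>[measurable]
  have sPi[measurable_cong]: "sets (PiM J (\<lambda>_. Q)) = sets (PiM J (\<lambda>_. P))" for J :: "'b set"
    by (intro sets_PiM_cong) (auto simp: sets)
  have u[measurable]: "u \<in> borel_measurable (PiM (insert i I) (\<lambda>_. P))" by fact
  have one: "(\<integral>\<^sup>+ y. v y * ennreal (exp (- \<phi> y)) \<partial>Q) \<le> (\<integral>\<^sup>+ y. v y \<partial>P)"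
    if [measurable]: "v \<in> borel_measurable P" for v
  proof -
    have "density Q (\<lambda>y. ennreal (exp (- \<phi> y))) \<le> P"
    proof (rule le_measure[THEN iffD2])
      show "\<forall>X\<in>sets (density Q (\<lambda>y. ennreal (exp (- \<phi> y)))). 
         emeasure (density Q (\<lambda>y. ennreal (exp (- \<phi> y)))) X \<le> emeasure P X"
        using dom by (auto simp: emeasure_density sets)
    qed (simp add: sets)
    then have "(\<integral>\<^sup>+ y. v y \<partial>density Q (\<lambda>y. ennreal (exp (- \<phi> y)))) \<le> (\<integral>\<^sup>+ y. v y \<partial>P)"
      by (intro nn_integral_mono_measure) (simp_all add: sets)
    then show ?thesis by (simp add: nn_integral_density mult.commute)
  qed
  let ?v = "\<lambda>x. \<integral>\<^sup>+ y. u (x(i := y)) * ennreal (exp (- \<phi> y)) \<partial>Q"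
  have fin: "finite (insert i I)" using insert by simp
  have [simp]: "(\<Sum>j\<in>I. \<phi> (if j = i then y else x j)) = (\<Sum>j\<in>I. \<phi> (x j))" for x y
    using insert by (intro sum.cong) auto
  have "(\<integral>\<^sup>+ \<omega>. u \<omega> * ennreal (exp (- (\<Sum>i\<in>insert i I. \<phi> (\<omega> i)))) \<partial>PiM (insert i I) (\<lambda>_. Q)) =
    (\<integral>\<^sup>+ x. \<integral>\<^sup>+ y. u (x(i := y)) * ennreal (exp (- (\<Sum>j\<in>insert i I. \<phi> ((x(i := y)) j)))) \<partial>Q \<partial>PiM I (\<lambda>_. Q))"
    using insert by (intro QQ.product_nn_integral_insert) measurable
  also have "\<dots> = (\<integral>\<^sup>+ x. ?v x * ennreal (exp (- (\<Sum>j\<in>I. \<phi> (x j)))) \<partial>PiM I (\<lambda>_. Q))"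
  proof (intro nn_integral_cong)
    fix x assume [measurable]: "x \<in> space (PiM I (\<lambda>_. Q))"
    have [measurable]: "(\<lambda>y. u (x(i := y))) \<in> borel_measurable P"
      using \<open>x \<in> _\<close> sets_eq_imp_space_eq[OF sPi[of I]]
      by (intro measurable_compose[OF measurable_component_update[OF _ insert(2)] u]) simp
    have "(\<integral>\<^sup>+ y. u (x(i := y)) * ennreal (exp (- (\<Sum>j\<in>insert i I. \<phi> ((x(i := y)) j)))) \<partial>Q) =
       (\<integral>\<^sup>+ y. u (x(i := y)) * ennreal (exp (- \<phi> y)) * ennreal (exp (- (\<Sum>j\<in>I. \<phi> (x j)))) \<partial>Q)"
      using insert by (intro nn_integral_cong)
        (simp add: exp_diff exp_minus divide_inverse ennreal_mult[symmetric] mult.assoc exp_add[symmetric])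
    also have "\<dots> = ?v x * ennreal (exp (- (\<Sum>j\<in>I. \<phi> (x j))))"
      by (rule nn_integral_multc) measurable
    finally show "(\<integral>\<^sup>+ y. u (x(i := y)) * ennreal (exp (- (\<Sum>j\<in>insert i I. \<phi> ((x(i := y)) j)))) \<partial>Q) =
      ?v x * ennreal (exp (- (\<Sum>j\<in>I. \<phi> (x j))))" .
  qed
  also have "\<dots> \<le> (\<integral>\<^sup>+ x. ?v x \<partial>PiM I (\<lambda>_. P))"
    by (rule insert.IH) measurable
  also have "\<dots> \<le> (\<integral>\<^sup>+ x. \<integral>\<^sup>+ y. u (x(i := y)) \<partial>P \<partial>PiM I (\<lambda>_. P))"
  proof (intro nn_integral_mono one)
    fix x assume "x \<in> space (PiM I (\<lambda>_. P))"
    then show "(\<lambda>y. u (x(i := y))) \<in> borel_measurable P"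
      by (intro measurable_compose[OF measurable_component_update[OF _ insert(2)] u])
  qed
  also have "\<dots> = (\<integral>\<^sup>+ \<omega>. u \<omega> \<partial>PiM (insert i I) (\<lambda>_. P))"
    using insert by (intro PP.product_nn_integral_insert[symmetric]) measurable
  finally show ?case .
qed

text \<open>The log-likelihood \<open>\<Phi>\<close> of the sample enters only through its mean.
  Instead of restricting to an event on which \<open>\<Phi>\<close> is close to its mean, exp (-
  \<Phi>) is bounded below by a function affine in \<open>\<Phi>\<close> and integrated. The final
  \<open>- 1\<close> stems from the total mass of the tilted product measure, which is at most that
  of the product of \<open>P\<close>. The threshold \<open>a\<close> is free; it will be slightly
  larger than the mean of \<open>\<Phi>\<close>.\<close>

lemma product_measure_lower_bound:
  fixes \<phi> :: "'a \<Rightarrow> real"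
  assumes P: "prob_space P" and Q: "prob_space Q" and sets: "sets Q = sets P"
    and int: "integrable Q \<phi>"
    and dom: "\<And>B. B \<in> sets P \<Longrightarrow> (\<integral>\<^sup>+ x. ennreal (exp (- \<phi> x)) * indicator B x \<partial>Q) \<le> emeasure P B"
    and I: "finite I" and E: "E \<in> sets (PiM I (\<lambda>_. Q))"
  shows "exp (- a) * ((1 + a) * measure (PiM I (\<lambda>_. Q)) E - card I * integral\<^sup>L Q \<phi> - 1) \<le> measure (PiM I (\<lambda>_. P)) E"
proof -
  interpret P: prob_space P by fact
  interpret Q: prob_space Q by fact
  interpret PP: product_prob_space "\<lambda>_. P" I by standard
  interpret QQ: product_prob_space "\<lambda>_. Q" I by standard
  have sPi[measurable_cong]: "sets (PiM I (\<lambda>_. Q)) = sets (PiM I (\<lambda>_. P))"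
    by (intro sets_PiM_cong) (auto simp: sets)
  have \<phi>: "\<phi> \<in> borel_measurable P" 
    using borel_measurable_integrable[OF int] sets by (simp cong: measurable_cong_sets)
  note sets[measurable_cong] \<phi>[measurable] E[measurable]
  have E'[measurable]: "E \<in> sets (PiM I (\<lambda>_. P))" using E sPi by simp
  note change = nn_integral_PiM_change_of_measure[OF P Q sets \<phi> dom I]
  define \<Phi> where "\<Phi> \<omega> = (\<Sum>i\<in>I. \<phi> (\<omega> i))" for \<omega>
  have [measurable]: "\<Phi> \<in> borel_measurable (PiM I (\<lambda>_. P))"
    unfolding \<Phi>_def by measurable
  have comp: "integrable (PiM I (\<lambda>_. Q)) (\<lambda>\<omega>. \<phi> (\<omega> i))" "(\<integral>\<omega>. \<phi> (\<omega> i) \<partial>PiM I (\<lambda>_. Q)) = integral\<^sup>L Q \<phi>" if i: "i \<in> I" for i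
  proof -
    have d: "distr (PiM I (\<lambda>_. Q)) Q (\<lambda>\<omega>. \<omega> i) = Q"
      using distr_PiM_component[of I "\<lambda>_. Q" i] Q i by simp
    have m: "(\<lambda>\<omega>. \<omega> i) \<in> PiM I (\<lambda>_. Q) \<rightarrow>\<^sub>M Q" using i by measurable
    show "integrable (PiM I (\<lambda>_. Q)) (\<lambda>\<omega>. \<phi> (\<omega> i))"
      using integrable_distr[OF m, of \<phi>] int by (simp add: d)
    show "(\<integral>\<omega>. \<phi> (\<omega> i) \<partial>PiM I (\<lambda>_. Q)) = integral\<^sup>L Q \<phi>"
      using integral_distr[OF m, of \<phi>] int by (simp add: d)
  qed
  have i\<Phi>: "integrable (PiM I (\<lambda>_. Q)) \<Phi>" "integral\<^sup>L (PiM I (\<lambda>_. Q)) \<Phi> = card I * integral\<^sup>L Q \<phi>"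
    unfolding \<Phi>_def[abs_def] using comp by auto
  have J: "(\<integral>\<^sup>+ \<omega>. ennreal (exp (- \<Phi> \<omega>)) \<partial>PiM I (\<lambda>_. Q)) \<le> 1"
    using change[of "\<lambda>_. 1"] PP.emeasure_space_1 by (simp add: \<Phi>_def)
  have ie: "integrable (PiM I (\<lambda>_. Q)) (\<lambda>\<omega>. exp (- \<Phi> \<omega>))"
    using le_less_trans[OF J] by (intro integrableI_nonneg) auto
  have J': "(\<integral>\<omega>. exp (- \<Phi> \<omega>) \<partial>PiM I (\<lambda>_. Q)) \<le> 1"
    using J by (subst (asm) nn_integral_eq_integral[OF ie]) auto
  have iE: "integrable (PiM I (\<lambda>_. Q)) (\<lambda>\<omega>. indicator E \<omega> * exp (- \<Phi> \<omega>))"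
    by (rule Bochner_Integration.integrable_bound[OF ie]) (auto simp: indicator_def)
  have "ennreal (\<integral>\<omega>. indicator E \<omega> * exp (- \<Phi> \<omega>) \<partial>PiM I (\<lambda>_. Q)) = 
      (\<integral>\<^sup>+ \<omega>. indicator E \<omega> * ennreal (exp (- \<Phi> \<omega>)) \<partial>PiM I (\<lambda>_. Q))"
    by (subst nn_integral_eq_integral[OF iE, symmetric]) (auto simp: indicator_def intro!: nn_integral_cong)
  also have "\<dots> \<le> (\<integral>\<^sup>+ \<omega>. indicator E \<omega> \<partial>PiM I (\<lambda>_. P))"
    unfolding \<Phi>_def by (rule change, assumption, rule borel_measurable_indicator[OF E'])
  also have "\<dots> = ennreal (measure (PiM I (\<lambda>_. P)) E)"
    by (simp add: PP.emeasure_eq_measure)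
  finally have 1: "(\<integral>\<omega>. indicator E \<omega> * exp (- \<Phi> \<omega>) \<partial>PiM I (\<lambda>_. Q)) \<le> measure (PiM I (\<lambda>_. P)) E"
    by (simp add: ennreal_le_iff)
  \<comment> \<open>On \<open>E\<close> this is \<open>1 + y \<le> exp y\<close> for \<open>y = a - \<Phi>\<close>; off \<open>E\<close> the summand \<open>exp (- \<Phi>)\<close> absorbs a negative \<open>\<Phi>\<close>,
    at the price of the \<open>- 1\<close> in the bound.\<close>
  have pointwise: "exp (- a) * ((1 + a) * indicator E \<omega> - \<Phi> \<omega> - exp (- \<Phi> \<omega>)) \<le> indicator E \<omega> * exp (- \<Phi> \<omega>)" for \<omega>
  proof (cases "\<omega> \<in> E")
    case True
    have "1 + a - \<Phi> \<omega> - exp (- \<Phi> \<omega>) \<le> exp (a - \<Phi> \<omega>)"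
      using exp_ge_add_one_self[of "a - \<Phi> \<omega>"] exp_ge_zero[of "- \<Phi> \<omega>"] by linarith
    then have "exp (- a) * (1 + a - \<Phi> \<omega> - exp (- \<Phi> \<omega>)) \<le> exp (- a) * exp (a - \<Phi> \<omega>)"
      by (intro mult_left_mono) auto
    also have "\<dots> = exp (- \<Phi> \<omega>)" by (simp add: exp_add[symmetric])
    finally show ?thesis using True by simp
  next
    case False
    have "- \<Phi> \<omega> - exp (- \<Phi> \<omega>) \<le> 0" using exp_ge_add_one_self[of "- \<Phi> \<omega>"] by linarith
    then show ?thesis using False by (simp add: mult_le_0_iff)
  qed
  have "exp (- a) * ((1 + a) * measure (PiM I (\<lambda>_. Q)) E - card I * integral\<^sup>L Q \<phi> - 1) \<le>
     exp (- a) * ((1 + a) * measure (PiM I (\<lambda>_. Q)) E - card I * integral\<^sup>L Q \<phi> - (\<integral>\<omega>. exp (- \<Phi> \<omega>) \<partial>PiM I (\<lambda>_. Q)))"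
    using J' by (intro mult_left_mono) auto
  also have "\<dots> = (\<integral>\<omega>. exp (- a) * ((1 + a) * indicator E \<omega> - \<Phi> \<omega> - exp (- \<Phi> \<omega>)) \<partial>PiM I (\<lambda>_. Q))"
    using i\<Phi> ie by (simp add: QQ.emeasure_eq_measure)
  also have "\<dots> \<le> (\<integral>\<omega>. indicator E \<omega> * exp (- \<Phi> \<omega>) \<partial>PiM I (\<lambda>_. Q))"
    using i\<Phi> ie iE by (intro integral_mono pointwise) (auto simp: QQ.emeasure_eq_measure)
  also note 1
  finally show ?thesis .
qed

section \<open>Empirical measures: integrals, concentration and measurability\<close>

lemma empirical_eq_distr:
  assumes N: "N > 0" and \<omega>: "\<And>i. i < N \<Longrightarrow> \<omega> i \<in> S"
  shows "empirical S N \<omega> = distr (uniform_count_measure {..<N}) (borel_on S) \<omega>"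
proof (rule measure_eqI)
  fix B assume "B \<in> sets (empirical S N \<omega>)"
  then have B: "B \<in> sets (borel_on S)" by simp
  have m: "\<omega> \<in> uniform_count_measure {..<N} \<rightarrow>\<^sub>M borel_on S"
    using \<omega> by (auto simp: measurable_def space_uniform_count_measure sets_uniform_count_measure)
  have "(\<Sum>i<N. indicator B (\<omega> i) :: ennreal) = of_nat (card (\<omega> -` B \<inter> {..<N}))"
    by (simp add: indicator_def sum.If_cases Int_commute vimage_def)
  then show "emeasure (empirical S N \<omega>) B = emeasure (distr (uniform_count_measure {..<N}) (borel_on S) \<omega>) B"
    using N by (simp add: emeasure_empirical[OF B] emeasure_distr[OF m B] space_uniform_count_measure
        emeasure_uniform_count_measure ennreal_of_nat_eq_real_of_nat divide_ennreal)
qed simp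

lemma integral_empirical:
  fixes f :: "'a::topological_space \<Rightarrow> real"
  assumes "N > 0" "\<And>i. i < N \<Longrightarrow> \<omega> i \<in> S" "f \<in> borel_measurable (borel_on S)"
  shows "integral\<^sup>L (empirical S N \<omega>) f = (\<Sum>i<N. f (\<omega> i)) / N"
proof -
  have m: "\<omega> \<in> uniform_count_measure {..<N} \<rightarrow>\<^sub>M borel_on S"
    using assms(2) by (auto simp: measurable_def space_uniform_count_measure sets_uniform_count_measure)
  show ?thesis
    using assms by (simp add: empirical_eq_distr integral_distr[OF m] integral_uniform_count_measure)
qed

lemma empirical_cong: "(\<And>i. i < N \<Longrightarrow> \<omega> i = \<omega>' i) \<Longrightarrow> empirical S N \<omega> = empirical S N \<omega>'"
  unfolding empirical_def by (intro arg_cong[of _ _ "measure_of _ _"] ext arg_cong2[of _ _ _ _ "(/)"] sum.cong) auto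

lemma indep_vars_PiM_coordinate:
  assumes "I \<noteq> {}" "\<And>i. i \<in> I \<Longrightarrow> prob_space (M i)"
  shows "prob_space.indep_vars (PiM I M) M (\<lambda>i \<omega>. \<omega> i) I"
proof -
  interpret prob_space "PiM I M" by (rule prob_space_PiM) (rule assms)
  have "distr (PiM I M) (PiM I M) (\<lambda>x. \<lambda>i\<in>I. x i) = distr (PiM I M) (PiM I M) (\<lambda>x. x)"
    by (intro distr_cong) (auto simp: space_PiM PiE_def extensional_restrict)
  also have "\<dots> = (\<Pi>\<^sub>M i\<in>I. distr (PiM I M) (M i) (\<lambda>\<omega>. \<omega> i))"
    unfolding distr_id using assms by (intro PiM_cong refl) (simp add: distr_PiM_component)
  finally show ?thesis
    using assms by (subst indep_vars_iff_distr_eq_PiM') auto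
qed

lemma empirical_mean_concentration:
  fixes f :: "'a \<Rightarrow> real" and N :: nat
  assumes Q: "prob_space Q" and f: "f \<in> borel_measurable Q" "\<And>x. x \<in> space Q \<Longrightarrow> \<bar>f x\<bar> \<le> B"
    and "\<epsilon> > 0" "N > 0" "B > 0"
  shows "measure (PiM {..<N} (\<lambda>_. Q)) {\<omega> \<in> space (PiM {..<N} (\<lambda>_. Q)). \<epsilon> \<le> \<bar>(\<Sum>i<N. f (\<omega> i)) / N - integral\<^sup>L Q f\<bar>}
          \<le> 2 * exp (- (\<epsilon>\<^sup>2 / (2 * B\<^sup>2)) * N)"
proof -
  let ?M = "PiM {..<N} (\<lambda>_. Q)"
  interpret Q: prob_space Q by fact
  interpret prob_space ?M by (rule prob_space_PiM) (rule Q)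
  note f(1)[measurable]
  have comp: "distr ?M borel (\<lambda>\<omega>. f (\<omega> i)) = distr Q borel f" if "i < N" for i
  proof -
    have "distr ?M borel (\<lambda>\<omega>. f (\<omega> i)) = distr (distr ?M Q (\<lambda>\<omega>. \<omega> i)) borel f"
      using that by (subst distr_distr) (auto simp: comp_def)
    also have "distr ?M Q (\<lambda>\<omega>. \<omega> i) = Q"
      using distr_PiM_component[of "{..<N}" "\<lambda>_. Q" i] Q that by simp
    finally show ?thesis .
  qed
  have mean: "expectation (\<lambda>\<omega>. f (\<omega> 0)) = integral\<^sup>L Q f"
  proof -
    have "expectation (\<lambda>\<omega>. f (\<omega> 0)) = integral\<^sup>L (distr ?M borel (\<lambda>\<omega>. f (\<omega> 0))) (\<lambda>x. x)"
      using \<open>N > 0\<close> by (subst integral_distr) auto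
    also have "\<dots> = integral\<^sup>L Q f"
      unfolding comp[OF \<open>N > 0\<close>] by (subst integral_distr) auto
    finally show ?thesis .
  qed
  have "indep_vars (\<lambda>_. borel) (\<lambda>i \<omega>. f (\<omega> i)) {..<N}"
    using \<open>N > 0\<close> Q by (intro indep_vars_compose2[OF indep_vars_PiM_coordinate]) auto
  interpret H: Hoeffding_ineq_iid ?M "{..<N}" "\<lambda>i \<omega>. f (\<omega> i)" "\<lambda>\<omega>. f (\<omega> 0)" "- B" B "integral\<^sup>L Q f"
  proof unfold_locales
    show "distr ?M borel (\<lambda>\<omega>. f (\<omega> i)) = distr ?M borel (\<lambda>\<omega>. f (\<omega> 0))" if "i \<in> {..<N}" for i
      using comp that \<open>N > 0\<close> by simp
    show "AE \<omega> in ?M. f (\<omega> 0) \<in> {- B..B}"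
    proof (rule AE_I2)
      fix \<omega> assume "\<omega> \<in> space ?M"
      then have "\<omega> 0 \<in> space Q" using \<open>N > 0\<close> by (auto simp: space_PiM)
      then have "\<bar>f (\<omega> 0)\<bar> \<le> B" by (rule f(2))
      then show "f (\<omega> 0) \<in> {- B..B}" unfolding atLeastAtMost_iff by linarith
    qed
    show "integral\<^sup>L Q f \<equiv> expectation (\<lambda>\<omega>. f (\<omega> 0))" by (rule eq_reflection) (rule mean[symmetric])
  qed (use \<open>indep_vars _ _ _\<close> \<open>N > 0\<close> in auto)
  have "prob {\<omega> \<in> space ?M. \<epsilon> \<le> \<bar>(\<Sum>i<N. f (\<omega> i)) / N - integral\<^sup>L Q f\<bar>} =
     prob {\<omega> \<in> space ?M. N * \<epsilon> \<le> \<bar>(\<Sum>i<N. f (\<omega> i)) - N * integral\<^sup>L Q f\<bar>}"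
  proof -
    have "\<epsilon> \<le> \<bar>s / N - m\<bar> \<longleftrightarrow> N * \<epsilon> \<le> \<bar>s - N * m\<bar>" for s m :: real
    proof -
      have "s - N * m = N * (s / N - m)"
        using \<open>N > 0\<close> by (simp add: right_diff_distrib)
      then have "\<bar>s - N * m\<bar> = N * \<bar>s / N - m\<bar>"
        by (simp only: abs_mult abs_of_nat)
      then show ?thesis using \<open>N > 0\<close> by simp
    qed
    then show ?thesis by simp
  qed
  \<comment> \<open>Hoeffding's inequality for the sum with deviation \<open>N * \<epsilon>\<close>;
    each summand ranges over an interval of length 2 B.\<close>
  also have "\<dots> \<le> 2 * exp (- 2 * (N * \<epsilon>)\<^sup>2 / (N * (B - - B)\<^sup>2))"
  proof -
    have "{..<N} \<noteq> {}" using \<open>N > 0\<close> by auto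
    then show ?thesis using H.Hoeffding_ineq_abs_ge[of "N * \<epsilon>"] assms(4-6) by simp
  qed
  also have "- 2 * (N * \<epsilon>)\<^sup>2 / (N * (B - - B)\<^sup>2) = - (\<epsilon>\<^sup>2 / (2 * B\<^sup>2)) * N"
    using assms(4-6) by (simp add: power2_eq_square field_simps)
  finally show ?thesis .
qed

text \<open>Serves measurability: the event that the empirical measure lies in an arbitrary weakly
  open set is relatively open in the space of samples, hence Borel, and no countable base of the
  weak topology has to be discussed.\<close>

lemma continuous_map_empirical:
  fixes S :: "'a::topological_space set"
  assumes N: "N > 0"
  shows "continuous_map (top_of_set (UNIV \<rightarrow> S)) (weak_topology S) (empirical S N)"
  unfolding weak_topology_def continuous_on_generated_topo_iff
proof (intro conjI allI impI)
  let ?B = "{{P \<in> probs S. integral\<^sup>L P f \<in> U} | (f :: 'a \<Rightarrow> real) U.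
        continuous_on S f \<and> bounded (f ` S) \<and> open U}"
  have ep: "empirical S N \<omega> \<in> probs S" if "\<omega> \<in> UNIV \<rightarrow> S" for \<omega>
    using that N by (intro empirical_in_probs) auto
  have "\<Union>?B = probs S"
    using topspace_weak_topology[of S] unfolding weak_topology_def topology_generated_by_topspace .
  then show "empirical S N ` topspace (top_of_set (UNIV \<rightarrow> S)) \<subseteq> \<Union>?B"
    using ep by auto
  have *: "openin (top_of_set (UNIV \<rightarrow> S)) (empirical S N -` {P \<in> probs S. integral\<^sup>L P f \<in> U} \<inter> topspace (top_of_set (UNIV \<rightarrow> S)))"
    if f: "continuous_on S f" and "open U" for f :: "'a \<Rightarrow> real" and U
  proof -
    let ?h = "\<lambda>\<omega>. (\<Sum>i<N. f (\<omega> i)) / N"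
    have "continuous_on (UNIV \<rightarrow> S) (\<lambda>\<omega>. f (\<omega> i))" for i :: nat
      by (rule continuous_on_compose2[OF f continuous_on_subset[OF continuous_on_product_coordinates subset_UNIV]]) auto
    then have "continuous_on (UNIV \<rightarrow> S) ?h"
      using N by (intro continuous_intros) auto
    then have "openin (top_of_set (UNIV \<rightarrow> S)) ((UNIV \<rightarrow> S) \<inter> ?h -` U)"
      using \<open>open U\<close> by (rule continuous_openin_preimage_gen)
    also have "(UNIV \<rightarrow> S) \<inter> ?h -` U = empirical S N -` {P \<in> probs S. integral\<^sup>L P f \<in> U} \<inter> topspace (top_of_set (UNIV \<rightarrow> S))"
    proof -
      have "integral\<^sup>L (empirical S N \<omega>) f = ?h \<omega>" if "\<omega> \<in> UNIV \<rightarrow> S" for \<omega>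
        using that N by (intro integral_empirical borel_measurable_continuous_on_restrict f) auto
      then show ?thesis using ep by auto
    qed
    finally show ?thesis .
  qed
  show "openin (top_of_set (UNIV \<rightarrow> S)) (empirical S N -` W \<inter> topspace (top_of_set (UNIV \<rightarrow> S)))" if "W \<in> ?B" for W
    using that by clarify (rule *)
qed

lemma sets_empirical_event:
  fixes S :: "'a::second_countable_topology set"
  assumes N: "N > 0" and U: "openin (weak_topology S) U" and P: "P \<in> probs S"
  shows "{\<omega> \<in> space (PiM UNIV (\<lambda>_. P)). empirical S N \<omega> \<in> U} \<in> sets (PiM UNIV (\<lambda>_. P))"
    and "{\<omega> \<in> space (PiM {..<N} (\<lambda>_. P)). empirical S N \<omega> \<in> U} \<in> sets (PiM {..<N} (\<lambda>_. P))"
proof -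
  have sp: "space (PiM UNIV (\<lambda>_ :: nat. P)) = (UNIV \<rightarrow> S)"
    by (simp add: space_PiM space_probs[OF P] PiE_def)
  have "openin (top_of_set (UNIV \<rightarrow> S)) {\<omega> \<in> UNIV \<rightarrow> S. empirical S N \<omega> \<in> U}"
    using openin_continuous_map_preimage[OF continuous_map_empirical[OF N] U] by simp
  then obtain W where W: "open W" "{\<omega> \<in> UNIV \<rightarrow> S. empirical S N \<omega> \<in> U} = (UNIV \<rightarrow> S) \<inter> W"
    by (auto simp: openin_open)
  have id: "(\<lambda>x. x) \<in> P \<rightarrow>\<^sub>M borel"
    using P by (subst measurable_cong_sets[of P "borel_on S"]) (auto simp: in_probs_iff intro: measurable_restrict_space1)
  have "(\<lambda>\<omega>. \<omega> i) \<in> borel_measurable (PiM UNIV (\<lambda>_ :: nat. P))" for i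
    using measurable_compose[OF measurable_component_singleton[of i UNIV "\<lambda>_. P"] id] by simp
  then have "(\<lambda>\<omega>. \<omega>) \<in> borel_measurable (PiM UNIV (\<lambda>_ :: nat. P))"
    by (rule measurable_coordinatewise_then_product)
  from measurable_sets[OF this borel_open[OF W(1)]]
  have "W \<inter> (UNIV \<rightarrow> S) \<in> sets (PiM UNIV (\<lambda>_ :: nat. P))" by (simp add: sp)
  then show 1: "{\<omega> \<in> space (PiM UNIV (\<lambda>_. P)). empirical S N \<omega> \<in> U} \<in> sets (PiM UNIV (\<lambda>_. P))"
    unfolding sp W(2) by (simp add: Int_commute)
  \<comment> \<open>A point of the finite product is \<open>undefined\<close> from index
    \<open>N\<close> on, which need not lie in \<open>S\<close>. Repeating the sample
    \<open>\<omega> 0\<close> gives a genuine sequence with the same empirical measure.\<close>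
  define ext where "ext \<omega> i = (if i < N then \<omega> i else \<omega> 0)" for \<omega> :: "nat \<Rightarrow> 'a" and i
  have "ext \<in> PiM {..<N} (\<lambda>_. P) \<rightarrow>\<^sub>M PiM UNIV (\<lambda>_. P)"
  proof (rule measurable_PiM_single')
    show "(\<lambda>\<omega>. ext \<omega> i) \<in> PiM {..<N} (\<lambda>_. P) \<rightarrow>\<^sub>M P" for i
    proof (cases "i < N")
      case True
      then show ?thesis by (simp add: ext_def measurable_component_singleton)
    next
      case False
      then show ?thesis using N by (simp add: ext_def measurable_component_singleton)
    qed
    show "ext \<in> space (PiM {..<N} (\<lambda>_. P)) \<rightarrow> (\<Pi>\<^sub>E i\<in>UNIV. space P)"
      using N by (simp add: ext_def space_PiM PiE_iff Pi_iff)
  qed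
  from measurable_sets[OF this 1]
  have "ext -` {\<omega> \<in> space (PiM UNIV (\<lambda>_. P)). empirical S N \<omega> \<in> U} \<inter> space (PiM {..<N} (\<lambda>_. P)) \<in> sets (PiM {..<N} (\<lambda>_. P))" .
  also have "ext -` {\<omega> \<in> space (PiM UNIV (\<lambda>_. P)). empirical S N \<omega> \<in> U} \<inter> space (PiM {..<N} (\<lambda>_. P)) =
     {\<omega> \<in> space (PiM {..<N} (\<lambda>_. P)). empirical S N \<omega> \<in> U}"
  proof -
    have "empirical S N (ext \<omega>) = empirical S N \<omega>" for \<omega>
      by (rule empirical_cong) (simp add: ext_def)
    moreover have "ext \<omega> \<in> space (PiM UNIV (\<lambda>_. P))" if "\<omega> \<in> space (PiM {..<N} (\<lambda>_. P))" for \<omega>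
      using that N by (simp add: ext_def space_PiM PiE_iff)
    ultimately show ?thesis by (auto simp only: vimage_eq Int_iff mem_Collect_eq)
  qed
  finally show "{\<omega> \<in> space (PiM {..<N} (\<lambda>_. P)). empirical S N \<omega> \<in> U} \<in> sets (PiM {..<N} (\<lambda>_. P))" .
qed

text \<open>The event depends on the first \<open>N\<close> coordinates only. This moves it from the
  infinite product, where disappointment is defined, to the finite one, where the change of measure
  is available.\<close>

lemma measure_empirical_event:
  fixes S :: "'a::second_countable_topology set"
  assumes N: "N > 0" and U: "openin (weak_topology S) U" and P: "P \<in> probs S"
  shows "measure (PiM UNIV (\<lambda>_. P)) {\<omega> \<in> space (PiM UNIV (\<lambda>_. P)). empirical S N \<omega> \<in> U} =
     measure (PiM {..<N} (\<lambda>_. P)) {\<omega> \<in> space (PiM {..<N} (\<lambda>_. P)). empirical S N \<omega> \<in> U}"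
proof -
  interpret P: prob_space P using P by (simp add: in_probs_iff)
  interpret PP: product_prob_space "\<lambda>_. P" "UNIV :: nat set" by standard
  let ?E = "{\<omega> \<in> space (PiM {..<N} (\<lambda>_. P)). empirical S N \<omega> \<in> U}"
  have r: "(\<lambda>x. restrict x {..<N}) \<in> PiM UNIV (\<lambda>_. P) \<rightarrow>\<^sub>M PiM {..<N} (\<lambda>_. P)"
    by (rule measurable_restrict_subset) auto
  have "measure (PiM {..<N} (\<lambda>_. P)) ?E = measure (distr (PiM UNIV (\<lambda>_. P)) (PiM {..<N} (\<lambda>_. P)) (\<lambda>x. restrict x {..<N})) ?E"
    using PP.distr_PiM_restrict_finite[of "{..<N}"] by simp
  also have "\<dots> = measure (PiM UNIV (\<lambda>_. P)) ((\<lambda>x. restrict x {..<N}) -` ?E \<inter> space (PiM UNIV (\<lambda>_. P)))"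
    by (rule measure_distr[OF r sets_empirical_event(2)[OF assms]])
  also have "(\<lambda>x. restrict x {..<N}) -` ?E \<inter> space (PiM UNIV (\<lambda>_. P)) = {\<omega> \<in> space (PiM UNIV (\<lambda>_. P)). empirical S N \<omega> \<in> U}"
  proof -
    have "empirical S N (restrict \<omega> {..<N}) = empirical S N \<omega>" for \<omega>
      by (rule empirical_cong) simp
    then show ?thesis by (auto simp: space_PiM)
  qed
  finally show ?thesis by simp
qed

text \<open>A weak neighbourhood of \<open>Q\<close> contains one given by finitely many test
  functions, so a union bound over Hoeffding's inequality suffices.\<close>

lemma empirical_measures_converge_in_probability:
  fixes S :: "'a::second_countable_topology set"
  assumes U: "openin (weak_topology S) U" and Q: "Q \<in> U"
  shows "(\<lambda>N. measure (PiM {..<N} (\<lambda>_. Q)) {\<omega> \<in> space (PiM {..<N} (\<lambda>_. Q)). empirical S N \<omega> \<in> U}) \<longlonglongrightarrow> 1"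
proof -
  let ?M = "\<lambda>N. PiM {..<N} (\<lambda>_. Q)" and ?E = "\<lambda>N. {\<omega> \<in> space (PiM {..<N} (\<lambda>_. Q)). empirical S N \<omega> \<in> U}"
  have Qp: "Q \<in> probs S" using openin_subset[OF U] Q by auto
  interpret Q: prob_space Q using Qp by (simp add: in_probs_iff)
  have pM: "prob_space (?M N)" for N by (rule prob_space_PiM) (rule Q.prob_space_axioms)
  obtain \<F> \<epsilon> where F: "finite \<F>" "\<epsilon> > 0" 
    "\<And>f :: 'a \<Rightarrow> real. f \<in> \<F> \<Longrightarrow> continuous_on S f \<and> bounded (f ` S)"
    "\<And>P. P \<in> probs S \<Longrightarrow> (\<And>f. f \<in> \<F> \<Longrightarrow> \<bar>integral\<^sup>L P f - integral\<^sup>L Q f\<bar> < \<epsilon>) \<Longrightarrow> P \<in> U"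
    using weak_topology_basic_neighbourhood[OF U Q] by blast
  have "\<exists>B>0. \<forall>x\<in>S. \<bar>f x\<bar> \<le> B" if "f \<in> \<F>" for f
    using F(3)[OF that] unfolding bounded_pos by auto
  then have "\<exists>B. \<forall>f\<in>\<F>. B f > 0 \<and> (\<forall>x\<in>S. \<bar>f x\<bar> \<le> B f)" by (intro bchoice ballI)
  then obtain B where B: "\<And>f. f \<in> \<F> \<Longrightarrow> B f > 0" "\<And>f x. f \<in> \<F> \<Longrightarrow> x \<in> S \<Longrightarrow> \<bar>f x\<bar> \<le> B f" by blast
  have fm: "f \<in> borel_measurable (borel_on S)" if "f \<in> \<F>" for f
    using F(3)[OF that] by (intro borel_measurable_continuous_on_restrict) auto
  then have fQ[measurable]: "f \<in> borel_measurable Q" if "f \<in> \<F>" for f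
    using that Qp by (subst measurable_cong_sets[of Q "borel_on S"]) (auto simp: in_probs_iff)
  have spQ: "space Q = S" by (rule space_probs[OF Qp])
  let ?b = "\<lambda>N. \<Sum>f\<in>\<F>. 2 * exp (- (\<epsilon>\<^sup>2 / (2 * (B f)\<^sup>2)) * real N)"
  have bound: "1 - ?b N \<le> measure (?M N) (?E N)" if N: "N > 0" for N
  proof -
    interpret M: prob_space "?M N" by (rule pM)
    let ?bad = "\<lambda>f. {\<omega> \<in> space (?M N). \<epsilon> \<le> \<bar>(\<Sum>i<N. f (\<omega> i)) / N - integral\<^sup>L Q f\<bar>}"
    have bad: "?bad f \<in> sets (?M N)" if [measurable]: "f \<in> \<F>" for f
      using fQ[OF that] by measurable
    have "space (?M N) - ?E N \<subseteq> (\<Union>f\<in>\<F>. ?bad f)"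
    proof (rule subsetI, rule ccontr)
      fix \<omega> assume \<omega>: "\<omega> \<in> space (?M N) - ?E N" "\<omega> \<notin> (\<Union>f\<in>\<F>. ?bad f)"
      have S: "\<omega> i \<in> S" if "i < N" for i using \<omega>(1) that by (auto simp: space_PiM spQ)
      have "empirical S N \<omega> \<in> U"
        using \<omega>(2) \<omega>(1) by (intro F(4) empirical_in_probs N S) (auto simp: integral_empirical[OF N S fm] not_le)
      then show False using \<omega>(1) by auto
    qed
    then have "measure (?M N) (space (?M N) - ?E N) \<le> measure (?M N) (\<Union>f\<in>\<F>. ?bad f)"
      using F(1) bad by (intro M.finite_measure_mono) auto
    also have "\<dots> \<le> (\<Sum>f\<in>\<F>. measure (?M N) (?bad f))"
      using F(1) bad by (intro measure_UNION_le) auto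
    also have "\<dots> \<le> ?b N"
      using B F(2) N fQ Q.prob_space_axioms spQ by (intro sum_mono empirical_mean_concentration) auto
    finally show ?thesis
      using M.prob_compl[OF sets_empirical_event(2)[OF N U Qp]] by simp
  qed
  have "(\<lambda>N. 1 - ?b N) \<longlonglongrightarrow> 1 - (\<Sum>f\<in>\<F>. 2 * 0)"
  proof (intro tendsto_intros)
    fix f assume f: "f \<in> \<F>"
    have "- (\<epsilon>\<^sup>2 / (2 * (B f)\<^sup>2)) < 0" using B(1)[OF f] F(2) by auto
    then have "filterlim (\<lambda>N. - (\<epsilon>\<^sup>2 / (2 * (B f)\<^sup>2)) * real N) at_bot sequentially"
      by (intro filterlim_tendsto_neg_mult_at_bot[OF tendsto_const _ filterlim_real_sequentially])
    then show "(\<lambda>N. exp (- (\<epsilon>\<^sup>2 / (2 * (B f)\<^sup>2)) * real N)) \<longlonglongrightarrow> 0"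
      by (rule filterlim_compose[OF exp_at_bot])
  qed
  then have l: "(\<lambda>N. 1 - ?b N) \<longlonglongrightarrow> 1" by simp
  show ?thesis
  proof (rule tendsto_sandwich[OF _ _ l tendsto_const])
    show "\<forall>\<^sub>F N in sequentially. 1 - ?b N \<le> measure (?M N) (?E N)"
      using eventually_gt_at_top[of 0] by eventually_elim (rule bound)
    show "\<forall>\<^sub>F N in sequentially. measure (?M N) (?E N) \<le> 1"
      using pM by (intro always_eventually allI prob_space.prob_le_1)
  qed
qed

section \<open>Mixtures, tilting and the lower bound for empirical events\<close>

lemma nn_integral_mixture:
  assumes s: "sets P = sets Q" and f: "f \<in> borel_measurable P"
  shows "(\<integral>\<^sup>+ x. f x \<partial>mixture t P Q) = ennreal t * (\<integral>\<^sup>+ x. f x \<partial>P) + ennreal (1 - t) * (\<integral>\<^sup>+ x. f x \<partial>Q)"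
  using f
proof (induction f rule: borel_measurable_induct)
  case (cong f g)
  have "(\<integral>\<^sup>+ x. f x \<partial>M) = (\<integral>\<^sup>+ x. g x \<partial>M)" if "space M = space P" for M
    using cong(3) that by (intro nn_integral_cong) auto
  then show ?case using cong(4) sets_eq_imp_space_eq[OF s] by simp
next
  case (set A)
  then show ?case using s by (simp add: emeasure_mixture)
next
  case (mult u c)
  note mult(2)[measurable]
  have "u \<in> borel_measurable Q" "u \<in> borel_measurable (mixture t P Q)"
    using mult(2) s by (simp_all cong: measurable_cong_sets)
  then show ?case using mult by (simp add: nn_integral_cmult distrib_left mult.left_commute)
next
  case (add u v)
  have "u \<in> borel_measurable Q" "u \<in> borel_measurable (mixture t P Q)"
     "v \<in> borel_measurable Q" "v \<in> borel_measurable (mixture t P Q)"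
    using add s by (simp_all cong: measurable_cong_sets)
  then show ?case using add by (simp add: nn_integral_add distrib_left ac_simps)
next
  case (seq U)
  have U: "U i \<in> borel_measurable Q" "U i \<in> borel_measurable (mixture t P Q)" for i
    using seq s by (simp_all cong: measurable_cong_sets)
  have inc: "incseq (\<lambda>i. ennreal c * (\<integral>\<^sup>+ x. U i x \<partial>M))" for c M
    using \<open>incseq U\<close> by (auto simp: incseq_def le_fun_def intro!: mult_left_mono nn_integral_mono)
  have "(\<integral>\<^sup>+ x. (SUP i. U i) x \<partial>mixture t P Q) =
      (SUP i. ennreal t * (\<integral>\<^sup>+ x. U i x \<partial>P) + ennreal (1 - t) * (\<integral>\<^sup>+ x. U i x \<partial>Q))"
    using seq U by (simp add: SUP_apply nn_integral_monotone_convergence_SUP image_comp)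
  also have "\<dots> = (SUP i. ennreal t * (\<integral>\<^sup>+ x. U i x \<partial>P)) + (SUP i. ennreal (1 - t) * (\<integral>\<^sup>+ x. U i x \<partial>Q))"
    by (intro ennreal_SUP_add inc)
  also have "\<dots> = ennreal t * (\<integral>\<^sup>+ x. (SUP i. U i) x \<partial>P) + ennreal (1 - t) * (\<integral>\<^sup>+ x. (SUP i. U i) x \<partial>Q)"
    using seq U by (simp add: SUP_apply nn_integral_monotone_convergence_SUP image_comp SUP_mult_left_ennreal)
  finally show ?case .
qed

lemma integral_mixture:
  fixes f :: "'a::topological_space \<Rightarrow> real"
  assumes P: "P \<in> probs S" and Q: "Q \<in> probs S" and t: "t \<in> {0..1}"
    and f: "f \<in> borel_measurable (borel_on S)" "bounded (f ` S)"
  shows "integral\<^sup>L (mixture t P Q) f = t * integral\<^sup>L P f + (1 - t) * integral\<^sup>L Q f"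
proof -
  obtain B where B: "\<And>x. x \<in> S \<Longrightarrow> \<bar>f x\<bar> \<le> B" using f(2) by (auto simp: bounded_iff)
  \<comment> \<open>Adding the bound \<open>B\<close> makes the function nonnegative on
    \<open>S\<close>, so that \<open>nn_integral_mixture\<close> applies; the constant cancels since
    all three measures have mass 1.\<close>
  define g where "g x = f x + B" for x
  have g: "\<And>x. x \<in> S \<Longrightarrow> 0 \<le> g x"
    using B by (fastforce simp: g_def abs_le_iff)
  have gm: "g \<in> borel_measurable (borel_on S)" using f(1) unfolding g_def by measurable
  have gb: "bounded (g ` S)"
  proof -
    have "g ` S = (\<lambda>x. B + x) ` (f ` S)" by (auto simp: g_def image_image ac_simps)
    then show ?thesis using f(2) by (simp only: bounded_translation)
  qed
  note M = mixture_in_probs[OF P Q t]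
  have nn: "(\<integral>\<^sup>+ x. ennreal (g x) \<partial>R) = ennreal (integral\<^sup>L R g)" "integral\<^sup>L R g = integral\<^sup>L R f + B" "0 \<le> integral\<^sup>L R g"
    if R: "R \<in> probs S" for R
  proof -
    interpret R: prob_space R using R by (simp add: in_probs_iff)
    have i: "integrable R g" "integrable R f" using R gm gb f by (auto intro: integrable_probs)
    show "(\<integral>\<^sup>+ x. ennreal (g x) \<partial>R) = ennreal (integral\<^sup>L R g)"
      using i g space_probs[OF R] by (intro nn_integral_eq_integral AE_I2) auto
    show "integral\<^sup>L R g = integral\<^sup>L R f + B"
      using i(2) R.prob_space unfolding g_def by simp
    show "0 \<le> integral\<^sup>L R g" using g space_probs[OF R] by (intro integral_nonneg_AE AE_I2) auto
  qed
  have "ennreal (integral\<^sup>L (mixture t P Q) g) = ennreal t * ennreal (integral\<^sup>L P g) + ennreal (1 - t) * ennreal (integral\<^sup>L Q g)"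
  proof -
    have "(\<lambda>x. ennreal (g x)) \<in> borel_measurable P"
      using gm P by (subst measurable_cong_sets[of P "borel_on S"]) (auto simp: in_probs_iff)
    then show ?thesis
      using nn_integral_mixture[of P Q "\<lambda>x. ennreal (g x)" t] P Q nn(1) M by (simp add: in_probs_iff)
  qed
  also have "\<dots> = ennreal (t * integral\<^sup>L P g + (1 - t) * integral\<^sup>L Q g)"
    using t nn(3)[OF P] nn(3)[OF Q] by (simp add: ennreal_mult)
  finally have "integral\<^sup>L (mixture t P Q) g = t * integral\<^sup>L P g + (1 - t) * integral\<^sup>L Q g"
    using t nn(3)[OF P] nn(3)[OF Q] nn(3)[OF M] by (subst (asm) ennreal_inj) auto
  then show ?thesis using nn(2)[OF P] nn(2)[OF Q] nn(2)[OF M] by (simp add: algebra_simps)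
qed

text \<open>For positive \<open>g\<close> the left side is g to the power t, and the claim is the
  weighted inequality between geometric and arithmetic means of \<open>g\<close> and 1. In the
  proof, two instances of 1 + y \<le> exp y are combined with weights t and 1 - t so that the
  logarithms cancel. For \<open>g = 0\<close> the left side is 0 whatever the value of
  \<open>ln 0\<close>.\<close>

lemma mult_exp_ln_le:
  fixes g t :: real
  assumes "0 \<le> g" "0 \<le> t" "t \<le> 1"
  shows "g * exp (- ((1 - t) * ln g)) \<le> t * g + (1 - t)"
proof (cases "g = 0")
  case False
  define s where "s = exp (t * ln g)"
  have g: "g = exp (ln g)" using False assms by simp
  have "s * (1 + (1 - t) * ln g) \<le> s * exp ((1 - t) * ln g)"
    unfolding s_def by (intro mult_left_mono exp_ge_add_one_self) auto
  also have "\<dots> = g" using g by (simp add: s_def exp_add[symmetric] algebra_simps)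
  finally have 1: "t * (s * (1 + (1 - t) * ln g)) \<le> t * g" using assms by (intro mult_left_mono)
  have "s * (1 + (- (t * ln g))) \<le> s * exp (- (t * ln g))"
    unfolding s_def by (intro mult_left_mono exp_ge_add_one_self) auto
  also have "\<dots> = 1" by (simp add: s_def exp_add[symmetric])
  finally have 2: "(1 - t) * (s * (1 + (- (t * ln g)))) \<le> (1 - t) * 1" using assms by (intro mult_left_mono) auto
  have "g * exp (- ((1 - t) * ln g)) = exp (ln g + - ((1 - t) * ln g))"
    unfolding exp_add using g by simp
  also have "ln g + - ((1 - t) * ln g) = t * ln g" by (simp add: algebra_simps)
  finally have "g * exp (- ((1 - t) * ln g)) = s" by (simp add: s_def)
  also have "s = t * (s * (1 + (1 - t) * ln g)) + (1 - t) * (s * (1 + (- (t * ln g))))"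
    by (simp add: algebra_simps)
  finally show ?thesis using 1 2 by simp
qed (use assms in simp)

text \<open>Let g be the density of \<open>Q\<close> relative to \<open>P\<close>. Relative to
  \<open>P\<close>, the tilted measure has density g^t and the mixture has density t g + (1 - t), so
  \<open>mult_exp_ln_le\<close> compares them pointwise. It supplies the hypothesis
  \<open>dom\<close> with a \<open>\<phi>\<close> whose mean is only 1 - t times the divergence of
  \<open>Q\<close> from \<open>P\<close>.\<close>

lemma mixture_dominates_tilted:
  assumes P: "P \<in> probs S" and Q: "Q \<in> probs S" and ac: "absolutely_continuous P Q"
    and t: "t \<in> {0..1}" and B: "B \<in> sets (borel_on S)"
  shows "(\<integral>\<^sup>+ x. ennreal (exp (- ((1 - t) * entropy_density (exp 1) P Q x))) * indicator B x \<partial>Q)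
           \<le> emeasure (mixture t Q P) B"
proof -
  interpret P: prob_space P using P by (simp add: in_probs_iff)
  interpret Q: prob_space Q using Q by (simp add: in_probs_iff)
  have s: "sets Q = sets P" "sets P = sets (borel_on S)" using P Q by (auto simp: in_probs_iff)
  have B'[measurable]: "B \<in> sets P" using B s by simp
  let ?\<rho> = "RN_deriv P Q" and ?\<phi> = "\<lambda>x. (1 - t) * entropy_density (exp 1) P Q x"
  have d: "density P ?\<rho> = Q" using ac s(1) by (rule P.density_RN_deriv)
  \<comment> \<open>\<open>entropy_density\<close> passes through \<open>enn2real\<close>, so the
    densities are compared only where \<open>?\<rho>\<close> is finite.\<close>
  have fin: "AE x in P. ?\<rho> x \<noteq> \<infinity>"
    using P.RN_deriv_finite[OF Q.sigma_finite_measure_axioms ac s(1)] .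
  have [measurable]: "entropy_density (exp 1) P Q \<in> borel_measurable P"
    unfolding entropy_density_def comp_def by measurable
  have "(\<integral>\<^sup>+ x. ennreal (exp (- ?\<phi> x)) * indicator B x \<partial>Q) = (\<integral>\<^sup>+ x. ennreal (exp (- ?\<phi> x)) * indicator B x \<partial>density P ?\<rho>)"
    by (simp only: d)
  also have "\<dots> = (\<integral>\<^sup>+ x. ?\<rho> x * (ennreal (exp (- ?\<phi> x)) * indicator B x) \<partial>P)"
    by (rule nn_integral_density) measurable
  also have "\<dots> \<le> (\<integral>\<^sup>+ x. ennreal t * (?\<rho> x * indicator B x) + ennreal (1 - t) * indicator B x \<partial>P)"
  proof (rule nn_integral_mono_AE, use fin in eventually_elim)
    fix x assume "?\<rho> x \<noteq> \<infinity>"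
    define g where "g = enn2real (?\<rho> x)"
    have \<rho>: "?\<rho> x = ennreal g" "0 \<le> g" using \<open>?\<rho> x \<noteq> \<infinity>\<close> by (auto simp: g_def less_top)
    have \<phi>: "?\<phi> x = (1 - t) * ln g" by (simp add: entropy_density_def g_def log_def)
    have "ennreal (g * exp (- ((1 - t) * ln g))) \<le> ennreal (t * g + (1 - t))"
      using mult_exp_ln_le[OF \<rho>(2), of t] t by (intro ennreal_leI) auto
    then show "?\<rho> x * (ennreal (exp (- ?\<phi> x)) * indicator B x) \<le> ennreal t * (?\<rho> x * indicator B x) + ennreal (1 - t) * indicator B x"
      unfolding \<phi> \<rho>(1) using \<rho>(2) t by (auto simp: indicator_def ennreal_mult)
  qed
  also have "\<dots> = ennreal t * (\<integral>\<^sup>+ x. ?\<rho> x * indicator B x \<partial>P) + ennreal (1 - t) * emeasure P B"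
    by (subst nn_integral_add) (auto simp: nn_integral_cmult)
  also have "(\<integral>\<^sup>+ x. ?\<rho> x * indicator B x \<partial>P) = emeasure (density P ?\<rho>) B"
    by (rule emeasure_density[symmetric]) measurable
  also have "\<dots> = emeasure Q B" by (simp only: d)
  also have "ennreal t * emeasure Q B + ennreal (1 - t) * emeasure P B = emeasure (mixture t Q P) B"
    using s B' by (intro emeasure_mixture[symmetric]) auto
  finally show ?thesis .
qed

lemma continuous_measurable_bounded:
  fixes f :: "'a::topological_space \<Rightarrow> real"
  assumes "compact S" "continuous_on S f"
  shows "f \<in> borel_measurable (borel_on S)" "bounded (f ` S)"
  using assms borel_measurable_continuous_on_restrict compact_imp_bounded[OF compact_continuous_image] by auto

lemma dro_predictor_const: "dro_predictor A (\<lambda>_. f) x p = (SUP P\<in>A p. integral\<^sup>L P f)"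
  by (simp add: dro_predictor_def cost_def)

text \<open>Sanov's lower bound with \<open>k\<close> in the role of the divergence. The threshold
  \<open>N * (k + e)\<close> in \<open>product_measure_lower_bound\<close> exceeds the mean of the
  log-likelihood by at least \<open>N * e\<close>. As the event has probability tending to 1 under
  \<open>Q\<close>, this excess eventually absorbs the constants and the bracket is at least
  1.\<close>

lemma empirical_event_lower_bound:
  fixes S :: "'a::second_countable_topology set"
  assumes U: "openin (weak_topology S) U" and Q: "Q \<in> U" and P: "P \<in> probs S"
    and int: "integrable Q \<phi>" "integral\<^sup>L Q \<phi> \<le> k" and "k \<ge> 0" "e > 0"
    and dom: "\<And>B. B \<in> sets (borel_on S) \<Longrightarrow> (\<integral>\<^sup>+ x. ennreal (exp (- \<phi> x)) * indicator B x \<partial>Q) \<le> emeasure P B"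
  shows "\<forall>\<^sub>F N in sequentially. exp (- (real N * (k + e))) \<le>
     measure (PiM UNIV (\<lambda>_. P)) {\<omega> \<in> space (PiM UNIV (\<lambda>_. P)). empirical S N \<omega> \<in> U}"
proof -
  have Qp: "Q \<in> probs S" using openin_subset[OF U] Q by auto
  have s: "sets P = sets (borel_on S)" "sets Q = sets P" and pr: "prob_space P" "prob_space Q"
    using P Qp by (auto simp: in_probs_iff)
  let ?E = "\<lambda>N. {\<omega> \<in> space (PiM {..<N} (\<lambda>_. Q)). empirical S N \<omega> \<in> U}"
  let ?q = "\<lambda>N. measure (PiM {..<N} (\<lambda>_. Q)) (?E N)"
  have q: "?q \<longlonglongrightarrow> 1" by (rule empirical_measures_converge_in_probability[OF U Q])
  then have "(\<lambda>N. e * ?q N - (1 - ?q N) * (1 + k)) \<longlonglongrightarrow> e * 1 - (1 - 1) * (1 + k)"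
    by (intro tendsto_intros)
  then have ev: "\<forall>\<^sub>F N in sequentially. e * ?q N - (1 - ?q N) * (1 + k) > e / 2"
    using \<open>e > 0\<close> by (intro order_tendstoD(1)) auto
  show ?thesis
    \<comment> \<open>From \<open>2 / e\<close> on, the gain of \<open>e / 2\<close> per sample adds
      up to at least 1.\<close>
    using ev eventually_ge_at_top[of "nat \<lceil>2 / e\<rceil>"] eventually_gt_at_top[of 0]
  proof eventually_elim
    fix N assume 1: "e / 2 < e * ?q N - (1 - ?q N) * (1 + k)" and 2: "nat \<lceil>2 / e\<rceil> \<le> N" and N: "0 < N"
    have q1: "?q N \<le> 1" by (rule prob_space.prob_le_1[OF prob_space_PiM]) (rule pr)
    have sp: "space (PiM {..<N} (\<lambda>_. Q)) = space (PiM {..<N} (\<lambda>_. P))"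
      using sets_eq_imp_space_eq[OF s(2)] by (simp add: space_PiM)
    have "2 / e \<le> N" using 2 by linarith
    then have "1 \<le> N * (e / 2)" using \<open>e > 0\<close> by (simp add: field_simps)
    also have "\<dots> \<le> N * (e * ?q N - (1 - ?q N) * (1 + k))"
      using 1 by (intro mult_left_mono) auto
    also have "\<dots> = (N + N * (k + e)) * ?q N - N * k - N" by (simp add: algebra_simps)
    also have "\<dots> \<le> (1 + N * (k + e)) * ?q N - N * k - 1"
    proof -
      have "(real N - 1) * ?q N \<le> (real N - 1) * 1" using N q1 by (intro mult_left_mono) auto
      then show ?thesis by (simp add: algebra_simps)
    qed
    also have "\<dots> \<le> (1 + N * (k + e)) * ?q N - N * integral\<^sup>L Q \<phi> - 1"
      using int(2) by (simp add: mult_left_mono)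
    finally have "exp (- (N * (k + e))) * 1 \<le> exp (- (N * (k + e))) * ((1 + N * (k + e)) * ?q N - N * integral\<^sup>L Q \<phi> - 1)"
      by (intro mult_left_mono) auto
    also have "\<dots> \<le> measure (PiM {..<N} (\<lambda>_. P)) (?E N)"
      using product_measure_lower_bound[OF pr s(2) int(1) dom finite_lessThan sets_empirical_event(2)[OF N U Qp], of "N * (k + e)"] s(1)
      by simp
    also have "\<dots> = measure (PiM UNIV (\<lambda>_. P)) {\<omega> \<in> space (PiM UNIV (\<lambda>_. P)). empirical S N \<omega> \<in> U}"
      unfolding sp using measure_empirical_event[OF N U P] by simp
    finally show "exp (- (real N * (k + e))) \<le> measure (PiM UNIV (\<lambda>_. P)) {\<omega> \<in> space (PiM UNIV (\<lambda>_. P)). empirical S N \<omega> \<in> U}"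
      by simp
  qed
qed

section \<open>Feasible ambiguity sets contain the Kullback-Leibler ball\<close>

lemma KL_ball_integral_le:
  fixes S :: "'a::second_countable_topology set" and f :: "'a \<Rightarrow> real"
  assumes S: "compact S" and dro: "is_dro X S A" and feas: "reasonably_feasible X S A r" and "r > 0"
    and x: "x \<in> X" and Q: "Q \<in> probs S" and P: "P \<in> KL_ambiguity S r Q" and f: "continuous_on S f"
  shows "integral\<^sup>L P f \<le> (SUP R\<in>A Q. integral\<^sup>L R f)"
proof (rule ccontr)
  define c where "c p = (SUP R\<in>A p. integral\<^sup>L R f)" for p
  assume "\<not> integral\<^sup>L P f \<le> (SUP R\<in>A Q. integral\<^sup>L R f)"
  then have less: "c Q < integral\<^sup>L P f" by (simp add: c_def)
  note fm = continuous_measurable_bounded[OF S f]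
  have Pp: "P \<in> probs S" and ac: "absolutely_continuous P Q" and iQ: "integrable Q (entropy_density (exp 1) P Q)"
    and KL: "integral\<^sup>L Q (entropy_density (exp 1) P Q) \<le> r"
    using P by (auto simp: KL_ambiguity_def D_KL_def KL_divergence_def split: if_splits)
  obtain b where b: "\<And>\<xi>. \<xi> \<in> S \<Longrightarrow> b \<le> f \<xi>" 
    using bounded_imp_bdd_below[OF fm(2)] by (auto simp: bdd_below_def)
  have loss: "loss X S (\<lambda>_. f)" using b unfolding loss_def by blast
  \<comment> \<open>\<open>P\<close> may have divergence exactly \<open>r\<close>; mixing in a little of \<open>Q\<close> makes it strictly smaller while
    keeping the cost above \<open>c Q\<close>.\<close>
  define \<delta> where "\<delta> = integral\<^sup>L P f - c Q"
  define m where "m = \<bar>c Q - integral\<^sup>L Q f\<bar>"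
  \<comment> \<open>Passing from \<open>P\<close> to \<open>R\<close> lowers the cost by at most
    \<open>t * (\<delta> + m)\<close>; this choice makes that exactly half of the excess
    \<open>\<delta>\<close>.\<close>
  define t where "t = \<delta> / (2 * (\<delta> + m))"
  have \<delta>: "\<delta> > 0" "m \<ge> 0" using less by (auto simp: \<delta>_def m_def)
  have t: "0 < t" "t < 1" "t * (\<delta> + m) = \<delta> / 2"
    using \<delta> by (auto simp: t_def field_simps)
  define R where "R = mixture t Q P"
  have Rp: "R \<in> probs S" unfolding R_def using Q Pp t by (intro mixture_in_probs) auto
  have "c Q < integral\<^sup>L R f"
  proof -
    have "integral\<^sup>L R f = t * integral\<^sup>L Q f + (1 - t) * integral\<^sup>L P f"
      unfolding R_def using Q Pp t fm by (intro integral_mixture) auto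
    also have "\<dots> = c Q + \<delta> - t * (\<delta> + (c Q - integral\<^sup>L Q f))"
      by (simp add: \<delta>_def algebra_simps)
    finally have "integral\<^sup>L R f = c Q + \<delta> - t * (\<delta> + (c Q - integral\<^sup>L Q f))" .
    moreover have "t * (\<delta> + (c Q - integral\<^sup>L Q f)) \<le> t * (\<delta> + m)"
      using t by (intro mult_left_mono) (auto simp: m_def)
    ultimately have "c Q + \<delta> - t * (\<delta> + m) \<le> integral\<^sup>L R f" by linarith
    then show ?thesis using t(3) \<delta> by linarith
  qed
  define U where "U = {p \<in> probs S. c p < integral\<^sup>L R f}"
  have "continuous_loss X S (\<lambda>_. f)" using loss f by (simp add: continuous_loss_def)
  then have "usc_map (weak_topology S) (dro_predictor A (\<lambda>_. f) x)"
    using dro x by (simp add: is_dro_def)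
  then have U: "openin (weak_topology S) U"
    by (simp add: usc_map_def U_def c_def dro_predictor_const)
  have QU: "Q \<in> U" using Q \<open>c Q < integral\<^sup>L R f\<close> by (simp add: U_def)
  let ?p = "disappointment_prob X S A (\<lambda>_. f) R"
  have p: "?p N = measure (PiM UNIV (\<lambda>_. R)) {\<omega> \<in> space (PiM UNIV (\<lambda>_. R)). empirical S N \<omega> \<in> U}" if N: "N > 0" for N
  proof -
    have "empirical S N \<omega> \<in> probs S" if "\<omega> \<in> space (PiM UNIV (\<lambda>_. R))" for \<omega>
      using that N by (intro empirical_in_probs) (auto simp: space_PiM space_probs[OF Rp])
    \<comment> \<open>For a decision-free loss neither side of the comparison depends on the
      decision, so the existential over \<open>X\<close> is witnessed by \<open>x\<close>.\<close>
    then have "{\<omega> \<in> space (PiM UNIV (\<lambda>_. R)). \<exists>x\<in>X. cost (\<lambda>_. f) x R > dro_predictor A (\<lambda>_. f) x (empirical S N \<omega>)} =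
      {\<omega> \<in> space (PiM UNIV (\<lambda>_. R)). empirical S N \<omega> \<in> U}"
      using x by (auto simp: U_def c_def cost_def dro_predictor_const)
    then show ?thesis by (simp add: disappointment_prob_def Let_def)
  qed
  \<comment> \<open>Mixing lowers the exponent from \<open>r\<close> by \<open>t * r\<close>. Half
    of this is spent on the error in Sanov's bound, and the other half contradicts the rate
    \<open>r\<close>.\<close>
  define e where "e = t * r / 2"
  have e: "e > 0" "(1 - t) * r + e = r - e" using t \<open>r > 0\<close> by (auto simp: e_def field_simps)
  have "\<forall>\<^sub>F N in sequentially. exp (- (real N * ((1 - t) * r + e))) \<le>
     measure (PiM UNIV (\<lambda>_. R)) {\<omega> \<in> space (PiM UNIV (\<lambda>_. R)). empirical S N \<omega> \<in> U}"
  proof (rule empirical_event_lower_bound[OF U QU Rp _ _ _ e(1)])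
    show "integrable Q (\<lambda>x. (1 - t) * entropy_density (exp 1) P Q x)" using iQ by simp
    show "(\<integral>x. (1 - t) * entropy_density (exp 1) P Q x \<partial>Q) \<le> (1 - t) * r"
      using KL t by (simp add: mult_left_mono)
    show "0 \<le> (1 - t) * r" using t \<open>r > 0\<close> by simp
    show "(\<integral>\<^sup>+ x. ennreal (exp (- ((1 - t) * entropy_density (exp 1) P Q x))) * indicator B x \<partial>Q) \<le> emeasure R B"
      if "B \<in> sets (borel_on S)" for B
      unfolding R_def using t that by (intro mixture_dominates_tilted[OF Pp Q ac]) auto
  qed
  then have "\<forall>\<^sub>F N in sequentially. ereal (- (r - e)) \<le> ereal (1 / real N) * log0 (?p N)"
    using eventually_gt_at_top[of 0]
  proof eventually_elim
    fix N assume 1: "exp (- (real N * ((1 - t) * r + e))) \<le>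
       measure (PiM UNIV (\<lambda>_. R)) {\<omega> \<in> space (PiM UNIV (\<lambda>_. R)). empirical S N \<omega> \<in> U}" and N: "N > 0"
    then have 2: "exp (- (real N * (r - e))) \<le> ?p N" by (simp only: p e)
    then have pos: "0 < ?p N" using exp_gt_zero less_le_trans by blast
    have "- (real N * (r - e)) \<le> ln (?p N)" using 2 pos by (simp add: ln_ge_iff)
    then have "- (r - e) \<le> 1 / real N * ln (?p N)" using N by (simp add: field_simps)
    then show "ereal (- (r - e)) \<le> ereal (1 / real N) * log0 (?p N)"
      using pos by (simp add: log0_def)
  qed
  then have "ereal (- (r - e)) \<le> limsup (\<lambda>N. ereal (1 / real N) * log0 (?p N))"
    by (intro le_Limsup) auto
  also have "\<dots> \<le> (SUP P\<in>probs S. limsup (\<lambda>N. ereal (1 / real N) * log0 (disappointment_prob X S A (\<lambda>_. f) P N)))"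
    using Rp by (rule SUP_upper)
  also have "\<dots> \<le> ereal (- r)"
    using feas loss f unfolding reasonably_feasible_def decision_free_def by blast
  finally show False using e(1) by simp
qed

lemma KL_ambiguity_subset:
  fixes S :: "'a::euclidean_space set"
  assumes S: "compact S" and dro: "is_dro X S A" and feas: "reasonably_feasible X S A r" and "r > 0"
    and x: "x \<in> X" and Q: "Q \<in> probs S"
  shows "KL_ambiguity S r Q \<subseteq> A Q"
proof
  fix P assume P: "P \<in> KL_ambiguity S r Q"
  have Pp: "P \<in> probs S" using P by (simp add: KL_ambiguity_def)
  have A: "A Q \<subseteq> probs S" "A Q \<noteq> {}" "convex_measures (A Q)" "closedin (weak_topology S) (A Q)"
    using dro Q by (auto simp: is_dro_def)
  show "P \<in> A Q"
  proof (rule closed_under_wasserstein_limits[OF S A(4) Pp], rule ccontr)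
    fix \<eta> :: real assume "\<eta> > 0" and far: "\<not> (\<exists>R\<in>A Q. wasserstein S P R < ennreal \<eta>)"
    then obtain F where F: "\<And>x y. \<bar>F x - F y\<bar> \<le> norm (x - y)" 
      "\<And>R. R \<in> A Q \<Longrightarrow> \<eta> / 2 \<le> integral\<^sup>L P F - integral\<^sup>L R F"
      using wasserstein_separation[OF S Pp A(1-3), of \<eta> "\<eta> / 2"] by (auto simp: not_less)
    have "continuous_on S F" using lipschitz_measurable_bounded(1)[OF S, of F 1] F(1) by simp
    then have "integral\<^sup>L P F \<le> (SUP R\<in>A Q. integral\<^sup>L R F)"
      by (rule KL_ball_integral_le[OF S dro feas \<open>r > 0\<close> x Q P])
    also have "\<dots> \<le> integral\<^sup>L P F - \<eta> / 2"
      using A(2) F(2) by (intro cSUP_least) fastforce+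
    finally show False using \<open>\<eta> > 0\<close> by simp
  qed
qed

text \<open>Makes the ball nonempty, without which the real-valued supremum in its predictor would
  be arbitrary. Integrability has to be checked separately, because \<open>D_KL\<close> is infinite
  without it.\<close>

lemma KL_ambiguity_refl:
  assumes "Q \<in> probs S" "r \<ge> 0"
  shows "Q \<in> KL_ambiguity S r Q"
proof -
  interpret prob_space Q using assms by (simp add: in_probs_iff)
  have "AE x in Q. 1 = RN_deriv Q Q x"
    by (rule RN_deriv_unique) (auto simp: density_1)
  then have *: "AE x in Q. entropy_density (exp 1) Q Q x = 0"
    by eventually_elim (simp add: entropy_density_def flip: One_nat_def)
  have "entropy_density (exp 1) Q Q \<in> borel_measurable Q"
    unfolding entropy_density_def comp_def by measurable
  then have "integrable Q (entropy_density (exp 1) Q Q)"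
    using integrable_cong_AE[OF _ _ *] by simp
  then show ?thesis
    using assms by (simp add: KL_ambiguity_def D_KL_def KL_same_eq_0 absolutely_continuous_def)
qed

subsection \<open>Worst-case costs\<close>

lemma bdd_above_integrals:
  fixes f :: "'a::topological_space \<Rightarrow> real"
  assumes A: "A \<subseteq> probs S" and f: "f \<in> borel_measurable (borel_on S)" "bounded (f ` S)"
  shows "bdd_above ((\<lambda>P. integral\<^sup>L P f) ` A)"
proof -
  obtain B where B: "\<And>x. x \<in> S \<Longrightarrow> \<bar>f x\<bar> \<le> B" using f(2) by (auto simp: bounded_iff)
  have "integral\<^sup>L P f \<le> B" if "P \<in> A" for P
  proof -
    have P: "P \<in> probs S" using A that by auto
    interpret prob_space P using P by (simp add: in_probs_iff)
    have "f x \<le> B" if "x \<in> S" for x using B[OF that] by linarith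
    then have "integral\<^sup>L P f \<le> (\<integral>x. B \<partial>P)"
      using integrable_probs[OF P f] space_probs[OF P] by (intro integral_mono) auto
    then show ?thesis by (simp add: prob_space)
  qed
  then show ?thesis by (auto intro!: bdd_aboveI)
qed

text \<open>Each \<open>P\<close> is matched with a \<open>Q\<close> in \<open>B\<close> that is
  closest up to \<open>e / L\<close>, which costs \<open>e\<close> in the integrals. For an infinite
  distance the bound is trivial because \<open>L\<close> is positive; in \<open>ennreal\<close> the
  product of 0 with infinity would be 0.\<close>

lemma worst_case_cost_diff_le:
  fixes S :: "'a::{real_normed_vector, second_countable_topology} set"
  assumes A: "A \<subseteq> probs S" "A \<noteq> {}" and B: "B \<subseteq> probs S" "B \<noteq> {}"
    and f: "f \<in> borel_measurable (borel_on S)" "bounded (f ` S)"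
    and lip: "\<And>x y. x \<in> S \<Longrightarrow> y \<in> S \<Longrightarrow> \<bar>f x - f y\<bar> \<le> L * norm (x - y)" and L: "L > 0"
  shows "ennreal ((SUP P\<in>A. integral\<^sup>L P f) - (SUP Q\<in>B. integral\<^sup>L Q f)) \<le>
           ennreal L * (SUP P\<in>A. INF Q\<in>B. wasserstein S P Q)"
proof (cases "SUP P\<in>A. INF Q\<in>B. wasserstein S P Q")
  case (real k)
  have "(SUP P\<in>A. integral\<^sup>L P f) \<le> (SUP Q\<in>B. integral\<^sup>L Q f) + L * k"
  proof (rule field_le_epsilon)
    fix e :: real assume "e > 0"
    show "(SUP P\<in>A. integral\<^sup>L P f) \<le> (SUP Q\<in>B. integral\<^sup>L Q f) + L * k + e"
    proof (rule cSUP_least[OF A(2)])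
      fix P assume P: "P \<in> A"
      have "(INF Q\<in>B. wasserstein S P Q) \<le> ennreal k"
        unfolding real(2)[symmetric] using P by (rule SUP_upper)
      also have "\<dots> < ennreal (k + e / L)" using \<open>e > 0\<close> L real(1) by (intro ennreal_lessI add_nonneg_pos divide_pos_pos) auto
      finally obtain Q where Q: "Q \<in> B" "wasserstein S P Q < ennreal (k + e / L)"
        by (auto simp: INF_less_iff)
      have "ennreal \<bar>integral\<^sup>L P f - integral\<^sup>L Q f\<bar> \<le> ennreal L * wasserstein S P Q"
        by (rule wasserstein_ge_lipschitz[OF f lip L])
      also have "\<dots> \<le> ennreal L * ennreal (k + e / L)" using Q(2) by (intro mult_left_mono) auto
      also have "\<dots> = ennreal (L * (k + e / L))" using L real(1) \<open>e > 0\<close> by (intro ennreal_mult[symmetric]) auto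
      finally have "\<bar>integral\<^sup>L P f - integral\<^sup>L Q f\<bar> \<le> L * (k + e / L)"
        using L real(1) \<open>e > 0\<close> by (subst (asm) ennreal_le_iff) auto
      also have "\<dots> = L * k + e" using L by (simp add: field_simps)
      finally have "integral\<^sup>L P f \<le> integral\<^sup>L Q f + L * k + e" by linarith
      moreover have "integral\<^sup>L Q f \<le> (SUP Q\<in>B. integral\<^sup>L Q f)"
        using bdd_above_integrals[OF B(1) f] Q(1) by (intro cSUP_upper)
      ultimately show "integral\<^sup>L P f \<le> (SUP Q\<in>B. integral\<^sup>L Q f) + L * k + e" by linarith
    qed
  qed
  then have "ennreal ((SUP P\<in>A. integral\<^sup>L P f) - (SUP Q\<in>B. integral\<^sup>L Q f)) \<le> ennreal (L * k)"
    by (intro ennreal_leI) simp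
  then show ?thesis using L real by (simp add: ennreal_mult)
next
  case top
  then show ?thesis unfolding top using L by (simp add: ennreal_mult_top)
qed

lemma directed_distance_le_worst_case_cost_diff:
  fixes S :: "'a::euclidean_space set"
  assumes S: "compact S" and A: "A \<subseteq> probs S" and B: "B \<subseteq> probs S" "B \<noteq> {}" "convex_measures B"
  shows "(SUP P\<in>A. INF Q\<in>B. wasserstein S P Q) \<le>
     (SUP F\<in>{F. \<forall>x y. \<bar>F x - F y\<bar> \<le> norm (x - y)}.
        ennreal ((SUP P\<in>A. integral\<^sup>L P F) - (SUP Q\<in>B. integral\<^sup>L Q F)))" (is "_ \<le> ?R")
proof (rule SUP_least, rule ccontr)
  fix P assume P: "P \<in> A" and "\<not> (INF Q\<in>B. wasserstein S P Q) \<le> ?R"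
  then have "?R < (INF Q\<in>B. wasserstein S P Q)" by (simp only: not_le)
  \<comment> \<open>Two intermediate values, as separation loses an arbitrarily small amount:
    \<open>z\<close> still bounds all distances from below, and \<open>y\<close> is what the
    potential attains, still above \<open>?R\<close>.\<close>
  from dense[OF this] obtain z where z: "?R < z" "z < (INF Q\<in>B. wasserstein S P Q)" by blast
  from dense[OF z(1)] obtain y where y: "?R < y" "y < z" by blast
  obtain \<delta> where \<delta>: "z = ennreal \<delta>" "0 \<le> \<delta>" using z(2) by (cases z) auto
  obtain \<delta>' where \<delta>': "y = ennreal \<delta>'" "0 \<le> \<delta>'" using y(2) by (cases y) auto
  have "\<delta>' < \<delta>" using y(2) \<delta> \<delta>' by (simp add: ennreal_less_iff)
  moreover have "ennreal \<delta> \<le> wasserstein S P Q" if "Q \<in> B" for Q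
    using less_le_trans[OF z(2) INF_lower[OF that]] \<delta>(1) by simp
  ultimately obtain F where F: "\<And>x y. \<bar>F x - F y\<bar> \<le> norm (x - y)"
      "\<And>Q. Q \<in> B \<Longrightarrow> \<delta>' \<le> integral\<^sup>L P F - integral\<^sup>L Q F"
    using wasserstein_separation[OF S subsetD[OF A P] B, of \<delta> \<delta>'] by metis
  have "(SUP Q\<in>B. integral\<^sup>L Q F) \<le> integral\<^sup>L P F - \<delta>'"
    using B(2) F(2) by (intro cSUP_least) fastforce+
  moreover have "integral\<^sup>L P F \<le> (SUP P\<in>A. integral\<^sup>L P F)"
  proof (rule cSUP_upper[OF P bdd_above_integrals[OF A]])
    show "F \<in> borel_measurable (borel_on S)" "bounded (F ` S)"
      using lipschitz_measurable_bounded[OF S, of F 1] F(1) by auto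
  qed
  ultimately have "y \<le> ennreal ((SUP P\<in>A. integral\<^sup>L P F) - (SUP Q\<in>B. integral\<^sup>L Q F))"
    unfolding \<delta>'(1) by (intro ennreal_leI) simp
  also have "\<dots> \<le> ?R" using F(1) by (intro SUP_upper) auto
  finally show False using y(1) by simp
qed

text \<open>The upper bound comes from covering \<open>S\<close> by the open sets where f < n. Upper
  semicontinuity gives nothing from below, so \<open>b\<close> is assumed. With both bounds,
  integrals and suprema for such losses have no default values.\<close>

lemma usc_measurable_bounded:
  fixes S :: "'a::topological_space set"
  assumes S: "compact S" and usc: "usc_map (top_of_set S) f" and b: "\<And>\<xi>. \<xi> \<in> S \<Longrightarrow> b \<le> f \<xi>"
  shows "f \<in> borel_measurable (borel_on S)" "bounded (f ` S)"
proof -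
  have "\<exists>T. open T \<and> {\<xi> \<in> S. f \<xi> < a} = S \<inter> T" for a
    using usc by (auto simp: usc_map_def openin_open)
  then obtain T where T: "\<And>a. open (T a)" "\<And>a. {\<xi> \<in> S. f \<xi> < a} = S \<inter> T a" by metis
  show "f \<in> borel_measurable (borel_on S)"
  proof (rule borel_measurableI_less)
    fix a
    show "{\<xi> \<in> space (borel_on S). f \<xi> < a} \<in> sets (borel_on S)"
      using T(1)[of a] by (auto simp: T(2) sets_restrict_space)
  qed
  have "S \<subseteq> (\<Union>n::nat. T (real n))"
  proof
    fix \<xi> assume "\<xi> \<in> S"
    moreover obtain n :: nat where "f \<xi> < real n" using reals_Archimedean2 by blast
    ultimately have "\<xi> \<in> S \<inter> T (real n)" unfolding T(2)[symmetric] by simp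
    then show "\<xi> \<in> (\<Union>n::nat. T (real n))" by blast
  qed
  then obtain C where C: "finite C" "S \<subseteq> (\<Union>n\<in>C. T (real n))"
    using compactE_image[OF S, of UNIV "\<lambda>n. T (real n)"] T(1) by metis
  have "f \<xi> \<le> real (Max C)" if "\<xi> \<in> S" for \<xi>
  proof -
    obtain n where n: "n \<in> C" "\<xi> \<in> T (real n)" using C(2) \<open>\<xi> \<in> S\<close> by auto
    then have "\<xi> \<in> {\<xi> \<in> S. f \<xi> < real n}" unfolding T(2) using \<open>\<xi> \<in> S\<close> by simp
    then have "f \<xi> < real n" by simp
    moreover have "n \<le> Max C" using n(1) C(1) by simp
    ultimately show ?thesis by linarith
  qed
  then have "f ` S \<subseteq> {b..real (Max C)}" using b by auto
  then show "bounded (f ` S)" by (rule bounded_subset[OF bounded_closed_interval])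
qed

lemma lip_const_bound:
  assumes "lip_const S f \<le> ennreal L" "0 \<le> L" "\<xi>' \<in> S" "\<xi> \<in> S"
  shows "\<bar>f \<xi>' - f \<xi>\<bar> \<le> L * norm (\<xi>' - \<xi>)"
proof (cases "\<xi>' = \<xi>")
  case False
  have "ennreal (\<bar>f \<xi>' - f \<xi>\<bar> / norm (\<xi>' - \<xi>)) \<le> lip_const S f"
    unfolding lip_const_def using assms(3,4) False by (intro SUP_upper2[of "(\<xi>', \<xi>)"]) auto
  also note assms(1)
  finally have "\<bar>f \<xi>' - f \<xi>\<bar> / norm (\<xi>' - \<xi>) \<le> L" using assms(2) by (subst (asm) ennreal_le_iff) auto
  then show ?thesis using False by (simp add: field_simps)
qed simp

theorem theorem7p2:
  fixes X :: "(real ^ 'm) set" and S :: "(real ^ 'd) set"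
  assumes "X \<noteq> {}" and "compact S"
  shows
    "(\<forall>\<A>\<^sub>1 \<A>\<^sub>2. is_dro X S \<A>\<^sub>1 \<longrightarrow> is_dro X S \<A>\<^sub>2 \<longrightarrow>
       (\<forall>x\<in>X. \<forall>Phat\<in>probs S.
          (SUP \<l>\<in>lipschitz1_losses X S.
             ennreal \<bar>dro_predictor \<A>\<^sub>1 \<l> x Phat - dro_predictor \<A>\<^sub>2 \<l> x Phat\<bar>)
          = max (SUP P\<in>\<A>\<^sub>1 Phat. INF Q\<in>\<A>\<^sub>2 Phat. wasserstein S P Q)
                (SUP Q\<in>\<A>\<^sub>2 Phat. INF P\<in>\<A>\<^sub>1 Phat. wasserstein S P Q)))
     \<and>
     (\<forall>r \<A>\<^sub>1. r > 0 \<longrightarrow> is_dro X S \<A>\<^sub>1 \<longrightarrow> reasonably_feasible X S \<A>\<^sub>1 r \<longrightarrow>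
       (\<forall>\<l>. usc_loss X S \<l> \<longrightarrow> (\<forall>x\<in>X. \<forall>Phat\<in>probs S.
          0 \<le> dro_predictor \<A>\<^sub>1 \<l> x Phat - dro_predictor (KL_ambiguity S r) \<l> x Phat \<and>
          ennreal (dro_predictor \<A>\<^sub>1 \<l> x Phat - dro_predictor (KL_ambiguity S r) \<l> x Phat)
            \<le> (if lip_const S (\<l> x) = \<infinity> then \<infinity>
               else lip_const S (\<l> x) *
                    (SUP P\<in>\<A>\<^sub>1 Phat. INF Q\<in>KL_ambiguity S r Phat. wasserstein S P Q)))))"
  (is "?part1 \<and> ?part2")
proof (rule conjI)
  note S = \<open>compact S\<close>
  show ?part1
  proof (intro allI impI ballI)
    fix A\<^sub>1 A\<^sub>2 x p
    assume dro: "is_dro X S A\<^sub>1" "is_dro X S A\<^sub>2" and x: "x \<in> X" and p: "p \<in> probs S"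
    have A: "A\<^sub>1 p \<subseteq> probs S" "A\<^sub>1 p \<noteq> {}" "convex_measures (A\<^sub>1 p)" "A\<^sub>2 p \<subseteq> probs S" "A\<^sub>2 p \<noteq> {}" "convex_measures (A\<^sub>2 p)"
      using dro p by (auto simp: is_dro_def)
    let ?c1 = "\<lambda>\<l>. dro_predictor A\<^sub>1 \<l> x p" and ?c2 = "\<lambda>\<l>. dro_predictor A\<^sub>2 \<l> x p"
    let ?L = "SUP \<l>\<in>lipschitz1_losses X S. ennreal \<bar>?c1 \<l> - ?c2 \<l>\<bar>"
    let ?H = "\<lambda>A B. SUP P\<in>A. INF Q\<in>B. wasserstein S P Q"
    have sym: "(SUP Q\<in>A\<^sub>2 p. INF P\<in>A\<^sub>1 p. wasserstein S P Q) = ?H (A\<^sub>2 p) (A\<^sub>1 p)"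
      by (intro SUP_cong INF_cong refl wasserstein_commute)
    have upper: "ennreal \<bar>?c1 \<l> - ?c2 \<l>\<bar> \<le> max (?H (A\<^sub>1 p) (A\<^sub>2 p)) (?H (A\<^sub>2 p) (A\<^sub>1 p))"
      if "\<l> \<in> lipschitz1_losses X S" for \<l>
    proof -
      have lip: "\<And>\<xi> \<xi>'. \<xi> \<in> S \<Longrightarrow> \<xi>' \<in> S \<Longrightarrow> \<bar>\<l> x \<xi> - \<l> x \<xi>'\<bar> \<le> 1 * norm (\<xi> - \<xi>')"
        using that x by (auto simp: lipschitz1_losses_def)
      note f = lipschitz_measurable_bounded(2,3)[OF S lip]
      have 12: "ennreal (?c1 \<l> - ?c2 \<l>) \<le> ?H (A\<^sub>1 p) (A\<^sub>2 p)"
        using worst_case_cost_diff_le[OF A(1,2,4,5) f lip] by (simp add: dro_predictor_def cost_def)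
      have 21: "ennreal (?c2 \<l> - ?c1 \<l>) \<le> ?H (A\<^sub>2 p) (A\<^sub>1 p)"
        using worst_case_cost_diff_le[OF A(4,5,1,2) f lip] by (simp add: dro_predictor_def cost_def)
      show ?thesis
        using 12 21 by (cases "?c1 \<l> \<le> ?c2 \<l>") (auto simp: abs_if le_max_iff_disj)
    qed
    \<comment> \<open>A potential \<open>F\<close> becomes an admissible loss by ignoring the
      decision, so each directed distance is approached along decision-free losses.\<close>
    have lower: "ennreal \<bar>(SUP P\<in>A\<^sub>1 p. integral\<^sup>L P F) - (SUP P\<in>A\<^sub>2 p. integral\<^sup>L P F)\<bar> \<le> ?L"
      if F: "\<forall>x y. \<bar>F x - F y\<bar> \<le> norm (x - y)" for F
    proof -
      have "bounded (F ` S)" using lipschitz_measurable_bounded(3)[OF S, of F 1] F by simp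
      then obtain b where "\<And>\<xi>. \<xi> \<in> S \<Longrightarrow> b \<le> F \<xi>"
        using bounded_imp_bdd_below by (fastforce simp: bdd_below_def)
      then have "(\<lambda>_. F) \<in> lipschitz1_losses X S"
        using F by (auto simp: lipschitz1_losses_def loss_def)
      then have "ennreal \<bar>?c1 (\<lambda>_. F) - ?c2 (\<lambda>_. F)\<bar> \<le> ?L" by (rule SUP_upper)
      then show ?thesis by (simp add: dro_predictor_const)
    qed
    have "?H (A\<^sub>1 p) (A\<^sub>2 p) \<le> ?L"
    proof (rule order_trans[OF directed_distance_le_worst_case_cost_diff[OF S A(1,4,5,6)]], rule SUP_least)
      fix F :: "real ^ 'd \<Rightarrow> real" assume F: "F \<in> {F. \<forall>x y. \<bar>F x - F y\<bar> \<le> norm (x - y)}"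
      then show "ennreal ((SUP P\<in>A\<^sub>1 p. integral\<^sup>L P F) - (SUP P\<in>A\<^sub>2 p. integral\<^sup>L P F)) \<le> ?L"
        by (intro order_trans[OF ennreal_leI[OF abs_ge_self] lower]) simp
    qed
    moreover have "?H (A\<^sub>2 p) (A\<^sub>1 p) \<le> ?L"
    proof (rule order_trans[OF directed_distance_le_worst_case_cost_diff[OF S A(4,1,2,3)]], rule SUP_least)
      fix F :: "real ^ 'd \<Rightarrow> real" assume F: "F \<in> {F. \<forall>x y. \<bar>F x - F y\<bar> \<le> norm (x - y)}"
      then have "ennreal \<bar>(SUP P\<in>A\<^sub>2 p. integral\<^sup>L P F) - (SUP P\<in>A\<^sub>1 p. integral\<^sup>L P F)\<bar> \<le> ?L"
        by (subst abs_minus_commute) (rule lower, simp)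
      then show "ennreal ((SUP P\<in>A\<^sub>2 p. integral\<^sup>L P F) - (SUP P\<in>A\<^sub>1 p. integral\<^sup>L P F)) \<le> ?L"
        by (rule order_trans[OF ennreal_leI[OF abs_ge_self]])
    qed
    ultimately show "?L = max (?H (A\<^sub>1 p) (A\<^sub>2 p)) (SUP Q\<in>A\<^sub>2 p. INF P\<in>A\<^sub>1 p. wasserstein S P Q)"
      unfolding sym by (intro antisym SUP_least upper) auto
  qed
  show ?part2
  proof (intro allI impI ballI)
    fix r :: real and A \<l> x Q
    assume r: "r > 0" and dro: "is_dro X S A" and feas: "reasonably_feasible X S A r"
      and \<l>: "usc_loss X S \<l>" and x: "x \<in> X" and Q: "Q \<in> probs S"
    let ?K = "KL_ambiguity S r Q" and ?f = "\<l> x"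
    have A: "A Q \<subseteq> probs S" "A Q \<noteq> {}" using dro Q by (auto simp: is_dro_def)
    have K: "?K \<subseteq> A Q" by (rule KL_ambiguity_subset[OF S dro feas r x Q])
    have K0: "?K \<subseteq> probs S" "?K \<noteq> {}" using K A KL_ambiguity_refl[OF Q, of r] r by auto
    obtain b where b: "\<And>\<xi>. \<xi> \<in> S \<Longrightarrow> b \<le> ?f \<xi>"
      using \<l> x by (auto simp: usc_loss_def loss_def)
    have "usc_map (top_of_set S) ?f" using \<l> x by (simp add: usc_loss_def)
    note f = usc_measurable_bounded[OF S this b]
    let ?a = "SUP P\<in>A Q. integral\<^sup>L P ?f" and ?k = "SUP P\<in>?K. integral\<^sup>L P ?f"
    have eq: "dro_predictor A \<l> x Q - dro_predictor (KL_ambiguity S r) \<l> x Q = ?a - ?k"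
      by (simp add: dro_predictor_def cost_def)
    have "?k \<le> ?a" using K K0(2) bdd_above_integrals[OF A(1) f] by (intro cSUP_subset_mono) auto
    moreover have "ennreal (?a - ?k) \<le> lip_const S ?f * (SUP P\<in>A Q. INF R\<in>?K. wasserstein S P R)"
      if fin: "lip_const S ?f \<noteq> \<infinity>"
    proof -
      obtain L where L: "lip_const S ?f = ennreal L" "0 \<le> L" using fin by (cases "lip_const S ?f") auto
      have lip: "\<bar>?f \<xi> - ?f \<xi>'\<bar> \<le> L * norm (\<xi> - \<xi>')" if "\<xi> \<in> S" "\<xi>' \<in> S" for \<xi> \<xi>'
        using L that by (intro lip_const_bound) auto
      show ?thesis
      \<comment> \<open>\<open>worst_case_cost_diff_le\<close> asks for a positive constant. For
        \<open>L = 0\<close> the loss is constant on \<open>S\<close>, so both worst-case costs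
        equal its value at any point of \<open>S\<close>.\<close>
      proof (cases "L = 0")
        case True
        obtain \<xi>\<^sub>0 where \<xi>\<^sub>0: "\<xi>\<^sub>0 \<in> S" 
          using Q prob_space.not_empty[of Q] by (auto simp: in_probs_iff space_probs[OF Q])
        have "integral\<^sup>L P ?f = ?f \<xi>\<^sub>0" if P: "P \<in> probs S" for P
        proof -
          have "integral\<^sup>L P ?f = (\<integral>\<xi>. ?f \<xi>\<^sub>0 \<partial>P)"
            using lip[OF _ \<xi>\<^sub>0] True space_probs[OF P] by (intro Bochner_Integration.integral_cong) auto
          then show ?thesis using P by (simp add: in_probs_iff prob_space.prob_space)
        qed
        then have "?a = (SUP P\<in>A Q. ?f \<xi>\<^sub>0)" "?k = (SUP P\<in>?K. ?f \<xi>\<^sub>0)"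
          using A(1) K0(1) by (auto intro!: SUP_cong)
        then have "?a - ?k = 0" using A(2) K0(2) by simp
        then show ?thesis by simp
      next
        case False
        then show ?thesis
          using worst_case_cost_diff_le[OF A K0 f lip] L by simp
      qed
    qed
    ultimately show "0 \<le> dro_predictor A \<l> x Q - dro_predictor (KL_ambiguity S r) \<l> x Q \<and>
          ennreal (dro_predictor A \<l> x Q - dro_predictor (KL_ambiguity S r) \<l> x Q)
            \<le> (if lip_const S ?f = \<infinity> then \<infinity>
               else lip_const S ?f * (SUP P\<in>A Q. INF R\<in>?K. wasserstein S P R))"
      unfolding eq by simp
  qed
qed

end
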